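(* Let $\Xi_{we}(A)=W_e(A)$ be the essential numerical range. Let $\Omega=\Omega_\mathrm{N},\Omega_\mathrm{SA}$ or $\Omega_{\mathrm{B}}$ and let $i=1,2$. Then $$\Delta^G_2 \not\ni \{\Xi_{we},\Omega,\Lambda_i\} \in \Pi^A_2.$$ Furthermore, for $\mathbb{F}\in\{\mathbb{R},\mathbb{C}\}$ and a non-empty open set $U\subset\mathbb{F}$, let $\Xi_{poll}^{\mathbb{F}}(A,U)=1$ if $\overline{U}\cap(W_e(A)\backslash \mathrm{Sp}(A))\neq\emptyset$ and $\Xi_{poll}^{\mathbb{F}}(A,U)=0$ otherwise, where $U$ is presented to the algorithm as a countable union $U=\bigcup_{m\in\mathbb{N}}U_m$ of open balls. Then for $i=1,2$ the following classifications hold, valid also if we restrict to the case $U=U_1$ (a single ball) or to $U=U_1=\mathbb{F}$: $$\Delta^G_3 \not\ni \{\Xi_{poll}^{\mathbb{R}},\Omega_\mathrm{SA},\Lambda_i\} \in \Sigma^A_3, \qquad \Delta^G_3 \not\ni \{\Xi_{poll}^{\mathbb{C}},\Omega_{\mathrm{B}},\Lambda_i\} \in \Sigma^A_3.$$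
   Context: **Operators.** $\{e_i\}_{i\in\mathbb{N}}$ is the canonical basis of $\mathcal{H}=l^2(\mathbb{N})$ and $\mathrm{Sp}(A)$ is the spectrum. $\Omega_{\mathrm{B}}=\mathcal{B}(l^2(\mathbb{N}))$ (bounded operators); $\Omega_\mathrm{N}$: normal operators in $\Omega_\mathrm{B}$; $\Omega_\mathrm{SA}$: self-adjoint operators in $\Omega_\mathrm{B}$. For $A\in\Omega_\mathrm{B}$, $W(A)=\{\langle Ax,x\rangle:\|x\|=1\}$ and $W_e(A)=\bigcap_{B\in\Omega_K}\overline{W(A+B)}$, where $\Omega_K$ is the class of compact operators on $l^2(\mathbb{N})$. **Evaluation sets.** $\Lambda_1=\{A\mapsto\langle Ae_j,e_i\rangle: i,j\in\mathbb{N}\}$; $\Lambda_2=\Lambda_1\cup\{A\mapsto\langle Ae_j,Ae_i\rangle,\ A\mapsto\langle A^*e_j,A^*e_i\rangle: i,j\in\mathbb{N}\}$. For $\Xi_{poll}^{\mathbb{F}}$ the input is $A$ together with a sequence of open balls $\{U_m\}_{m\in\mathbb{N}}$ whose union is the non-empty open set $U\subset\mathbb{F}$: if $\mathbb{F}=\mathbb{R}$ each $U_m=(a_m,b_m)$ with $a_m,b_m\in\mathbb{Q}\cup\{\pm\infty\}$; if $\mathbb{F}=\mathbb{C}$ each $U_m$ is the open disc of radius $r_m\in\mathbb{Q}_+\cup\{\infty\}$ centred at $z_m\in\mathbb{Q}+i\mathbb{Q}$. The pointwise evaluations of the sequence $\{(a_m,b_m)\}$, respectively $\{(r_m,z_m)\}$,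 are added to $\Lambda_i$, and the notation $\{\Xi_{poll}^{\mathbb{F}},\Omega,\Lambda_i\}$ refers to this problem with $A\in\Omega$. **Computational problems.** A computational problem $\{\Xi,\Omega,\mathcal{M},\Lambda\}$ (abbreviated $\{\Xi,\Omega,\Lambda\}$) consists of a domain $\Omega$, a set $\Lambda$ of complex-valued functions on $\Omega$ separating points of $\Omega$, a metric space $(\mathcal{M},d)$ and a map $\Xi:\Omega\to\mathcal{M}$. For $\Xi_{we}$, $\mathcal{M}$ is the set of non-empty compact subsets of $\mathbb{C}$ with the Hausdorff metric; for $\Xi_{poll}^{\mathbb{F}}$, $\mathcal{M}=\{0,1\}$ with the discrete metric and the order $0<1$. A *general algorithm* is a map $\Gamma:\Omega\to\mathcal{M}$ such that for each $A\in\Omega$ there is a non-empty finite set $\Lambda_\Gamma(A)\subset\Lambda$ such that (i) $\Gamma(A)$ depends only on $\{h(A)\}_{h\in\Lambda_\Gamma(A)}$, and (ii) if $B\in\Omega$ satisfies $h(B)=h(A)$ for all $h\in\Lambda_\Gamma(A)$, then $\Lambda_\Gamma(B)=\Lambda_\Gamma(A)$ (hence $\Gamma(B)=\Gamma(A)$). A *tower of algorithms of height $k$* is a family of maps $\Gamma_{n_k},\Gamma_{n_k,n_{k-1}},\ldots,\Gamma_{n_k,\ldots,n_1}:\Omega\to\mathcal{M}$, $n_j\in\mathbb{N}$, where the $\Gamma_{n_k,\ldots,n_1}$ are general algorithms and for every $A$: $\Xi(A)=\lim_{n_k\to\infty}\Gamma_{n_k}(A)$ and $\Gamma_{n_k,\ldots,n_{j+1}}(A)=\lim_{n_j\to\infty}\Gamma_{n_k,\ldots,n_j}(A)$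 for $j=k-1,\ldots,1$. It has type $G$ (general) with no further restriction. It has type $A$ (arithmetic) if moreover $\Lambda$ is countable and for each $A$ the map $(n_k,\ldots,n_1)\mapsto\Gamma_{n_k,\ldots,n_1}(A)$ is recursive, i.e. executable by a Blum–Shub–Smale machine (finitely many arithmetic operations and comparisons) with input $(n_k,\ldots,n_1)$ and an oracle for $\{h(A)\}_{h\in\Lambda}$ (by a Turing machine with such an oracle if all the evaluations are in $\mathbb{Q}+i\mathbb{Q}$), the output being a finite string of complex numbers identified with an element of $\mathcal{M}$. **SCI hierarchy** ($\alpha\in\{G,A\}$, $m\ge1$). $\Delta_{m+1}^\alpha$: problems with a type $\alpha$ tower of height at most $m$. For the Hausdorff metric, $\Pi_m^\alpha$: problems in $\Delta_{m+1}^\alpha$ having a type $\alpha$ tower of height $m$ such that for every $A$ there are $X_{n_m}(A)\in\mathcal{M}$ with $\Xi(A)\subset X_{n_m}(A)$ and $d(X_{n_m}(A),\Gamma_{n_m}(A))\le2^{-n_m}$ (equivalently $\sup_{z\in\Xi(A)}\mathrm{dist}(z,\Gamma_{n_m}(A))\le2^{-n_m}$). For $\mathcal{M}=\{0,1\}$, $\Sigma_m^\alpha$: problems in $\Delta_{m+1}^\alpha$ having a type $\alpha$ tower of height $m$ with $\Gamma_{n_m}\to\Xi$ from below, i.e. $\Gamma_{n_m}\le\Xi$. "$\Delta\not\ni X\in\Pi$" means $X\notin\Delta$ and $X\in\Pi$. *)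

theory Defs
  imports "HOL-Analysis.Analysis" "HOL-Library.Nat_Bijection"
begin

section \<open>The Hilbert space of square-summable complex sequences\<close>

typedef ell2 = "{x :: nat \<Rightarrow> complex. summable (\<lambda>n. (cmod (x n))\<^sup>2)}"
  morphisms ell2_nth Abs_ell2
  by (rule exI[of _ "\<lambda>_. 0"]) simp

setup_lifting type_definition_ell2

lemma summable_cmod_sq: "summable (\<lambda>n. (cmod (ell2_nth x n))\<^sup>2)"
  using ell2_nth[of x] by simp

lemma summable_cmod_sq_add:
  assumes "summable (\<lambda>n. (cmod (f n))\<^sup>2)" "summable (\<lambda>n. (cmod (g n))\<^sup>2)"
  shows "summable (\<lambda>n. (cmod (f n + g n))\<^sup>2)"
proof (rule summable_comparison_test)
  show "summable (\<lambda>n. 2 * (cmod (f n))\<^sup>2 + 2 * (cmod (g n))\<^sup>2)"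
    using assms by (intro summable_add summable_mult)
  have "(cmod (f n + g n))\<^sup>2 \<le> 2 * (cmod (f n))\<^sup>2 + 2 * (cmod (g n))\<^sup>2" for n
  proof -
    have "(cmod (f n + g n))\<^sup>2 \<le> (cmod (f n) + cmod (g n))\<^sup>2"
      by (intro power_mono norm_triangle_ineq) simp
    also have "\<dots> \<le> 2 * (cmod (f n))\<^sup>2 + 2 * (cmod (g n))\<^sup>2"
      using zero_le_power2[of "cmod (f n) - cmod (g n)"]
      by (simp add: power2_sum power2_diff)
    finally show ?thesis .
  qed
  then show "\<exists>N. \<forall>n\<ge>N. norm ((cmod (f n + g n))\<^sup>2)
      \<le> 2 * (cmod (f n))\<^sup>2 + 2 * (cmod (g n))\<^sup>2"
    by auto
qed

lemma summable_ell2_prod: "summable (\<lambda>n. ell2_nth x n * cnj (ell2_nth y n))"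
proof (rule summable_comparison_test)
  show "summable (\<lambda>n. (cmod (ell2_nth x n))\<^sup>2 + (cmod (ell2_nth y n))\<^sup>2)"
    by (intro summable_add summable_cmod_sq)
  have "a * b \<le> a\<^sup>2 + b\<^sup>2" for a b :: real
  proof -
    have "2 * (a * b) \<le> a\<^sup>2 + b\<^sup>2"
      using zero_le_power2[of "a - b"] by (simp add: power2_diff)
    then show ?thesis
      using zero_le_power2[of a] zero_le_power2[of b] by linarith
  qed
  then show "\<exists>N. \<forall>n\<ge>N. norm (ell2_nth x n * cnj (ell2_nth y n))
      \<le> (cmod (ell2_nth x n))\<^sup>2 + (cmod (ell2_nth y n))\<^sup>2"
    by (auto simp: norm_mult)
qed

text \<open>The inner product is linear in its first argument.\<close>

definition cinner :: "ell2 \<Rightarrow> ell2 \<Rightarrow> complex" where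
  "cinner x y = (\<Sum>n. ell2_nth x n * cnj (ell2_nth y n))"

lift_definition scaleC :: "complex \<Rightarrow> ell2 \<Rightarrow> ell2" is "\<lambda>c x n. c * x n"
  by (auto simp: norm_mult power_mult_distrib intro: summable_mult)

instantiation ell2 :: real_vector
begin

lift_definition zero_ell2 :: ell2 is "\<lambda>_. 0" by simp
lift_definition plus_ell2 :: "ell2 \<Rightarrow> ell2 \<Rightarrow> ell2" is "\<lambda>x y n. x n + y n"
  by (auto intro: summable_cmod_sq_add)
lift_definition uminus_ell2 :: "ell2 \<Rightarrow> ell2" is "\<lambda>x n. - x n" by simp
lift_definition minus_ell2 :: "ell2 \<Rightarrow> ell2 \<Rightarrow> ell2" is "\<lambda>x y n. x n - y n"
  using summable_cmod_sq_add[of _ "\<lambda>n. - _ n"] by fastforce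
lift_definition scaleR_ell2 :: "real \<Rightarrow> ell2 \<Rightarrow> ell2" is "\<lambda>r x n. r *\<^sub>R x n"
  by (auto simp: power_mult_distrib intro: summable_mult)

instance
  by standard (transfer; auto simp: fun_eq_iff algebra_simps)+

end

instantiation ell2 :: real_inner
begin

definition inner_ell2 :: "ell2 \<Rightarrow> ell2 \<Rightarrow> real" where
  "inner_ell2 x y = Re (cinner x y)"
definition norm_ell2 :: "ell2 \<Rightarrow> real" where
  "norm_ell2 x = sqrt (\<Sum>n. (cmod (ell2_nth x n))\<^sup>2)"
definition dist_ell2 :: "ell2 \<Rightarrow> ell2 \<Rightarrow> real" where
  "dist_ell2 x y = norm (x - y)"
definition sgn_ell2 :: "ell2 \<Rightarrow> ell2" where
  "sgn_ell2 x = inverse (norm x) *\<^sub>R x"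
definition uniformity_ell2 :: "(ell2 \<times> ell2) filter" where
  "uniformity_ell2 = (INF e\<in>{0<..}. principal {(x, y). dist x y < e})"
definition open_ell2 :: "ell2 set \<Rightarrow> bool" where
  "open_ell2 U \<longleftrightarrow> (\<forall>x\<in>U. eventually (\<lambda>(x', y). x' = x \<longrightarrow> y \<in> U) uniformity)"

lemma inner_ell2_eq: "inner (x::ell2) y = (\<Sum>n. Re (ell2_nth x n * cnj (ell2_nth y n)))"
  unfolding inner_ell2_def cinner_def by (rule Re_suminf[OF summable_ell2_prod])

lemma summable_ell2_inner: "summable (\<lambda>n. Re (ell2_nth x n * cnj (ell2_nth y n)))"
  by (rule summable_Re[OF summable_ell2_prod])

lemma Re_mult_cnj_self: "Re (z * cnj z) = (cmod z)\<^sup>2"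
  by (simp add: complex_mult_cnj cmod_power2)

lemma inner_ell2_self: "inner (x::ell2) x = (\<Sum>n. (cmod (ell2_nth x n))\<^sup>2)"
  unfolding inner_ell2_eq Re_mult_cnj_self ..

instance
proof
  fix x y z :: ell2 and r :: real
  show "inner x y = inner y x"
    unfolding inner_ell2_eq by (simp add: mult.commute)
  show "inner (x + y) z = inner x z + inner y z"
    unfolding inner_ell2_eq suminf_add[OF summable_ell2_inner summable_ell2_inner]
    by (simp add: plus_ell2.rep_eq algebra_simps)
  show "inner (r *\<^sub>R x) y = r * inner x y"
    unfolding inner_ell2_eq suminf_mult[OF summable_ell2_inner, symmetric]
    by (simp add: scaleR_ell2.rep_eq algebra_simps)
  show "0 \<le> inner x x"
    unfolding inner_ell2_self by (intro suminf_nonneg summable_cmod_sq) simp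
  show "inner x x = 0 \<longleftrightarrow> x = 0"
    unfolding inner_ell2_self
    by (subst suminf_eq_zero_iff[OF summable_cmod_sq])
      (auto simp: ell2_nth_inject[symmetric] zero_ell2.rep_eq fun_eq_iff)
  show "norm x = sqrt (inner x x)"
    unfolding inner_ell2_self norm_ell2_def ..
qed (simp_all add: dist_ell2_def sgn_ell2_def uniformity_ell2_def open_ell2_def)

end

lift_definition ell2_basis :: "nat \<Rightarrow> ell2" is "\<lambda>i n. if n = i then 1 else 0"
  by (rule summable_finite[where N = "{i}" for i]) auto


section \<open>Operators\<close>

text \<open>The type \<^typ>\<open>ell2 \<Rightarrow>\<^sub>L ell2\<close> consists of the bounded real-linear maps;
  complex linearity is a separate requirement.\<close>

type_synonym op2 = "ell2 \<Rightarrow>\<^sub>L ell2"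

definition Omega_B :: "op2 set" where
  "Omega_B = {A. \<forall>c x. blinfun_apply A (scaleC c x) = scaleC c (blinfun_apply A x)}"

text \<open>For complex-linear bounded \<open>A\<close> the adjoint exists and is unique by Riesz representation.\<close>

definition adj :: "op2 \<Rightarrow> op2" where
  "adj A = (THE B. \<forall>x y. cinner (blinfun_apply A x) y = cinner x (blinfun_apply B y))"

definition Omega_N :: "op2 set" where
  "Omega_N = {A \<in> Omega_B. A o\<^sub>L adj A = adj A o\<^sub>L A}"

definition Omega_SA :: "op2 set" where
  "Omega_SA = {A \<in> Omega_B. adj A = A}"

definition Omega_K :: "op2 set" where
  "Omega_K = {K \<in> Omega_B. compact (closure (blinfun_apply K ` cball 0 1))}"

definition Sp :: "op2 \<Rightarrow> complex set" where
  "Sp A = {z. \<not> (\<exists>R\<in>Omega_B. \<forall>x.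
      blinfun_apply R (blinfun_apply A x - scaleC z x) = x \<and>
      blinfun_apply A (blinfun_apply R x) - scaleC z (blinfun_apply R x) = x)}"

definition num_range :: "op2 \<Rightarrow> complex set" where
  "num_range A = {cinner (blinfun_apply A x) x | x. norm x = 1}"

definition ess_num_range :: "op2 \<Rightarrow> complex set" where
  "ess_num_range A = (\<Inter>B\<in>Omega_K. closure (num_range (A + B)))"


section \<open>Computational problems and general algorithms\<close>

text \<open>The evaluation set of a problem is \<^term>\<open>range (evals p)\<close>.  It is given together with an
  explicit enumeration, because an oracle machine refers to the evaluations by their index;
  general algorithms only depend on the set.  The relation \<^term>\<open>encodes p\<close> is the
  identification of finite strings of complex numbers with elements of the metric space
  \<^term>\<open>(outs p, odist p)\<close>.\<close>

record ('a, 'm) problem =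
  inputs :: "'a set"
  evals :: "nat \<Rightarrow> 'a \<Rightarrow> complex"
  outs :: "'m set"
  odist :: "'m \<Rightarrow> 'm \<Rightarrow> real"
  encodes :: "complex list \<Rightarrow> 'm \<Rightarrow> bool"
  target :: "'a \<Rightarrow> 'm"

definition computational_problem :: "('a, 'm) problem \<Rightarrow> bool" where
  "computational_problem p \<longleftrightarrow>
     Metric_space (outs p) (odist p) \<and>
     target p \<in> inputs p \<rightarrow> outs p \<and>
     (\<forall>A\<in>inputs p. \<forall>B\<in>inputs p. (\<forall>h\<in>range (evals p). h A = h B) \<longrightarrow> A = B)"

definition general_algorithm :: "('a, 'm) problem \<Rightarrow> ('a \<Rightarrow> 'm) \<Rightarrow> bool" where
  "general_algorithm p \<Gamma> \<longleftrightarrow>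
     \<Gamma> \<in> inputs p \<rightarrow> outs p \<and>
     (\<exists>L :: 'a \<Rightarrow> ('a \<Rightarrow> complex) set. \<forall>A\<in>inputs p.
        L A \<noteq> {} \<and> finite (L A) \<and> L A \<subseteq> range (evals p) \<and>
        (\<forall>B\<in>inputs p. (\<forall>h\<in>L A. h B = h A) \<longrightarrow> L B = L A \<and> \<Gamma> B = \<Gamma> A))"

text \<open>The map \<open>\<Gamma>\<close> with indices \<open>n\<^sub>k, \<dots>, n\<^sub>j\<close> is \<open>\<Gamma> [n\<^sub>k, \<dots>, n\<^sub>j]\<close>;
  the empty list of indices stands for the target map itself.\<close>

definition tower :: "('a, 'm) problem \<Rightarrow> nat \<Rightarrow> (nat list \<Rightarrow> 'a \<Rightarrow> 'm) \<Rightarrow> bool" where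
  "tower p k \<Gamma> \<longleftrightarrow>
     (\<forall>A\<in>inputs p. \<Gamma> [] A = target p A) \<and>
     (\<forall>ns. length ns \<le> k \<longrightarrow> \<Gamma> ns \<in> inputs p \<rightarrow> outs p) \<and>
     (\<forall>ns. length ns < k \<longrightarrow>
        (\<forall>A\<in>inputs p. (\<lambda>n. odist p (\<Gamma> (ns @ [n]) A) (\<Gamma> ns A)) \<longlonglongrightarrow> 0)) \<and>
     (\<forall>ns. length ns = k \<longrightarrow> general_algorithm p (\<Gamma> ns))"


section \<open>Blum--Shub--Smale machines with an oracle\<close>

text \<open>Machines over the reals; a complex number is stored as its real and imaginary part.
  As in the original definition of these machines, the infinite memory is accessed through the
  fixed registers named in the instructions and through a copy node with indirect addressing.
  \<open>Branch r l\<close> jumps to instruction \<open>l\<close> if register \<open>r\<close> is nonnegative.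
  \<open>Query r s\<close> asks the oracle for the evaluation whose index is in register \<open>r\<close>
  and writes the answer to the registers \<open>s\<close> and \<open>s + 1\<close>.\<close>

datatype bss_instr =
    Const nat real
  | Add nat nat nat
  | Sub nat nat nat
  | Mul nat nat nat
  | Div nat nat nat
  | Copy nat nat
  | Branch nat nat
  | Query nat nat

definition addr :: "real \<Rightarrow> nat" where
  "addr v = nat \<lfloor>v\<rfloor>"

fun bss_exec :: "(nat \<Rightarrow> complex) \<Rightarrow> bss_instr \<Rightarrow> nat \<times> (nat \<Rightarrow> real) \<Rightarrow> nat \<times> (nat \<Rightarrow> real)" where
  "bss_exec orc (Const r c) (pc, x) = (pc + 1, x(r := c))"
| "bss_exec orc (Add r s t) (pc, x) = (pc + 1, x(r := x s + x t))"
| "bss_exec orc (Sub r s t) (pc, x) = (pc + 1, x(r := x s - x t))"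
| "bss_exec orc (Mul r s t) (pc, x) = (pc + 1, x(r := x s * x t))"
| "bss_exec orc (Div r s t) (pc, x) = (pc + 1, x(r := x s / x t))"
| "bss_exec orc (Copy r s) (pc, x) = (pc + 1, x(addr (x r) := x (addr (x s))))"
| "bss_exec orc (Branch r l) (pc, x) = (if 0 \<le> x r then l else pc + 1, x)"
| "bss_exec orc (Query r s) (pc, x) =
     (pc + 1, x(s := Re (orc (addr (x r))), s + 1 := Im (orc (addr (x r)))))"

definition bss_step ::
  "(nat \<Rightarrow> complex) \<Rightarrow> bss_instr list \<Rightarrow> nat \<times> (nat \<Rightarrow> real) \<Rightarrow> nat \<times> (nat \<Rightarrow> real)" where
  "bss_step orc P s = (if fst s < length P then bss_exec orc (P ! fst s) s else s)"

text \<open>The input list is written to the first registers.  The machine halts when the program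
  counter leaves the program; register \<open>0\<close> then holds the length of the output string and the
  following registers hold its entries.\<close>

definition bss_init :: "nat list \<Rightarrow> nat \<times> (nat \<Rightarrow> real)" where
  "bss_init ns = (0, \<lambda>i. if i < length ns then real (ns ! i) else 0)"

definition bss_output :: "(nat \<Rightarrow> real) \<Rightarrow> complex list" where
  "bss_output x = map (\<lambda>l. Complex (x (2 * l + 1)) (x (2 * l + 2))) [0..<addr (x 0)]"

definition bss_computes ::
  "(nat \<Rightarrow> complex) \<Rightarrow> bss_instr list \<Rightarrow> nat list \<Rightarrow> complex list \<Rightarrow> bool" where
  "bss_computes orc P ns out \<longleftrightarrow>
     (\<exists>T pc x. (bss_step orc P ^^ T) (bss_init ns) = (pc, x) \<and> length P \<le> pc \<and> out = bss_output x)"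

text \<open>With rational constants and rational oracle answers all registers stay rational, so such a
  machine does the same as a Turing machine with this oracle.\<close>

definition rational_program :: "bss_instr list \<Rightarrow> bool" where
  "rational_program P \<longleftrightarrow> (\<forall>r c. Const r c \<in> set P \<longrightarrow> c \<in> \<rat>)"

definition gauss_rat :: "complex set" where
  "gauss_rat = {z. Re z \<in> \<rat> \<and> Im z \<in> \<rat>}"

definition executes ::
  "('a, 'm) problem \<Rightarrow> nat \<Rightarrow> (nat list \<Rightarrow> 'a \<Rightarrow> 'm) \<Rightarrow> bss_instr list \<Rightarrow> 'a \<Rightarrow> bool" where
  "executes p k \<Gamma> P A \<longleftrightarrow> (\<forall>ns. length ns = k \<longrightarrow>
     (\<exists>out. bss_computes (\<lambda>i. evals p i A) P ns out \<and> encodes p out (\<Gamma> ns A)))"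

text \<open>One machine serves all inputs and all indices.  The second conjunct covers the inputs with
  evaluations in the Gaussian rationals, on which a Turing machine is required.  Countability of
  the evaluation set is implicit in its enumeration.\<close>

definition recursive_tower ::
  "('a, 'm) problem \<Rightarrow> nat \<Rightarrow> (nat list \<Rightarrow> 'a \<Rightarrow> 'm) \<Rightarrow> bool" where
  "recursive_tower p k \<Gamma> \<longleftrightarrow>
     (\<exists>P. \<forall>A\<in>inputs p. executes p k \<Gamma> P A) \<and>
     (\<exists>P. rational_program P \<and>
        (\<forall>A\<in>inputs p. (\<forall>i. evals p i A \<in> gauss_rat) \<longrightarrow> executes p k \<Gamma> P A))"


section \<open>The SCI hierarchy\<close>

datatype tower_type = General | Arithmetic

definition typed_tower ::
  "tower_type \<Rightarrow> ('a, 'm) problem \<Rightarrow> nat \<Rightarrow> (nat list \<Rightarrow> 'a \<Rightarrow> 'm) \<Rightarrow> bool" where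
  "typed_tower \<alpha> p k \<Gamma> \<longleftrightarrow> tower p k \<Gamma> \<and> (\<alpha> = Arithmetic \<longrightarrow> recursive_tower p k \<Gamma>)"

text \<open>Only meaningful for index at least \<open>2\<close>.\<close>

definition Delta :: "tower_type \<Rightarrow> nat \<Rightarrow> ('a, 'm) problem set" where
  "Delta \<alpha> n = {p. computational_problem p \<and>
     (\<exists>k \<Gamma>. 1 \<le> k \<and> k < n \<and> typed_tower \<alpha> p k \<Gamma>)}"

text \<open>\<open>Pi_Haus\<close> is for problems with values in the non-empty compact sets under the Hausdorff
  metric, \<open>Sigma_dec\<close> for decision problems with values in \<open>{0, 1}\<close>.\<close>

definition Pi_Haus :: "tower_type \<Rightarrow> nat \<Rightarrow> ('a, complex set) problem set" where
  "Pi_Haus \<alpha> m = {p \<in> Delta \<alpha> (m + 1). \<exists>\<Gamma>. typed_tower \<alpha> p m \<Gamma> \<and>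
     (\<forall>A\<in>inputs p. \<forall>n. \<exists>X\<in>outs p. target p A \<subseteq> X \<and> odist p X (\<Gamma> [n] A) \<le> 1 / 2 ^ n)}"

definition Sigma_dec :: "tower_type \<Rightarrow> nat \<Rightarrow> ('a, nat) problem set" where
  "Sigma_dec \<alpha> m = {p \<in> Delta \<alpha> (m + 1). \<exists>\<Gamma>. typed_tower \<alpha> p m \<Gamma> \<and>
     (\<forall>A\<in>inputs p. \<forall>n. \<Gamma> [n] A \<le> target p A)}"

definition ne_compacts :: "complex set set" where
  "ne_compacts = {X. X \<noteq> {} \<and> compact X}"

definition hausdorff_dist :: "complex set \<Rightarrow> complex set \<Rightarrow> real" where
  "hausdorff_dist X Y = (if X \<in> ne_compacts \<and> Y \<in> ne_compacts
     then max (SUP x\<in>X. infdist x Y) (SUP y\<in>Y. infdist y X) else 0)"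


section \<open>Evaluation sets\<close>

definition Lambda_1 :: "(op2 \<Rightarrow> complex) set" where
  "Lambda_1 = {\<lambda>A. cinner (blinfun_apply A (ell2_basis j)) (ell2_basis i) | i j. True}"

definition Lambda_2 :: "(op2 \<Rightarrow> complex) set" where
  "Lambda_2 = Lambda_1
     \<union> {\<lambda>A. cinner (blinfun_apply A (ell2_basis j)) (blinfun_apply A (ell2_basis i)) | i j. True}
     \<union> {\<lambda>A. cinner (blinfun_apply (adj A) (ell2_basis j)) (blinfun_apply (adj A) (ell2_basis i))
        | i j. True}"

definition pairs :: "(nat \<Rightarrow> nat \<Rightarrow> 'b) \<Rightarrow> nat \<Rightarrow> 'b" where
  "pairs f n = (case prod_decode n of (i, j) \<Rightarrow> f i j)"

definition interleave :: "(nat \<Rightarrow> 'b) \<Rightarrow> (nat \<Rightarrow> 'b) \<Rightarrow> (nat \<Rightarrow> 'b) \<Rightarrow> nat \<Rightarrow> 'b" where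
  "interleave f g h n =
     (if n mod 3 = 0 then f (n div 3) else if n mod 3 = 1 then g (n div 3) else h (n div 3))"

definition eval_1 :: "nat \<Rightarrow> op2 \<Rightarrow> complex" where
  "eval_1 = pairs (\<lambda>i j A. cinner (blinfun_apply A (ell2_basis j)) (ell2_basis i))"

definition eval_2 :: "nat \<Rightarrow> op2 \<Rightarrow> complex" where
  "eval_2 = interleave eval_1
     (pairs (\<lambda>i j A. cinner (blinfun_apply A (ell2_basis j)) (blinfun_apply A (ell2_basis i))))
     (pairs (\<lambda>i j A. cinner (blinfun_apply (adj A) (ell2_basis j))
                            (blinfun_apply (adj A) (ell2_basis i))))"

lemma range_pairs: "range (pairs f) = {f i j | i j. True}"
proof -
  have "f i j \<in> range (pairs f)" for i j
    by (rule range_eqI[of _ _ "prod_encode (i, j)"]) (simp add: pairs_def)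
  then have "{f i j | i j. True} \<subseteq> range (pairs f)"
    by auto
  moreover have "range (pairs f) \<subseteq> {f i j | i j. True}"
    unfolding pairs_def by (force split: prod.split)
  ultimately show ?thesis
    by (rule subset_antisym[rotated])
qed

lemma range_interleave: "range (interleave f g h) = range f \<union> range g \<union> range h"
proof
  show "range (interleave f g h) \<subseteq> range f \<union> range g \<union> range h"
    by (auto simp: interleave_def)
  have "f n = interleave f g h (3 * n)" "g n = interleave f g h (3 * n + 1)"
    "h n = interleave f g h (3 * n + 2)" for n
    by (simp_all add: interleave_def div_add1_eq mod_add_eq[symmetric]
        del: add_2_eq_Suc' One_nat_def)
  then show "range f \<union> range g \<union> range h \<subseteq> range (interleave f g h)"
    by (metis (mono_tags, lifting) Un_least image_subsetI rangeI)
qed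

lemma range_eval_1: "range eval_1 = Lambda_1"
  by (simp add: eval_1_def range_pairs Lambda_1_def)

lemma range_eval_2: "range eval_2 = Lambda_2"
  by (simp add: eval_2_def range_interleave range_eval_1 range_pairs Lambda_2_def)


section \<open>The essential numerical range as a computational problem\<close>

definition we_problem :: "op2 set \<Rightarrow> (nat \<Rightarrow> op2 \<Rightarrow> complex) \<Rightarrow> (op2, complex set) problem" where
  "we_problem \<Omega> ev = \<lparr> inputs = \<Omega>, evals = ev, outs = ne_compacts, odist = hausdorff_dist,
     encodes = (\<lambda>out X. X = set out), target = ess_num_range \<rparr>"


section \<open>Spectral pollution\<close>

text \<open>Real balls are given by their endpoints, complex balls by radius and centre.\<close>

definition real_ball :: "ereal \<times> ereal \<Rightarrow> real set" where
  "real_ball U = {x. fst U < ereal x \<and> ereal x < snd U}"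

definition complex_ball :: "ereal \<times> complex \<Rightarrow> complex set" where
  "complex_ball U = {w. ereal (dist (snd U) w) < fst U}"

definition ext_rat :: "ereal set" where
  "ext_rat = ereal ` \<rat> \<union> {\<infinity>, -\<infinity>}"

definition real_ball_seqs :: "(nat \<Rightarrow> ereal \<times> ereal) set" where
  "real_ball_seqs = {U. \<forall>m. fst (U m) \<in> ext_rat \<and> snd (U m) \<in> ext_rat \<and> fst (U m) < snd (U m)}"

definition complex_ball_seqs :: "(nat \<Rightarrow> ereal \<times> complex) set" where
  "complex_ball_seqs = {U. \<forall>m. fst (U m) \<in> ext_rat \<and> 0 < fst (U m) \<and> snd (U m) \<in> gauss_rat}"

text \<open>Evaluations are complex-valued; the infinite values are coded by non-real numbers.\<close>

definition ereal_code :: "ereal \<Rightarrow> complex" where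
  "ereal_code r = (if r = \<infinity> then \<i> else if r = -\<infinity> then - \<i>
     else complex_of_real (real_of_ereal r))"

definition real_poll_eval ::
  "(nat \<Rightarrow> op2 \<Rightarrow> complex) \<Rightarrow> nat \<Rightarrow> op2 \<times> (nat \<Rightarrow> ereal \<times> ereal) \<Rightarrow> complex" where
  "real_poll_eval ev = interleave (\<lambda>n (A, U). ev n A)
     (\<lambda>m (A, U). ereal_code (fst (U m))) (\<lambda>m (A, U). ereal_code (snd (U m)))"

definition complex_poll_eval ::
  "(nat \<Rightarrow> op2 \<Rightarrow> complex) \<Rightarrow> nat \<Rightarrow> op2 \<times> (nat \<Rightarrow> ereal \<times> complex) \<Rightarrow> complex" where
  "complex_poll_eval ev = interleave (\<lambda>n (A, U). ev n A)
     (\<lambda>m (A, U). ereal_code (fst (U m))) (\<lambda>m (A, U). snd (U m))"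

definition real_poll :: "op2 \<times> (nat \<Rightarrow> ereal \<times> ereal) \<Rightarrow> nat" where
  "real_poll = (\<lambda>(A, U). if complex_of_real ` closure (\<Union>m. real_ball (U m))
       \<inter> (ess_num_range A - Sp A) \<noteq> {} then 1 else 0)"

definition complex_poll :: "op2 \<times> (nat \<Rightarrow> ereal \<times> complex) \<Rightarrow> nat" where
  "complex_poll = (\<lambda>(A, U). if closure (\<Union>m. complex_ball (U m))
       \<inter> (ess_num_range A - Sp A) \<noteq> {} then 1 else 0)"

definition decision_problem ::
  "'a set \<Rightarrow> (nat \<Rightarrow> 'a \<Rightarrow> complex) \<Rightarrow> ('a \<Rightarrow> nat) \<Rightarrow> ('a, nat) problem" where
  "decision_problem I ev \<Xi> = \<lparr> inputs = I, evals = ev, outs = {0, 1}, odist = discrete_metric.dd,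
     encodes = (\<lambda>out b. out = [of_nat b]), target = \<Xi> \<rparr>"

text \<open>Here \<open>\<U>\<close> is the set of admitted sequences of balls.\<close>

definition real_poll_problem ::
  "op2 set \<Rightarrow> (nat \<Rightarrow> ereal \<times> ereal) set \<Rightarrow> (nat \<Rightarrow> op2 \<Rightarrow> complex) \<Rightarrow>
   (op2 \<times> (nat \<Rightarrow> ereal \<times> ereal), nat) problem" where
  "real_poll_problem \<Omega> \<U> ev = decision_problem (\<Omega> \<times> \<U>) (real_poll_eval ev) real_poll"

definition complex_poll_problem ::
  "op2 set \<Rightarrow> (nat \<Rightarrow> ereal \<times> complex) set \<Rightarrow> (nat \<Rightarrow> op2 \<Rightarrow> complex) \<Rightarrow>
   (op2 \<times> (nat \<Rightarrow> ereal \<times> complex), nat) problem" where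
  "complex_poll_problem \<Omega> \<U> ev = decision_problem (\<Omega> \<times> \<U>) (complex_poll_eval ev) complex_poll"

text \<open>A single ball is the constant sequence of this ball.\<close>

definition single :: "(nat \<Rightarrow> 'b) set \<Rightarrow> (nat \<Rightarrow> 'b) set" where
  "single \<U> = {U \<in> \<U>. \<forall>m. U m = U 0}"

end

theory Submission
  imports Defs
begin

text \<open>
  Both halves of the classification rest on one description of the essential numerical range: it is
  the intersection over \<open>n\<close> of the closures of the sets \<open>W\<^sub>n\<close> of all \<open>\<langle>A x, x\<rangle>\<close> with \<open>x\<close> a unit vector
  whose first \<open>n\<close> coordinates vanish (\<open>ess_num_range_eq\<close>).  The inclusion from left to right uses
  finite rank perturbations together with the convexity of \<open>W\<^sub>n\<close>, the other one that compact operators map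
  weakly null sequences to null sequences.

  \<^bold>\<open>Upper bounds.\<close>  The normalised values of the quadratic form at integer vectors with finite support are
  dense in \<open>W\<^sub>n\<close>, and the closures decrease to the essential numerical range; this is a tower of height
  two that converges from above (\<open>we_in_Pi\<close>).  For spectral pollution, a point lies
  outside the spectrum iff \<open>A - z\<close> and its adjoint are bounded below (\<open>not_in_Sp_iff\<close>), and it suffices
  to test this on integer vectors.  Fixing the lower bound \<open>1 / (n3 + 1)\<close> with the outermost index, using
  the middle index for the tail, the test vectors and the tolerance, and the innermost one for the search for
  witnesses, gives a statement \<open>\<exists>n3. \<forall>n2. \<exists>n1\<close> whose matrix compares rational expressions in
  finitely many matrix entries.  The quantifier over \<open>n2\<close> is removed by compactness (\<open>pollution_iff\<close>), and
  monotonicity turns the three quantifiers into three limits, the outermost one from below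
  (\<open>Sigma_dec_3_I\<close>).

  \<^bold>\<open>Machines.\<close>  Integer vectors are coded by digits, so every formula involved consists of arithmetic,
  comparisons, queries and bounded sums, products and quantifiers.  Such terms are compiled with a
  static stack of registers (\<open>computable\<close>); indirect addressing is only needed for writing a list
  of unbounded length (\<open>list_program\<close>).  Every map that such a machine computes is a general algorithm, because a
  halting run makes finitely many queries (\<open>executed_general_algorithm\<close>).

  \<^bold>\<open>Lower bounds.\<close>  Diagonal operators translate bits into operators in such a way that each evaluation
  depends on finitely many bits.  With diagonal entries in \<open>{0, 1}\<close> the essential numerical range is \<open>{0}\<close> or
  \<open>{1}\<close> for eventually constant sequences of bits, and a single limit can be made to oscillate between
  them (\<open>oscillation\<close>).  With the entries \<open>a (j, i) / (j + 1)\<close> pollution occurs iff some column of the bit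
  matrix \<open>a\<close> is infinite, and a Baire category argument shows that two limits do not decide
  this (\<open>infinite_column_not_double_limit\<close>).
\<close>


section \<open>The Hilbert space and its bounded operators\<close>

lemmas ell2_nth_simps [simp] = zero_ell2.rep_eq plus_ell2.rep_eq minus_ell2.rep_eq
  uminus_ell2.rep_eq scaleR_ell2.rep_eq scaleC.rep_eq ell2_basis.rep_eq

lemma ell2_eqI: "(\<And>i. ell2_nth x i = ell2_nth y i) \<Longrightarrow> x = y"
  by (simp add: ell2_nth_inject[symmetric] fun_eq_iff)

lemma ell2_nth_sum [simp]: "ell2_nth (\<Sum>i\<in>I. f i) k = (\<Sum>i\<in>I. ell2_nth (f i) k)"
  by (induction I rule: infinite_finite_induct) auto

lemma scaleC_simps [simp]:
  "scaleC 0 x = 0" "scaleC c 0 = 0" "scaleC 1 x = x" "scaleC c (scaleC d x) = scaleC (c * d) x"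
  "scaleC (- c) x = - scaleC c x" "scaleC c (- x) = - scaleC c x"
  by (auto intro: ell2_eqI)

lemma scaleC_distribs:
  "scaleC c (x + y) = scaleC c x + scaleC c y" "scaleC (c + d) x = scaleC c x + scaleC d x"
  "scaleC c (x - y) = scaleC c x - scaleC c y" "scaleC (c - d) x = scaleC c x - scaleC d x"
  by (auto intro!: ell2_eqI simp: algebra_simps)

lemma scaleR_eq_scaleC: "r *\<^sub>R x = scaleC (of_real r) x"
  by (auto intro!: ell2_eqI simp: scaleR_conv_of_real)

lemma cinner_add_left: "cinner (x + y) z = cinner x z + cinner y z"
  unfolding cinner_def suminf_add[OF summable_ell2_prod summable_ell2_prod]
  by (simp add: algebra_simps)

lemma cinner_scaleC_left: "cinner (scaleC c x) z = c * cinner x z"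
  unfolding cinner_def suminf_mult[OF summable_ell2_prod, symmetric] by (simp add: algebra_simps)

lemma cinner_commute: "cinner y x = cnj (cinner x y)"
proof -
  have "(\<lambda>n. ell2_nth x n * cnj (ell2_nth y n)) sums cinner x y"
    unfolding cinner_def by (rule summable_sums[OF summable_ell2_prod])
  then have "(\<lambda>n. cnj (ell2_nth x n * cnj (ell2_nth y n))) sums cnj (cinner x y)"
    by (simp only: sums_cnj)
  then show ?thesis unfolding cinner_def by (simp add: sums_iff mult.commute)
qed

lemma cinner_diff_left: "cinner (x - y) z = cinner x z - cinner y z"
  using cinner_add_left[of x "scaleC (-1) y" z] cinner_scaleC_left[of "-1" y z] by simp

lemma cinner_add_right: "cinner z (x + y) = cinner z x + cinner z y"
  by (subst (1 2 3) cinner_commute) (simp add: cinner_add_left)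

lemma cinner_diff_right: "cinner z (x - y) = cinner z x - cinner z y"
  by (subst (1 2 3) cinner_commute) (simp add: cinner_diff_left)

lemma cinner_scaleC_right: "cinner z (scaleC c x) = cnj c * cinner z x"
  by (subst (1 2) cinner_commute) (simp add: cinner_scaleC_left)

lemma cinner_zero [simp]: "cinner 0 x = 0" "cinner x 0 = 0"
  by (simp_all add: cinner_def)

lemma cinner_minus [simp]: "cinner (- x) y = - cinner x y" "cinner x (- y) = - cinner x y"
  using cinner_diff_left[of 0 x y] cinner_diff_right[of x 0 y] by simp_all

lemma cinner_sum_left: "cinner (\<Sum>i\<in>I. f i) y = (\<Sum>i\<in>I. cinner (f i) y)"
  by (induction I rule: infinite_finite_induct) (auto simp: cinner_add_left)

lemma cinner_sum_right: "cinner y (\<Sum>i\<in>I. f i) = (\<Sum>i\<in>I. cinner y (f i))"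
  by (induction I rule: infinite_finite_induct) (auto simp: cinner_add_right)

lemma norm_sq_suminf: "(norm x)\<^sup>2 = (\<Sum>n. (cmod (ell2_nth x n))\<^sup>2)"
  by (simp add: norm_ell2_def suminf_nonneg summable_cmod_sq)

lemma cinner_self: "cinner x x = of_real ((norm x)\<^sup>2)"
proof (rule complex_eqI)
  show "Re (cinner x x) = Re (of_real ((norm x)\<^sup>2))"
    using power2_norm_eq_inner[of x] by (simp add: inner_ell2_def)
  have "Im (cinner x x) = Im (cnj (cinner x x))"
    using cinner_commute[of x x] by simp
  then show "Im (cinner x x) = Im (of_real ((norm x)\<^sup>2))" by simp
qed

lemma norm_scaleC [simp]: "norm (scaleC c x) = cmod c * norm x"
proof -
  have "complex_of_real ((norm (scaleC c x))\<^sup>2) = of_real ((cmod c * norm x)\<^sup>2)"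
    by (simp only: cinner_self[symmetric] cinner_scaleC_left cinner_scaleC_right)
      (simp add: cinner_self power_mult_distrib complex_norm_square mult_ac flip: of_real_power)
  then show ?thesis
    by (simp only: of_real_eq_iff) (simp add: power2_eq_iff_nonneg)
qed

lemma cauchy_schwarz: "cmod (cinner x y) \<le> norm x * norm y"
proof (cases "cinner x y = 0")
  case False
  define c where "c = cnj (sgn (cinner x y))"
  have c: "cmod c = 1" using False by (simp add: c_def norm_sgn)
  have "cinner (scaleC c x) y = of_real (cmod (cinner x y))"
  proof -
    have "cnj (cinner x y) * cinner x y = of_real (cmod (cinner x y)) * of_real (cmod (cinner x y))"
      using complex_norm_square[of "cinner x y"] by (simp add: power2_eq_square mult.commute)
    then show ?thesis using False by (simp add: cinner_scaleC_left c_def sgn_eq field_simps)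
  qed
  then have "cmod (cinner x y) = inner (scaleC c x) y" by (simp add: inner_ell2_def)
  also have "\<dots> \<le> norm (scaleC c x) * norm y" by (rule norm_cauchy_schwarz)
  finally show ?thesis by (simp add: c)
qed simp

lemma bounded_linear_cinner_left: "bounded_linear (\<lambda>x. cinner x y)"
  by (rule bounded_linear_intro[where K = "norm y"])
    (simp_all add: cinner_add_left scaleR_eq_scaleC cinner_scaleC_left cauchy_schwarz scaleR_conv_of_real)

lemma cinner_basis_right: "cinner x (ell2_basis i) = ell2_nth x i"
proof -
  have "(\<lambda>n. ell2_nth x n * cnj (ell2_nth (ell2_basis i) n)) = (\<lambda>n. if n = i then ell2_nth x n else 0)"
    by (auto simp: fun_eq_iff)
  then show ?thesis unfolding cinner_def using sums_single[of i "ell2_nth x"] by (simp add: sums_iff)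
qed

lemma cinner_basis_left: "cinner (ell2_basis i) x = cnj (ell2_nth x i)"
  by (subst cinner_commute) (simp add: cinner_basis_right)

lemma norm_basis [simp]: "norm (ell2_basis i) = 1"
proof -
  have "complex_of_real ((norm (ell2_basis i))\<^sup>2) = 1"
    by (simp only: cinner_self[symmetric] cinner_basis_right) simp
  then have "(norm (ell2_basis i))\<^sup>2 = 1" by (simp only: of_real_eq_1_iff)
  then show ?thesis using norm_ge_zero[of "ell2_basis i"] by (auto simp: power2_eq_1_iff)
qed

lemma cmod_nth_le: "cmod (ell2_nth x i) \<le> norm x"
  using cauchy_schwarz[of x "ell2_basis i"] by (simp add: cinner_basis_right)

text \<open>Truncations and integer vectors both have this form, so that one formula for the norm and one
  for the action of an operator serve both.\<close>

lift_definition fin :: "nat \<Rightarrow> (nat \<Rightarrow> complex) \<Rightarrow> ell2" is "\<lambda>m f i. if i < m then f i else 0"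
  subgoal for m f by (rule summable_finite[where N = "{..<m}"]) auto
  done

declare fin.rep_eq [simp]

abbreviation head :: "nat \<Rightarrow> ell2 \<Rightarrow> ell2" where "head m x \<equiv> fin m (ell2_nth x)"

lemma fin_eq_sum: "fin m f = (\<Sum>i<m. scaleC (f i) (ell2_basis i))"
proof (rule ell2_eqI)
  fix k
  have "(\<Sum>i<m. f i * (if k = i then 1 else 0)) = (\<Sum>i<m. if i = k then f i else 0)"
    by (rule sum.cong) auto
  also have "\<dots> = (if k < m then f k else 0)" by simp
  finally show "ell2_nth (fin m f) k = ell2_nth (\<Sum>i<m. scaleC (f i) (ell2_basis i)) k" by simp
qed

lemma norm_fin_sq: "(norm (fin m f))\<^sup>2 = (\<Sum>i<m. (cmod (f i))\<^sup>2)"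
  unfolding norm_sq_suminf by (subst suminf_finite[of "{..<m}"]) auto

lemma cinner_head: "cinner (head m x) y = cinner x (head m y)"
  unfolding fin_eq_sum
  by (simp add: cinner_sum_left cinner_sum_right cinner_scaleC_left cinner_scaleC_right
      cinner_basis_left cinner_basis_right mult.commute)

lemma norm_head_le: "norm (head m x) \<le> norm x"
proof -
  have "(norm (head m x))\<^sup>2 \<le> (norm x)\<^sup>2"
    unfolding norm_fin_sq norm_sq_suminf[of x] by (rule sum_le_suminf[OF summable_cmod_sq]) auto
  then show ?thesis by (simp add: power2_le_iff_abs_le)
qed

lemma norm_head_mono: "m \<le> n \<Longrightarrow> norm (head m x) \<le> norm (head n x)"
proof -
  assume "m \<le> n"
  then have "head m (head n x) = head m x" by (auto intro: ell2_eqI)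
  then show ?thesis using norm_head_le[of m "head n x"] by simp
qed

lemma pythagoras_head: "(norm x)\<^sup>2 = (norm (head m x))\<^sup>2 + (norm (x - head m x))\<^sup>2"
proof -
  have "cinner (head m x) (x - head m x) = 0" unfolding cinner_def
    by (rule trans[OF suminf_cong suminf_zero]) simp
  then have "inner (head m x) (x - head m x) = 0" by (simp add: inner_ell2_def)
  then show ?thesis
    using dot_norm[of "head m x" "x - head m x"] by simp
qed

lemma head_tendsto: "(\<lambda>m. head m x) \<longlonglongrightarrow> x"
proof -
  have "(\<lambda>m. (norm (head m x))\<^sup>2) \<longlonglongrightarrow> (norm x)\<^sup>2"
    unfolding norm_fin_sq norm_sq_suminf[of x] by (rule summable_LIMSEQ[OF summable_cmod_sq])
  then have "(\<lambda>m. (norm x)\<^sup>2 - (norm (head m x))\<^sup>2) \<longlonglongrightarrow> 0"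
    by (auto intro: tendsto_eq_intros)
  moreover have "(norm x)\<^sup>2 - (norm (head m x))\<^sup>2 = (norm (x - head m x))\<^sup>2" for m
    using pythagoras_head[of x m] by simp
  ultimately have "(\<lambda>m. (norm (x - head m x))\<^sup>2) \<longlonglongrightarrow> 0"
    by (simp only:)
  then have "(\<lambda>m. sqrt ((norm (x - head m x))\<^sup>2)) \<longlonglongrightarrow> sqrt 0" by (rule tendsto_real_sqrt)
  then have "(\<lambda>m. norm (head m x - x)) \<longlonglongrightarrow> 0" by (simp add: norm_minus_commute)
  then show ?thesis by (rule LIM_zero_cancel[OF tendsto_norm_zero_cancel])
qed

text \<open>Completeness: the coordinatewise limit \<open>f\<close> of a Cauchy sequence \<open>X\<close> differs from \<open>X n\<close> by
  a sequence whose partial sums of squares are uniformly small, so \<open>f\<close> is square-summable.\<close>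

lemma Cauchy_ell2_convergent:
  assumes "Cauchy (X :: nat \<Rightarrow> ell2)" shows "convergent X"
proof -
  have "Cauchy (\<lambda>n. ell2_nth (X n) i)" for i
  proof (rule CauchyI)
    fix e :: real assume "e > 0"
    then obtain M where M: "\<And>m n. m \<ge> M \<Longrightarrow> n \<ge> M \<Longrightarrow> norm (X m - X n) < e"
      using assms unfolding Cauchy_iff by blast
    have "norm (ell2_nth (X m) i - ell2_nth (X n) i) < e" if "m \<ge> M" "n \<ge> M" for m n
      using cmod_nth_le[of "X m - X n" i] M[OF that] by simp
    then show "\<exists>M. \<forall>m\<ge>M. \<forall>n\<ge>M. norm (ell2_nth (X m) i - ell2_nth (X n) i) < e" by blast
  qed
  then have "\<exists>l. (\<lambda>n. ell2_nth (X n) i) \<longlonglongrightarrow> l" for i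
    using Cauchy_convergent convergent_def by blast
  then obtain f where f: "\<And>i. (\<lambda>n. ell2_nth (X n) i) \<longlonglongrightarrow> f i" by metis
  have small: "\<exists>M. \<forall>n\<ge>M. \<forall>k. (\<Sum>i<k. (cmod (ell2_nth (X n) i - f i))\<^sup>2) \<le> e\<^sup>2" if "e > 0" for e
  proof -
    obtain M where M: "\<And>m n. m \<ge> M \<Longrightarrow> n \<ge> M \<Longrightarrow> norm (X m - X n) < e"
      using assms \<open>e > 0\<close> unfolding Cauchy_iff by blast
    have "(\<Sum>i<k. (cmod (ell2_nth (X n) i - f i))\<^sup>2) \<le> e\<^sup>2" if "n \<ge> M" for n k
    proof (rule LIMSEQ_le_const2)
      show "(\<lambda>m. \<Sum>i<k. (cmod (ell2_nth (X n) i - ell2_nth (X m) i))\<^sup>2) \<longlonglongrightarrow>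
          (\<Sum>i<k. (cmod (ell2_nth (X n) i - f i))\<^sup>2)"
        by (intro tendsto_intros f)
      have "(\<Sum>i<k. (cmod (ell2_nth (X n) i - ell2_nth (X m) i))\<^sup>2) \<le> e\<^sup>2" if "m \<ge> M" for m
      proof -
        have "(\<Sum>i<k. (cmod (ell2_nth (X n) i - ell2_nth (X m) i))\<^sup>2) = (norm (head k (X n - X m)))\<^sup>2"
          by (simp add: norm_fin_sq)
        also have "\<dots> \<le> e\<^sup>2"
          using norm_head_le[of k "X n - X m"] M[OF \<open>n \<ge> M\<close> that] by (intro power_mono) auto
        finally show ?thesis .
      qed
      then show "\<exists>N. \<forall>m\<ge>N. (\<Sum>i<k. (cmod (ell2_nth (X n) i - ell2_nth (X m) i))\<^sup>2) \<le> e\<^sup>2" by blast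
    qed
    then show ?thesis by blast
  qed
  have summ: "\<exists>M. \<forall>n\<ge>M. summable (\<lambda>i. (cmod (ell2_nth (X n) i - f i))\<^sup>2) \<and>
      (\<Sum>i. (cmod (ell2_nth (X n) i - f i))\<^sup>2) \<le> e\<^sup>2" if "e > 0" for e
    using small[OF that] by (meson summableI_nonneg_bounded suminf_le_const zero_le_power2)
  then obtain M where "summable (\<lambda>i. (cmod (ell2_nth (X M) i - f i))\<^sup>2)"
    by (metis order_refl zero_less_one)
  then have "summable (\<lambda>i. (cmod (f i - ell2_nth (X M) i))\<^sup>2)" by (simp add: norm_minus_commute)
  from summable_cmod_sq_add[OF this summable_cmod_sq[of "X M"]]
  have "summable (\<lambda>i. (cmod (f i))\<^sup>2)" by simp
  then have nth: "ell2_nth (Abs_ell2 f) = f" by (simp add: Abs_ell2_inverse)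
  have "\<exists>M. \<forall>n\<ge>M. norm (X n - Abs_ell2 f) < e" if "e > 0" for e
  proof -
    from summ[of "e / 2"] that obtain M where
      M: "\<And>n. n \<ge> M \<Longrightarrow> (\<Sum>i. (cmod (ell2_nth (X n) i - f i))\<^sup>2) \<le> (e / 2)\<^sup>2" by auto
    have "norm (X n - Abs_ell2 f) < e" if "n \<ge> M" for n
    proof -
      have "(norm (X n - Abs_ell2 f))\<^sup>2 \<le> (e / 2)\<^sup>2"
        using M[OF that] by (simp add: norm_sq_suminf nth)
      then have "norm (X n - Abs_ell2 f) \<le> e / 2" using \<open>e > 0\<close> by (simp add: power2_le_iff_abs_le)
      then show ?thesis using \<open>e > 0\<close> by simp
    qed
    then show ?thesis by blast
  qed
  then show ?thesis unfolding convergent_def by (meson LIMSEQ_iff)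
qed

lemma complete_ell2: "complete (UNIV :: ell2 set)"
  unfolding complete_def using Cauchy_ell2_convergent convergent_def by blast

subsection \<open>Complex linear operators and adjoints\<close>

lemma Omega_B_scaleC: "A \<in> Omega_B \<Longrightarrow> blinfun_apply A (scaleC c x) = scaleC c (blinfun_apply A x)"
  by (simp add: Omega_B_def)

lemma Omega_B_fin:
  "A \<in> Omega_B \<Longrightarrow> blinfun_apply A (fin m f) = (\<Sum>i<m. scaleC (f i) (blinfun_apply A (ell2_basis i)))"
  by (simp add: fin_eq_sum blinfun.sum_right Omega_B_scaleC)

lemma Omega_B_diff: "A \<in> Omega_B \<Longrightarrow> B \<in> Omega_B \<Longrightarrow> A - B \<in> Omega_B"
  by (simp add: Omega_B_def blinfun.diff_left scaleC_distribs)

definition mk_op :: "(ell2 \<Rightarrow> ell2) \<Rightarrow> op2" where "mk_op f = Blinfun f"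

lemma mk_op:
  assumes "\<And>x y. f (x + y) = f x + f y" "\<And>c x. f (scaleC c x) = scaleC c (f x)"
    "\<And>x. norm (f x) \<le> K * norm x"
  shows "blinfun_apply (mk_op f) = f" "mk_op f \<in> Omega_B"
proof -
  have "bounded_linear f"
    using assms(3) by (intro bounded_linear_intro[where K = K])
      (auto simp: assms(1,2) scaleR_eq_scaleC mult.commute)
  then show "blinfun_apply (mk_op f) = f" by (simp add: mk_op_def bounded_linear_Blinfun_apply)
  then show "mk_op f \<in> Omega_B" by (simp add: Omega_B_def assms)
qed

definition scalar :: "complex \<Rightarrow> op2" where "scalar c = mk_op (scaleC c)"

lemma scalar [simp]: "blinfun_apply (scalar c) x = scaleC c x" "scalar c \<in> Omega_B"
  using mk_op[of "scaleC c" "cmod c"] by (auto simp: scalar_def scaleC_distribs mult.commute)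

lemma cinner_eqI: "(\<And>x. cinner x y = cinner x z) \<Longrightarrow> y = z"
proof (rule ell2_eqI)
  fix i assume "\<And>x. cinner x y = cinner x z"
  from this[of "ell2_basis i"] show "ell2_nth y i = ell2_nth z i" by (simp add: cinner_basis_left)
qed

text \<open>The adjoint has the coordinates \<open>\<langle>y, A e\<^sub>n\<rangle>\<close>; testing \<open>A\<close> on a finite section of this sequence
  shows that its norm is at most \<open>\<parallel>A\<parallel> \<parallel>y\<parallel>\<close>.\<close>

lemma adjoint_coords_summable:
  assumes A: "A \<in> Omega_B"
  defines "c \<equiv> \<lambda>y n. cinner y (blinfun_apply A (ell2_basis n))"
  shows "summable (\<lambda>n. (cmod (c y n))\<^sup>2)" "(\<Sum>n. (cmod (c y n))\<^sup>2) \<le> (norm A * norm y)\<^sup>2"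
proof -
  have bd: "(\<Sum>n<m. (cmod (c y n))\<^sup>2) \<le> (norm A * norm y)\<^sup>2" for m
  proof -
    define v where "v = fin m (c y)"
    have "cinner y (blinfun_apply A v) = (\<Sum>n<m. cnj (c y n) * c y n)"
      unfolding v_def Omega_B_fin[OF A] by (simp add: cinner_sum_right cinner_scaleC_right c_def)
    also have "\<dots> = of_real ((norm v)\<^sup>2)"
      unfolding v_def norm_fin_sq of_real_sum
      by (intro sum.cong refl) (metis complex_norm_square mult.commute)
    finally have "(norm v)\<^sup>2 = cmod (cinner y (blinfun_apply A v))"
      by (simp add: norm_power)
    also have "\<dots> \<le> norm y * (norm A * norm v)"
      by (rule order_trans[OF cauchy_schwarz]) (intro mult_left_mono norm_blinfun norm_ge_zero)
    finally have "norm v * norm v \<le> (norm A * norm y) * norm v" by (simp add: power2_eq_square mult_ac)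
    then have "norm v \<le> norm A * norm y"
      by (cases "norm v = 0") (auto dest: mult_right_le_imp_le)
    then have "(norm v)\<^sup>2 \<le> (norm A * norm y)\<^sup>2" by (intro power_mono) auto
    then show ?thesis by (simp add: v_def norm_fin_sq)
  qed
  then show "summable (\<lambda>n. (cmod (c y n))\<^sup>2)" by (intro summableI_nonneg_bounded) auto
  then show "(\<Sum>n. (cmod (c y n))\<^sup>2) \<le> (norm A * norm y)\<^sup>2" using bd by (rule suminf_le_const)
qed

lemma adjoint_exists:
  assumes A: "A \<in> Omega_B"
  obtains B where "B \<in> Omega_B" "\<And>x y. cinner (blinfun_apply A x) y = cinner x (blinfun_apply B y)"
proof -
  define f where "f y = Abs_ell2 (\<lambda>n. cinner y (blinfun_apply A (ell2_basis n)))" for y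
  have f: "ell2_nth (f y) n = cinner y (blinfun_apply A (ell2_basis n))" for y n
    unfolding f_def using adjoint_coords_summable(1)[OF A] by (simp add: Abs_ell2_inverse)
  have "(norm (f y))\<^sup>2 \<le> (norm A * norm y)\<^sup>2" for y
    unfolding norm_sq_suminf f by (rule adjoint_coords_summable(2)[OF A])
  then have "norm (f y) \<le> norm A * norm y" for y
    by (simp add: power2_le_iff_abs_le)
  then have B: "blinfun_apply (mk_op f) = f" "mk_op f \<in> Omega_B"
    by (intro mk_op[where K = "norm A"]; auto intro!: ell2_eqI simp: f cinner_add_left cinner_scaleC_left)+
  have "cinner (blinfun_apply A x) y = cinner x (f y)" for x y
  proof -
    have "cinner (blinfun_apply A (head m x)) y = cinner (head m x) (f y)" for m
      unfolding Omega_B_fin[OF A] unfolding fin_eq_sum cinner_sum_left cinner_scaleC_left cinner_basis_left f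
      by (simp flip: cinner_commute)
    moreover have "(\<lambda>m. cinner (blinfun_apply A (head m x)) y) \<longlonglongrightarrow> cinner (blinfun_apply A x) y"
      by (intro bounded_linear.tendsto[OF bounded_linear_cinner_left] tendsto_intros head_tendsto)
    moreover have "(\<lambda>m. cinner (head m x) (f y)) \<longlonglongrightarrow> cinner x (f y)"
      by (intro bounded_linear.tendsto[OF bounded_linear_cinner_left] head_tendsto)
    ultimately show ?thesis using LIMSEQ_unique by simp
  qed
  then show ?thesis using that[of "mk_op f"] B by simp
qed

lemma adj_eqI:
  assumes "\<And>x y. cinner (blinfun_apply A x) y = cinner x (blinfun_apply B y)"
  shows "adj A = B"
  unfolding adj_def
proof (rule the_equality)
  fix C assume "\<forall>x y. cinner (blinfun_apply A x) y = cinner x (blinfun_apply C y)"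
  then have "cinner x (blinfun_apply C y) = cinner x (blinfun_apply B y)" for x y
    using assms[of x y] by simp
  then have "blinfun_apply C y = blinfun_apply B y" for y by (rule cinner_eqI)
  then show "C = B" by (rule blinfun_eqI)
qed (use assms in simp)

lemma adj:
  assumes "A \<in> Omega_B"
  shows "adj A \<in> Omega_B" "cinner (blinfun_apply A x) y = cinner x (blinfun_apply (adj A) y)"
    "cinner x (blinfun_apply A y) = cinner (blinfun_apply (adj A) x) y"
proof -
  obtain B where B: "B \<in> Omega_B" "\<And>x y. cinner (blinfun_apply A x) y = cinner x (blinfun_apply B y)"
    using adjoint_exists[OF assms] by blast
  then have "adj A = B" by (intro adj_eqI)
  with B show "adj A \<in> Omega_B" "cinner (blinfun_apply A x) y = cinner x (blinfun_apply (adj A) y)"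
    by auto
  show "cinner x (blinfun_apply A y) = cinner (blinfun_apply (adj A) x) y"
    using B(2)[of y x] cinner_commute[of "blinfun_apply A y" x] cinner_commute[of y "blinfun_apply B x"]
    by (simp add: \<open>adj A = B\<close>)
qed

section \<open>The essential numerical range\<close>

text \<open>The numerical range of the compression of \<open>A\<close> to the span of the basis vectors from \<open>n\<close> on,
  written without the compression.\<close>

definition tail_range :: "op2 \<Rightarrow> nat \<Rightarrow> complex set" where
  "tail_range A n = {cinner (blinfun_apply A x) x | x. norm x = 1 \<and> (\<forall>i<n. ell2_nth x i = 0)}"

lemma tail_range_I:
  "norm x = 1 \<Longrightarrow> (\<And>i. i < n \<Longrightarrow> ell2_nth x i = 0) \<Longrightarrow> cinner (blinfun_apply A x) x \<in> tail_range A n"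
  by (auto simp: tail_range_def)

lemma quotient_in_tail_range:
  assumes A: "A \<in> Omega_B" and x: "x \<noteq> 0" "\<And>i. i < n \<Longrightarrow> ell2_nth x i = 0"
  shows "cinner (blinfun_apply A x) x / of_real ((norm x)\<^sup>2) \<in> tail_range A n"
proof -
  let ?y = "scaleC (of_real (1 / norm x)) x"
  have "cinner (blinfun_apply A ?y) ?y = cinner (blinfun_apply A x) x / of_real ((norm x)\<^sup>2)"
    using x(1) by (simp add: Omega_B_scaleC[OF A] cinner_scaleC_left cinner_scaleC_right power2_eq_square)
  moreover have "norm ?y = 1" using x(1) by (simp add: norm_divide)
  ultimately show ?thesis using tail_range_I[of ?y n A] x(2) by simp
qed

lemma tail_range_nonempty: "tail_range A n \<noteq> {}"
proof -
  have "cinner (blinfun_apply A (ell2_basis n)) (ell2_basis n) \<in> tail_range A n"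
    by (rule tail_range_I) auto
  then show ?thesis by blast
qed

lemma tail_range_antimono: "m \<le> n \<Longrightarrow> tail_range A n \<subseteq> tail_range A m"
  by (fastforce simp: tail_range_def)

lemma tail_range_bound: "z \<in> tail_range A n \<Longrightarrow> cmod z \<le> norm A"
proof -
  assume "z \<in> tail_range A n"
  then obtain x where x: "norm x = 1" "z = cinner (blinfun_apply A x) x"
    by (auto simp: tail_range_def)
  have "cmod z \<le> norm (blinfun_apply A x) * norm x" unfolding x(2) by (rule cauchy_schwarz)
  also have "\<dots> \<le> norm A" using norm_blinfun[of A x] x(1) by simp
  finally show ?thesis .
qed

lemma compact_closure_tail_range: "compact (closure (tail_range A n))"
  unfolding compact_closure using tail_range_bound by (auto intro!: boundedI)

text \<open>Toeplitz--Hausdorff.  After an affine change \<open>B\<close> of the form, \<open>x\<close> and \<open>y\<close> have the values \<open>0\<close>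
  and \<open>1\<close>, and multiplying \<open>y\<close> by a phase makes the mixed term real; then the form is real along
  the segment from \<open>x\<close> to \<open>y\<close>, and the intermediate value theorem applies.\<close>

lemma convex_tail_range:
  assumes A: "A \<in> Omega_B" shows "convex (tail_range A n)"
  unfolding convex_alt
proof (intro ballI allI impI)
  fix a b and t :: real
  assume a: "a \<in> tail_range A n" and b: "b \<in> tail_range A n" and t: "0 \<le> t \<and> t \<le> 1"
  show "(1 - t) *\<^sub>R a + t *\<^sub>R b \<in> tail_range A n"
  proof (cases "a = b")
    case True
    then show ?thesis using a by (simp add: algebra_simps flip: scaleR_add_left)
  next
    case False
    obtain x where x: "norm x = 1" "\<And>i. i < n \<Longrightarrow> ell2_nth x i = 0" "a = cinner (blinfun_apply A x) x"
      using a by (auto simp: tail_range_def)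
    obtain y' where y': "norm y' = 1" "\<And>i. i < n \<Longrightarrow> ell2_nth y' i = 0" "b = cinner (blinfun_apply A y') y'"
      using b by (auto simp: tail_range_def)
    define B where "B u v = (cinner (blinfun_apply A u) v - a * cinner u v) / (b - a)" for u v
    have B_add: "B (u + v) w = B u w + B v w" "B w (u + v) = B w u + B w v" for u v w
      by (simp_all add: B_def blinfun.add_right cinner_add_left cinner_add_right diff_divide_distrib
          add_divide_distrib algebra_simps)
    have B_scale: "B (scaleC c u) v = c * B u v" "B u (scaleC c v) = cnj c * B u v" for c u v
      by (simp_all add: B_def Omega_B_scaleC[OF A] cinner_scaleC_left cinner_scaleC_right
          diff_divide_distrib algebra_simps)
    define \<delta> where "\<delta> = B y' x - cnj (B x y')"
    define c where "c = (if \<delta> = 0 then 1 else cnj (sgn \<delta>))"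
    have c: "cmod c = 1" by (simp add: c_def norm_sgn)
    have "Im (c * \<delta>) = 0"
    proof (cases "\<delta> = 0")
      case False
      have "cnj \<delta> * \<delta> = of_real ((cmod \<delta>)\<^sup>2)" using complex_norm_square[of \<delta>] by (simp add: mult.commute)
      then have "c * \<delta> = of_real ((cmod \<delta>)\<^sup>2 / cmod \<delta>)" using False by (simp add: c_def sgn_eq)
      then show ?thesis by (simp only: Im_complex_of_real)
    qed simp
    define y where "y = scaleC c y'"
    have y: "norm y = 1" "\<And>i. i < n \<Longrightarrow> ell2_nth y i = 0"
      using y' c by (auto simp: y_def)
    have cc: "cnj c * c = 1" using c complex_norm_square[of c] by (simp add: mult.commute)
    have Axy: "cinner (blinfun_apply A y) y = b"
      using cc by (simp add: y_def Omega_B_scaleC[OF A] cinner_scaleC_left cinner_scaleC_right y'(3) mult.assoc[symmetric])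
    have "B x y + B y x = cnj c * B x y' + c * B y' x" by (simp add: y_def B_scale)
    moreover have "Im (cnj c * B x y' + c * B y' x) = Im (c * \<delta>)"
      by (simp add: \<delta>_def algebra_simps)
    ultimately have "Im (B x y + B y x) = 0" using \<open>Im (c * \<delta>) = 0\<close> by simp
    then obtain r where r: "B x y + B y x = of_real r"
      by (metis complex_is_Real_iff Reals_cases)
    have Bx: "B x x = 0" and By: "B y y = 1"
      using False x(1) y(1) by (simp_all add: B_def cinner_self x(3)[symmetric] Axy)
    define v where "v s = scaleC (of_real (1 - s)) x + scaleC (of_real s) y" for s
    have Bv: "B (v s) (v s) = of_real (s\<^sup>2 + s * (1 - s) * r)" for s
    proof -
      have "B (v s) (v s) = of_real ((1 - s) * (1 - s)) * B x x + of_real (s * s) * B y y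
          + of_real (s * (1 - s)) * (B x y + B y x)"
        by (simp add: v_def B_add B_scale algebra_simps)
      then show ?thesis by (simp add: Bx By r power2_eq_square)
    qed
    have v0: "v s \<noteq> 0" if s: "0 \<le> s" "s \<le> 1" for s
    proof
      assume "v s = 0"
      then have eq: "scaleC (of_real (1 - s)) x = - scaleC (of_real s) y"
        by (simp add: v_def eq_neg_iff_add_eq_0)
      then have "norm (scaleC (of_real (1 - s)) x) = norm (scaleC (of_real s) y)" by simp
      then have "1 - s = s" using s x(1) y(1) by (simp only: norm_scaleC norm_of_real) simp
      then have s2: "s = 1 / 2" by simp
      have "scaleC (1 / 2) x = scaleC (1 / 2) (- y)" using eq unfolding s2 by simp
      then have "scaleC 2 (scaleC (1 / 2) x) = scaleC 2 (scaleC (1 / 2) (- y))" by simp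
      then have "x = - y" by simp
      then show False using False x(3) Axy by (simp add: blinfun.minus_right)
    qed
    define g where "g s = (s\<^sup>2 + s * (1 - s) * r) / (norm (v s))\<^sup>2" for s
    have cont_v: "continuous_on {0..1} (\<lambda>s. norm (v s))"
      unfolding v_def scaleR_eq_scaleC[symmetric] by (intro continuous_intros)
    have "continuous_on {0..1} g"
      unfolding g_def by (intro continuous_intros cont_v) (use v0 in auto)
    moreover have "g 0 \<le> t" "t \<le> g 1" using t y(1) by (auto simp: g_def v_def)
    ultimately obtain s where s: "0 \<le> s" "s \<le> 1" "g s = t"
      using IVT'[of g 0 t 1] by auto
    have "cinner (blinfun_apply A (v s)) (v s) = B (v s) (v s) * (b - a) + a * cinner (v s) (v s)"
      using False by (simp add: B_def)
    also have "\<dots> = of_real (t * (norm (v s))\<^sup>2) * (b - a) + a * of_real ((norm (v s))\<^sup>2)"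
      unfolding Bv cinner_self using v0[OF s(1,2)] s(3) by (simp add: g_def field_simps)
    finally have "cinner (blinfun_apply A (v s)) (v s) / of_real ((norm (v s))\<^sup>2) = of_real t * (b - a) + a"
      using v0[OF s(1,2)] by (simp add: add_divide_distrib)
    moreover have "cinner (blinfun_apply A (v s)) (v s) / of_real ((norm (v s))\<^sup>2) \<in> tail_range A n"
      using v0[OF s(1,2)] x(2) y(2) by (intro quotient_in_tail_range[OF A]) (auto simp: v_def)
    moreover have "(1 - t) *\<^sub>R a + t *\<^sub>R b = of_real t * (b - a) + a"
      by (simp add: scaleR_conv_of_real algebra_simps)
    ultimately show ?thesis by simp
  qed
qed

text \<open>Images of the unit ball under finite rank operators lie in sets of this form; they are compact by
  induction on the number of vectors.\<close>

lemma compact_coefficient_sums: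
  fixes m :: nat
  shows "compact {\<Sum>i<m. scaleC (c i) (u i) | c. \<forall>i<m. cmod (c i) \<le> R}"
proof (induction m)
  case (Suc m)
  let ?S = "\<lambda>m. {\<Sum>i<m. scaleC (c i) (u i) | c. \<forall>i<m. cmod (c i) \<le> R}"
  let ?h = "\<lambda>p. fst p + scaleC (snd p) (u m)"
  have "bounded_linear (\<lambda>c. scaleC c (u m))"
    by (rule bounded_linear_intro[where K = "norm (u m)"])
      (auto simp: scaleC_distribs scaleR_eq_scaleC scaleR_conv_of_real)
  then have "continuous_on (?S m \<times> cball 0 R) ?h"
    by (intro continuous_intros bounded_linear.continuous_on[of "\<lambda>c. scaleC c (u m)"])
  then have "compact (?h ` (?S m \<times> cball 0 R))"
    using Suc by (intro compact_continuous_image compact_Times) auto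
  moreover have "?h ` (?S m \<times> cball 0 R) = ?S (Suc m)"
  proof
    show "?h ` (?S m \<times> cball 0 R) \<subseteq> ?S (Suc m)"
    proof clarsimp
      fix d c assume *: "cmod d \<le> R" "\<forall>i<m. cmod (c i) \<le> R"
      show "\<exists>c'. (\<Sum>i<m. scaleC (c i) (u i)) + scaleC d (u m) = (\<Sum>i<m. scaleC (c' i) (u i)) + scaleC (c' m) (u m) \<and>
          (\<forall>i<Suc m. cmod (c' i) \<le> R)"
        using * by (intro exI[of _ "c(m := d)"]) (auto simp: less_Suc_eq)
    qed
    show "?S (Suc m) \<subseteq> ?h ` (?S m \<times> cball 0 R)"
    proof clarsimp
      fix c assume *: "\<forall>i<Suc m. cmod (c i) \<le> R"
      show "(\<Sum>i<m. scaleC (c i) (u i)) + scaleC (c m) (u m) \<in> ?h ` (?S m \<times> cball 0 R)"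
        by (rule image_eqI[of _ _ "(\<Sum>i<m. scaleC (c i) (u i), c m)"]) (use * in auto)
    qed
  qed
  ultimately show ?case by simp
qed simp

text \<open>Replacing the first \<open>n\<close> coordinates of \<open>A\<close> by the scalar \<open>z\<close> is a finite rank perturbation,
  and for \<open>z\<close> in the tail range it leaves, by convexity, a numerical range inside the tail range.\<close>

lemma ess_num_range_subset:
  assumes A: "A \<in> Omega_B" shows "ess_num_range A \<subseteq> closure (tail_range A n)"
proof -
  obtain z where z: "z \<in> tail_range A n" using tail_range_nonempty by blast
  define Q where "Q x = x - head n x" for x
  define f where "f x = scaleC z (head n x) + Q (blinfun_apply A (Q x)) - blinfun_apply A x" for x
  have Q: "Q (x + y) = Q x + Q y" "Q (scaleC c x) = scaleC c (Q x)" "ell2_nth (Q x) i = (if i < n then 0 else ell2_nth x i)" for x y c i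
    by (auto intro!: ell2_eqI simp: Q_def algebra_simps)
  have norm_Q: "norm (Q x) \<le> norm x" for x
  proof -
    have "(norm (Q x))\<^sup>2 \<le> (norm x)\<^sup>2" unfolding Q_def using pythagoras_head[of x n] by simp
    then show ?thesis by (simp add: power2_le_iff_abs_le)
  qed
  have QA: "norm (Q (blinfun_apply A (Q x))) \<le> norm A * norm x" "norm (blinfun_apply A (Q x)) \<le> norm A * norm x" for x
  proof -
    show "norm (blinfun_apply A (Q x)) \<le> norm A * norm x"
      by (rule order_trans[OF norm_blinfun]) (intro mult_left_mono norm_Q norm_ge_zero)
    then show "norm (Q (blinfun_apply A (Q x))) \<le> norm A * norm x"
      using norm_Q order_trans by blast
  qed
  have head: "head n (x + y) = head n x + head n y" "head n (scaleC c x) = scaleC c (head n x)" for x y c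
    by (auto intro!: ell2_eqI)
  have "norm (f x) \<le> (cmod z + norm A + norm A) * norm x" for x
  proof -
    have "norm (f x) \<le> norm (scaleC z (head n x)) + norm (Q (blinfun_apply A (Q x))) + norm (blinfun_apply A x)"
      unfolding f_def using norm_triangle_ineq4 norm_triangle_ineq add_mono order_refl order_trans by meson
    also have "\<dots> \<le> cmod z * norm x + norm A * norm x + norm A * norm x"
      by (intro add_mono QA norm_blinfun) (simp add: mult_left_mono norm_head_le)
    finally show ?thesis by (simp add: algebra_simps)
  qed
  moreover have "f (x + y) = f x + f y" for x y
    unfolding f_def head Q(1) blinfun.add_right scaleC_distribs by simp
  moreover have "f (scaleC c x) = scaleC c (f x)" for c x
    unfolding f_def head Q(2) Omega_B_scaleC[OF A] scaleC_distribs by (simp add: mult.commute)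
  ultimately have B: "blinfun_apply (mk_op f) = f" "mk_op f \<in> Omega_B"
    using mk_op[of f] by blast+
  have "mk_op f \<in> Omega_K"
  proof -
    define R where "R = cmod z + norm A + 1"
    let ?S = "\<lambda>u. {\<Sum>i<n. scaleC (c i) (u i) | c. \<forall>i<n. cmod (c i) \<le> R}"
    let ?S2 = "\<lambda>u w. {x + y | x y. x \<in> ?S u \<and> y \<in> ?S w}"
    let ?T = "?S2 ell2_basis (\<lambda>i. blinfun_apply A (ell2_basis i))"
    have "compact ?T" by (intro compact_sums compact_coefficient_sums)
    moreover have "f ` cball 0 1 \<subseteq> ?T"
    proof (rule image_subsetI)
      fix x :: ell2 assume "x \<in> cball 0 1"
      then have x: "norm x \<le> 1" by simp
      let ?c = "\<lambda>i. z * ell2_nth x i - ell2_nth (blinfun_apply A (Q x)) i"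
      let ?d = "\<lambda>i. - ell2_nth x i"
      have "blinfun_apply A x = blinfun_apply A (Q x) + blinfun_apply A (head n x)"
        by (simp add: Q_def flip: blinfun.add_right)
      then have "f x = fin n ?c + (\<Sum>i<n. scaleC (?d i) (blinfun_apply A (ell2_basis i)))"
        unfolding Omega_B_fin[OF A] f_def
        by (intro ell2_eqI) (auto simp: Q(3) sum_negf)
      moreover have "cmod (?c i) \<le> R" for i
      proof -
        have "cmod (?c i) \<le> cmod z * cmod (ell2_nth x i) + cmod (ell2_nth (blinfun_apply A (Q x)) i)"
          by (rule order_trans[OF norm_triangle_ineq4]) (simp add: norm_mult)
        also have "\<dots> \<le> cmod z * 1 + norm A * 1"
          using cmod_nth_le[of x i] cmod_nth_le[of "blinfun_apply A (Q x)" i] QA(2)[of x] x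
            mult_left_mono[OF x norm_ge_zero[of A]]
          by (intro add_mono mult_left_mono) auto
        finally show ?thesis by (simp add: R_def)
      qed
      moreover have "cmod (?d i) \<le> R" for i
      proof -
        have "cmod (?d i) \<le> 1" using cmod_nth_le[of x i] x by simp
        then show ?thesis using norm_ge_zero[of z] norm_ge_zero[of A] unfolding R_def by linarith
      qed
      ultimately have "f x = fin n ?c + (\<Sum>i<n. scaleC (?d i) (blinfun_apply A (ell2_basis i)))"
        "fin n ?c \<in> ?S ell2_basis"
        "(\<Sum>i<n. scaleC (?d i) (blinfun_apply A (ell2_basis i))) \<in> ?S (\<lambda>i. blinfun_apply A (ell2_basis i))"
        unfolding fin_eq_sum mem_Collect_eq by (simp, intro exI[of _ ?c] conjI allI impI refl, simp,
          intro exI[of _ ?d] conjI allI impI refl, simp)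
      then show "f x \<in> ?T" by blast
    qed
    ultimately have "closure (f ` cball 0 1) \<subseteq> ?T"
      by (intro closure_minimal compact_imp_closed)
    then have eq: "?T \<inter> closure (f ` cball 0 1) = closure (f ` cball 0 1)"
      by (rule Int_absorb1)
    have "compact (closure (f ` cball 0 1))"
      using compact_Int_closed[OF \<open>compact ?T\<close> closed_closure, of "f ` cball 0 1"] unfolding eq .
    then show ?thesis using B by (simp add: Omega_K_def)
  qed
  then have "ess_num_range A \<subseteq> closure (num_range (A + mk_op f))"
    by (auto simp: ess_num_range_def)
  also have "\<dots> \<subseteq> closure (tail_range A n)"
  proof (rule closure_mono, rule subsetI)
    fix w assume "w \<in> num_range (A + mk_op f)"
    then obtain x where x: "norm x = 1" "w = cinner (blinfun_apply (A + mk_op f) x) x"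
      by (auto simp: num_range_def)
    have "w = cinner (scaleC z (head n x) + Q (blinfun_apply A (Q x))) x"
      by (simp add: x(2) blinfun.add_left B f_def)
    also have "\<dots> = z * cinner (head n x) x + cinner (blinfun_apply A (Q x)) (Q x)"
      unfolding Q_def by (simp add: cinner_add_left cinner_scaleC_left cinner_diff_left cinner_diff_right cinner_head)
    also have "cinner (head n x) x = of_real ((norm (head n x))\<^sup>2)"
    proof -
      have "head n (head n x) = head n x" by (auto intro: ell2_eqI)
      then have "cinner (head n x) x = cinner (head n x) (head n x)" by (metis cinner_head)
      then show ?thesis by (simp add: cinner_self)
    qed
    finally have w: "w = z * of_real ((norm (head n x))\<^sup>2) + cinner (blinfun_apply A (Q x)) (Q x)" .
    have s: "(norm (Q x))\<^sup>2 = 1 - (norm (head n x))\<^sup>2"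
      using pythagoras_head[of x n] x(1) by (simp add: Q_def)
    show "w \<in> tail_range A n"
    proof (cases "Q x = 0")
      case True
      then have "(norm (head n x))\<^sup>2 = 1" using s by simp
      then show ?thesis using w z True by (simp del: of_real_power)
    next
      case False
      let ?q = "cinner (blinfun_apply A (Q x)) (Q x) / of_real ((norm (Q x))\<^sup>2)"
      have "?q \<in> tail_range A n" using False by (intro quotient_in_tail_range[OF A]) (auto simp: Q)
      moreover have "1 - (norm (Q x))\<^sup>2 \<ge> 0" using s by simp
      ultimately have "(1 - (norm (Q x))\<^sup>2) *\<^sub>R z + (norm (Q x))\<^sup>2 *\<^sub>R ?q \<in> tail_range A n"
        using convex_tail_range[OF A, of n] z unfolding convex_alt by simp
      moreover have "(1 - (norm (Q x))\<^sup>2) *\<^sub>R z + (norm (Q x))\<^sup>2 *\<^sub>R ?q = w"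
      proof -
        have "of_real ((norm (Q x))\<^sup>2) * ?q = cinner (blinfun_apply A (Q x)) (Q x)" using False by simp
        moreover have "1 - (norm (Q x))\<^sup>2 = (norm (head n x))\<^sup>2" using s by simp
        ultimately show ?thesis unfolding w scaleR_conv_of_real by (simp only: mult.commute)
      qed
      ultimately show ?thesis by simp
    qed
  qed
  finally show ?thesis .
qed

text \<open>Compact operators map a bounded sequence that tends to zero weakly to a null sequence, so they
  do not change limits of the form along the tails.\<close>

lemma subset_ess_num_range:
  assumes A: "A \<in> Omega_B" and z: "\<And>n. z \<in> closure (tail_range A n)"
  shows "z \<in> ess_num_range A"
  unfolding ess_num_range_def
proof (rule INT_I)
  fix K assume "K \<in> Omega_K"
  then have K: "K \<in> Omega_B" "compact (closure (blinfun_apply K ` cball 0 1))" by (auto simp: Omega_K_def)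
  have "\<exists>x. norm x = 1 \<and> (\<forall>i<n. ell2_nth x i = 0) \<and> dist (cinner (blinfun_apply A x) x) z < inverse (real (Suc n))" for n
  proof -
    obtain w where "w \<in> tail_range A n" "dist w z < inverse (real (Suc n))"
      using z[of n] unfolding closure_approachable by (metis inverse_positive_iff_positive of_nat_0_less_iff zero_less_Suc)
    then show ?thesis by (auto simp: tail_range_def)
  qed
  then obtain x where x: "\<And>n. norm (x n) = 1" "\<And>n i. i < n \<Longrightarrow> ell2_nth (x n) i = 0"
    "\<And>n. dist (cinner (blinfun_apply A (x n)) (x n)) z < inverse (real (Suc n))" by metis
  have "blinfun_apply K (x n) \<in> blinfun_apply K ` cball 0 1" for n
    by (rule imageI) (simp add: x(1))
  then have "blinfun_apply K (x n) \<in> closure (blinfun_apply K ` cball 0 1)" for n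
    using closure_subset by blast
  then obtain y r where r: "strict_mono r" "((\<lambda>n. blinfun_apply K (x n)) \<circ> r) \<longlonglongrightarrow> y"
    using seq_compactE[OF K(2)[unfolded compact_eq_seq_compact_metric], of "\<lambda>n. blinfun_apply K (x n)"]
    by blast
  have "ell2_nth y i = 0" for i
  proof -
    let ?w = "blinfun_apply (adj K) (ell2_basis i)"
    have "cmod (cinner (blinfun_apply K (x (r n))) (ell2_basis i)) \<le> norm (head (r n) ?w - ?w)" for n
    proof -
      have "head (r n) (x (r n)) = 0" using x(2) by (auto intro!: ell2_eqI)
      then have "cinner (x (r n)) (head (r n) ?w) = 0" by (simp flip: cinner_head)
      then have "cinner (blinfun_apply K (x (r n))) (ell2_basis i) = cinner (x (r n)) (?w - head (r n) ?w)"
        by (simp add: adj(2)[OF K(1)] cinner_diff_right)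
      then show ?thesis using cauchy_schwarz[of "x (r n)" "?w - head (r n) ?w"] x(1)
        by (simp add: norm_minus_commute)
    qed
    moreover have "(\<lambda>n. norm (head (r n) ?w - ?w)) \<longlonglongrightarrow> 0"
      using LIMSEQ_subseq_LIMSEQ[OF head_tendsto[of ?w] r(1)]
      by (intro tendsto_norm_zero LIM_zero) (simp add: o_def)
    ultimately have "(\<lambda>n. cinner (blinfun_apply K (x (r n))) (ell2_basis i)) \<longlonglongrightarrow> 0"
      by (rule Lim_null_comparison[OF always_eventually[OF allI]])
    moreover have "(\<lambda>n. cinner (blinfun_apply K (x (r n))) (ell2_basis i)) \<longlonglongrightarrow> cinner y (ell2_basis i)"
      using r(2) by (intro bounded_linear.tendsto[OF bounded_linear_cinner_left]) (simp add: o_def)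
    ultimately have "0 = cinner y (ell2_basis i)" by (rule LIMSEQ_unique)
    then show ?thesis by (simp add: cinner_basis_right)
  qed
  then have "y = 0" by (intro ell2_eqI) simp
  have "cmod (cinner (blinfun_apply K (x (r n))) (x (r n))) \<le> norm (blinfun_apply K (x (r n)))" for n
    using cauchy_schwarz[of "blinfun_apply K (x (r n))" "x (r n)"] x(1) by simp
  moreover have "(\<lambda>n. norm (blinfun_apply K (x (r n)))) \<longlonglongrightarrow> 0"
    using r(2) \<open>y = 0\<close> by (intro tendsto_norm_zero) (simp add: o_def)
  ultimately have k: "(\<lambda>n. cinner (blinfun_apply K (x (r n))) (x (r n))) \<longlonglongrightarrow> 0"
    by (rule Lim_null_comparison[OF always_eventually[OF allI]])
  have "(\<lambda>n. cinner (blinfun_apply A (x n)) (x n)) \<longlonglongrightarrow> z"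
  proof (rule tendsto_dist_iff[THEN iffD2], rule Lim_null_comparison[OF always_eventually])
    show "\<forall>n. norm (dist (cinner (blinfun_apply A (x n)) (x n)) z) \<le> inverse (real (Suc n))"
      using x(3) less_imp_le by auto
  qed (rule LIMSEQ_inverse_real_of_nat)
  from tendsto_add[OF LIMSEQ_subseq_LIMSEQ[OF this r(1)] k]
  have "(\<lambda>n. cinner (blinfun_apply (A + K) (x (r n))) (x (r n))) \<longlonglongrightarrow> z"
    by (simp add: o_def blinfun.add_left cinner_add_left)
  moreover have "cinner (blinfun_apply (A + K) (x (r n))) (x (r n)) \<in> num_range (A + K)" for n
    using x(1) by (auto simp: num_range_def)
  ultimately show "z \<in> closure (num_range (A + K))"
    unfolding closure_sequential by (intro exI[of _ "\<lambda>n. cinner (blinfun_apply (A + K) (x (r n))) (x (r n))"]) auto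
qed

lemma ess_num_range_eq: "A \<in> Omega_B \<Longrightarrow> ess_num_range A = (\<Inter>n. closure (tail_range A n))"
  by (intro subset_antisym INT_greatest ess_num_range_subset subsetI subset_ess_num_range) auto

lemma ess_num_range_ne_compact:
  assumes "A \<in> Omega_B" shows "ess_num_range A \<in> ne_compacts"
proof -
  have "(\<Inter>n. closure (tail_range A n)) \<noteq> {}"
    using compact_closure_tail_range[of A]
    by (intro compact_nest) (auto simp: tail_range_nonempty dest: closure_mono[OF tail_range_antimono])
  moreover have "compact (\<Inter>n. closure (tail_range A n))"
    unfolding compact_eq_bounded_closed
    by (intro conjI closed_INT ballI closed_closure
        bounded_subset[OF compact_imp_bounded[OF compact_closure_tail_range[of A 0]]]) auto
  ultimately show ?thesis using assms by (simp add: ne_compacts_def ess_num_range_eq)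
qed

section \<open>The spectrum\<close>

text \<open>For small \<open>t\<close> the map \<open>x \<mapsto> x - t (S x - y)\<close> is a contraction; its fixed point solves
  \<open>S x = y\<close>.\<close>

lemma coercive_surjective:
  fixes S :: op2
  assumes e: "e > 0" and S: "\<And>x. e * (norm x)\<^sup>2 \<le> inner (blinfun_apply S x) x"
  obtains x where "blinfun_apply S x = y"
proof -
  define M where "M = norm S + e"
  \<comment> \<open>This value of \<open>t\<close> minimises the squared contraction factor \<open>1 - 2 t e + t\<^sup>2 M\<^sup>2\<close>.\<close>
  define t where "t = e / M\<^sup>2"
  define q where "q = sqrt (1 - e\<^sup>2 / M\<^sup>2)"
  have M: "e \<le> M" "norm S \<le> M" "0 < M" using e by (auto simp: M_def add_nonneg_pos)
  have "e\<^sup>2 \<le> M\<^sup>2" using M e by (intro power_mono) auto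
  then have q: "0 \<le> q" "q < 1" "q\<^sup>2 = 1 - e\<^sup>2 / M\<^sup>2"
    using M e by (auto simp: q_def)
  have contr: "norm (u - t *\<^sub>R blinfun_apply S u) \<le> q * norm u" for u
  proof -
    have "norm (blinfun_apply S u) \<le> M * norm u"
      using norm_blinfun[of S u] mult_right_mono[OF M(2) norm_ge_zero[of u]] by linarith
    then have Su: "(norm (blinfun_apply S u))\<^sup>2 \<le> M\<^sup>2 * (norm u)\<^sup>2"
      by (metis norm_ge_zero power_mono power_mult_distrib)
    have t: "0 < t" using e M by (simp add: t_def)
    have "(norm (u - t *\<^sub>R blinfun_apply S u))\<^sup>2
        = (norm u)\<^sup>2 - 2 * t * inner (blinfun_apply S u) u + t\<^sup>2 * (norm (blinfun_apply S u))\<^sup>2"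
      unfolding power2_norm_eq_inner
      by (simp add: inner_diff_left inner_diff_right inner_commute power2_eq_square algebra_simps)
    also have "\<dots> \<le> (norm u)\<^sup>2 - 2 * t * (e * (norm u)\<^sup>2) + t\<^sup>2 * (M\<^sup>2 * (norm u)\<^sup>2)"
      using t by (intro add_mono diff_mono mult_left_mono S Su order_refl) auto
    also have "\<dots> = (1 - 2 * t * e + t\<^sup>2 * M\<^sup>2) * (norm u)\<^sup>2" by (simp add: algebra_simps)
    also have "1 - 2 * t * e + t\<^sup>2 * M\<^sup>2 = q\<^sup>2"
      using M(3) unfolding q(3) t_def by (simp add: power2_eq_square field_simps)
    finally have "(norm (u - t *\<^sub>R blinfun_apply S u))\<^sup>2 \<le> (q * norm u)\<^sup>2"
      by (simp add: power_mult_distrib)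
    then show ?thesis using q(1) by (simp add: power2_le_iff_abs_le)
  qed
  let ?f = "\<lambda>x. x - t *\<^sub>R (blinfun_apply S x - y)"
  have "dist (?f u) (?f v) \<le> q * dist u v" for u v
  proof -
    have "?f u - ?f v = (u - v) - t *\<^sub>R blinfun_apply S (u - v)"
      by (simp add: blinfun.diff_right algebra_simps)
    then show ?thesis unfolding dist_norm by (simp only: contr)
  qed
  then obtain x where "?f x = x"
    using Banach_fix[OF complete_ell2 UNIV_not_empty q(1,2) subset_UNIV, of ?f] by blast
  moreover have "t \<noteq> 0" using e M by (simp add: t_def)
  ultimately have "blinfun_apply S x = y" by simp
  then show ?thesis using that by blast
qed

lemma adj_compose_self:
  assumes "T \<in> Omega_B"
  shows "inner (blinfun_apply T (blinfun_apply (adj T) x)) x = (norm (blinfun_apply (adj T) x))\<^sup>2"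
  unfolding inner_ell2_def adj(2)[OF assms] cinner_self by simp

text \<open>If the adjoint is bounded below then \<open>T T\<^sup>*\<close> is coercive, so \<open>T\<close> is onto; the lower bound for \<open>T\<close>
  itself makes the inverse single-valued and bounded.  Conversely the norms of an inverse and of its
  adjoint give the lower bounds.\<close>

lemma boundedly_invertible_iff:
  assumes T: "T \<in> Omega_B"
  shows "(\<exists>R\<in>Omega_B. \<forall>x. blinfun_apply R (blinfun_apply T x) = x \<and> blinfun_apply T (blinfun_apply R x) = x)
    \<longleftrightarrow> (\<exists>e>0. \<forall>x. e * (norm x)\<^sup>2 \<le> (norm (blinfun_apply T x))\<^sup>2 \<and>
                  e * (norm x)\<^sup>2 \<le> (norm (blinfun_apply (adj T) x))\<^sup>2)"
proof
  assume "\<exists>R\<in>Omega_B. \<forall>x. blinfun_apply R (blinfun_apply T x) = x \<and> blinfun_apply T (blinfun_apply R x) = x"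
  then obtain R where R: "R \<in> Omega_B" "\<And>x. blinfun_apply R (blinfun_apply T x) = x"
    "\<And>x. blinfun_apply T (blinfun_apply R x) = x" by blast
  have R': "blinfun_apply (adj R) (blinfun_apply (adj T) x) = x" for x
    by (rule cinner_eqI) (simp add: adj(2)[OF R(1), symmetric] adj(2)[OF T, symmetric] R(3))
  define M where "M = max (norm R) (norm (adj R)) + 1"
  have M: "0 < M" "norm R \<le> M" "norm (adj R) \<le> M"
    by (auto simp: M_def add_nonneg_pos le_max_iff_disj)
  have low: "1 / M\<^sup>2 * (norm x)\<^sup>2 \<le> (norm w)\<^sup>2"
    if "blinfun_apply B w = x" "norm B \<le> M" for B :: op2 and w x
  proof -
    have "norm x \<le> M * norm w"
      using norm_blinfun[of B w] mult_right_mono[OF that(2) norm_ge_zero[of w]] that(1) by simp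
    then have "(norm x)\<^sup>2 \<le> (M * norm w)\<^sup>2" by (intro power_mono) auto
    then show ?thesis using M(1) by (simp add: power_mult_distrib field_simps)
  qed
  show "\<exists>e>0. \<forall>x. e * (norm x)\<^sup>2 \<le> (norm (blinfun_apply T x))\<^sup>2 \<and>
      e * (norm x)\<^sup>2 \<le> (norm (blinfun_apply (adj T) x))\<^sup>2"
    using low[OF R(2) M(2)] low[OF R' M(3)] M(1) by (intro exI[of _ "1 / M\<^sup>2"]) auto
next
  assume "\<exists>e>0. \<forall>x. e * (norm x)\<^sup>2 \<le> (norm (blinfun_apply T x))\<^sup>2 \<and>
      e * (norm x)\<^sup>2 \<le> (norm (blinfun_apply (adj T) x))\<^sup>2"
  then obtain e where e: "e > 0" "\<And>x. e * (norm x)\<^sup>2 \<le> (norm (blinfun_apply T x))\<^sup>2"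
    "\<And>x. e * (norm x)\<^sup>2 \<le> (norm (blinfun_apply (adj T) x))\<^sup>2" by blast
  have surj: "\<exists>x. blinfun_apply T x = y" for y
  proof -
    have "e * (norm x)\<^sup>2 \<le> inner (blinfun_apply (T o\<^sub>L adj T) x) x" for x
      using e(3)[of x] adj_compose_self[OF T, of x] by simp
    then obtain x where "blinfun_apply (T o\<^sub>L adj T) x = y" using coercive_surjective[OF e(1)] by blast
    then show ?thesis by auto
  qed
  have inj: "x = y" if "blinfun_apply T x = blinfun_apply T y" for x y
  proof -
    have "e * (norm (x - y))\<^sup>2 \<le> 0" using e(2)[of "x - y"] that by (simp add: blinfun.diff_right)
    then have "(norm (x - y))\<^sup>2 \<le> 0" using e(1) by (simp add: mult_le_0_iff)
    then show ?thesis by simp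
  qed
  obtain r where r: "\<And>y. blinfun_apply T (r y) = y" using surj by metis
  have r_add: "r (x + y) = r x + r y" for x y by (rule inj) (simp add: r blinfun.add_right)
  have r_scale: "r (scaleC c x) = scaleC c (r x)" for x c
    by (rule inj) (simp add: r Omega_B_scaleC[OF T])
  have "norm (r y) \<le> sqrt (1 / e) * norm y" for y
  proof -
    have "(norm (r y))\<^sup>2 \<le> (sqrt (1 / e) * norm y)\<^sup>2"
      using e(2)[of "r y"] e(1) by (simp add: r power_mult_distrib field_simps)
    then show ?thesis using e(1) by (simp add: power2_le_iff_abs_le)
  qed
  then have "blinfun_apply (mk_op r) = r" "mk_op r \<in> Omega_B"
    using mk_op[OF r_add r_scale] by blast+
  moreover have "r (blinfun_apply T x) = x" for x by (rule inj) (rule r)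
  ultimately show "\<exists>R\<in>Omega_B. \<forall>x. blinfun_apply R (blinfun_apply T x) = x \<and> blinfun_apply T (blinfun_apply R x) = x"
    using r by metis
qed

lemma not_in_Sp_iff:
  assumes A: "A \<in> Omega_B"
  shows "z \<notin> Sp A \<longleftrightarrow> (\<exists>e>0. \<forall>x.
    e * (norm x)\<^sup>2 \<le> (norm (blinfun_apply A x - scaleC z x))\<^sup>2 \<and>
    e * (norm x)\<^sup>2 \<le> (norm (blinfun_apply (adj A) x - scaleC (cnj z) x))\<^sup>2)"
proof -
  have T: "A - scalar z \<in> Omega_B" by (intro Omega_B_diff A) simp
  have "adj (A - scalar z) = adj A - scalar (cnj z)"
    by (rule adj_eqI) (simp add: blinfun.diff_left cinner_diff_left cinner_diff_right adj(2)[OF A]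
        cinner_scaleC_left cinner_scaleC_right)
  with boundedly_invertible_iff[OF T] show ?thesis
    by (simp add: Sp_def blinfun.diff_left)
qed

section \<open>Computing with oracle machines\<close>

definition reaches ::
  "(nat \<Rightarrow> complex) \<Rightarrow> bss_instr list \<Rightarrow> nat \<times> (nat \<Rightarrow> real) \<Rightarrow> nat \<times> (nat \<Rightarrow> real) \<Rightarrow> bool" where
  "reaches orc P s t \<longleftrightarrow> (\<exists>T. (bss_step orc P ^^ T) s = t)"

lemma reaches_refl [simp]: "reaches orc P s s"
  unfolding reaches_def by (rule exI[of _ 0]) simp

lemma reaches_trans [trans]:
  assumes "reaches orc P s t" "reaches orc P t u"
  shows "reaches orc P s u"
proof -
  from assms obtain T T' where T: "(bss_step orc P ^^ T) s = t" "(bss_step orc P ^^ T') t = u"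
    unfolding reaches_def by blast
  have "(bss_step orc P ^^ (T' + T)) s = u"
    by (simp add: funpow_add T)
  then show ?thesis
    unfolding reaches_def by blast
qed

definition placed :: "bss_instr list \<Rightarrow> nat \<Rightarrow> bss_instr list \<Rightarrow> bool" where
  "placed P pc code \<longleftrightarrow> pc + length code \<le> length P \<and> (\<forall>i<length code. P ! (pc + i) = code ! i)"

lemma placed_append: "placed P pc (c @ c') \<longleftrightarrow> placed P pc c \<and> placed P (pc + length c) c'"
proof
  assume *: "placed P pc (c @ c')"
  have "P ! (pc + length c + i) = c' ! i" if "i < length c'" for i
    using * that unfolding placed_def
    by (auto dest!: spec[of _ "length c + i"] simp: add.assoc)
  moreover have "P ! (pc + i) = c ! i" if "i < length c" for i
    using * that unfolding placed_def by (auto dest!: spec[of _ i] simp: nth_append)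
  ultimately show "placed P pc c \<and> placed P (pc + length c) c'"
    using * unfolding placed_def by auto
next
  assume *: "placed P pc c \<and> placed P (pc + length c) c'"
  have "P ! (pc + i) = (c @ c') ! i" if "i < length (c @ c')" for i
  proof (cases "i < length c")
    case True
    then show ?thesis using * by (simp add: placed_def nth_append)
  next
    case False
    then have "i - length c < length c'" using that by simp
    then have "P ! (pc + length c + (i - length c)) = c' ! (i - length c)"
      using * unfolding placed_def by blast
    then show ?thesis using False by (simp add: nth_append)
  qed
  then show "placed P pc (c @ c')"
    using * unfolding placed_def by auto
qed

lemma placed_Cons:
  "placed P pc (i # c) \<longleftrightarrow> pc < length P \<and> P ! pc = i \<and> placed P (Suc pc) c"
proof -
  have "placed P pc [i] \<longleftrightarrow> pc < length P \<and> P ! pc = i"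
    by (auto simp: placed_def)
  then show ?thesis
    using placed_append[of P pc "[i]" c] by simp
qed

lemma placed_self: "placed P 0 P"
  by (simp add: placed_def)

text \<open>Stated in continuation form, so that repeated use together with \<open>placed_Cons\<close> executes
  straight-line code.\<close>

lemma reaches_step:
  assumes "pc < length P" "reaches orc P (bss_exec orc (P ! pc) (pc, x)) t"
  shows "reaches orc P (pc, x) t"
proof -
  have "bss_step orc P (pc, x) = bss_exec orc (P ! pc) (pc, x)"
    using assms(1) by (simp add: bss_step_def)
  then have "reaches orc P (pc, x) (bss_exec orc (P ! pc) (pc, x))"
    unfolding reaches_def by (intro exI[of _ 1]) simp
  then show ?thesis using assms(2) by (rule reaches_trans)
qed

lemma rational_program_append [simp]:
  "rational_program (c @ c') \<longleftrightarrow> rational_program c \<and> rational_program c'"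
  by (auto simp: rational_program_def)

lemma rational_program_Cons:
  "rational_program (i # c) \<longleftrightarrow> (\<forall>r q. i = Const r q \<longrightarrow> q \<in> \<rat>) \<and> rational_program c"
  by (auto simp: rational_program_def)

lemma rational_program_Nil [simp]: "rational_program []"
  by (simp add: rational_program_def)

text \<open>Jump targets are absolute, so the address \<open>pc\<close> of the fragment is a parameter.  The variables
  \<open>vs\<close> sit in arbitrary registers \<open>rs\<close> below the stack pointer \<open>d\<close>.  The bound \<open>M\<close> on the touched
  registers is what leaves room for an output list above the working registers.\<close>

definition fragment ::
  "('e \<Rightarrow> nat \<Rightarrow> complex) \<Rightarrow> ('e \<Rightarrow> nat) list \<Rightarrow> ('e \<Rightarrow> real) \<Rightarrow> nat list \<Rightarrow> nat \<Rightarrow> nat \<Rightarrow>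
   bss_instr list \<Rightarrow> nat \<Rightarrow> bool" where
  "fragment orc vs f rs d pc code M \<longleftrightarrow> rational_program code \<and>
     (\<forall>e x P. placed P pc code \<longrightarrow> (\<forall>i<length vs. x (rs ! i) = real ((vs ! i) e)) \<longrightarrow>
        (\<exists>x'. reaches (orc e) P (pc, x) (pc + length code, x') \<and> x' d = f e \<and>
              (\<forall>i. i < d \<or> M \<le> i \<longrightarrow> x' i = x i)))"

text \<open>Quantifying over all positions of the arguments and of the result makes computability stable
  under composition: a nested term is compiled with a static stack, so no fragment needs indirect
  addressing.  The environment type \<open>'e\<close> is arbitrary; a bound variable becomes a new component
  of the environment.\<close>

definition computable ::
  "('e \<Rightarrow> nat \<Rightarrow> complex) \<Rightarrow> ('e \<Rightarrow> nat) list \<Rightarrow> ('e \<Rightarrow> real) \<Rightarrow> bool" where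
  "computable orc vs f \<longleftrightarrow> (\<forall>rs d pc. length rs = length vs \<longrightarrow> (\<forall>r\<in>set rs. r < d) \<longrightarrow>
     (\<exists>code M. fragment orc vs f rs d pc code M))"

lemma computableE:
  assumes "computable orc vs f" "length rs = length vs" "\<forall>r\<in>set rs. r < d"
  obtains code M where "fragment orc vs f rs d pc code M"
  using assms unfolding computable_def by blast

lemma fragment_rational: "fragment orc vs f rs d pc code M \<Longrightarrow> rational_program code"
  by (simp add: fragment_def)

lemma fragment_run:
  assumes "fragment orc vs f rs d pc code M" "placed P pc code"
    "\<And>i. i < length vs \<Longrightarrow> x (rs ! i) = real ((vs ! i) e)"
  obtains x' where "reaches (orc e) P (pc, x) (pc + length code, x')" "x' d = f e"
    "\<And>i. i < d \<or> M \<le> i \<Longrightarrow> x' i = x i"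
  using assms unfolding fragment_def by blast

lemma computableI:
  assumes "\<And>rs d pc. length rs = length vs \<Longrightarrow> \<forall>r\<in>set rs. r < d \<Longrightarrow>
    \<exists>code M. fragment orc vs f rs d pc code M"
  shows "computable orc vs f"
  using assms unfolding computable_def by blast

lemma computable_binop:
  assumes exec: "\<And>orc r s t pc x. bss_exec orc (I r s t) (pc, x) = (pc + 1, x(r := g (x s) (x t)))"
    and rat: "\<And>r s t r' q. I r s t \<noteq> Const r' q"
    and a: "computable orc vs a" and b: "computable orc vs b"
  shows "computable orc vs (\<lambda>e. g (a e) (b e))"
proof (rule computableI)
  fix rs :: "nat list" and d pc :: nat assume rs: "length rs = length vs" "\<forall>r\<in>set rs. r < d"
  obtain ca Ma where ca: "fragment orc vs a rs d pc ca Ma"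
    using computableE[OF a rs] .
  have "\<forall>r\<in>set rs. r < Suc d" using rs by auto
  then obtain cb Mb where cb: "fragment orc vs b rs (Suc d) (pc + length ca) cb Mb"
    using computableE[OF b rs(1)] by blast
  define code where "code = (ca @ cb) @ [I d d (Suc d)]"
  have "fragment orc vs (\<lambda>e. g (a e) (b e)) rs d pc code (max (Suc d) (max Ma Mb))"
    unfolding fragment_def
  proof (intro conjI allI impI)
    show "rational_program code"
      using ca cb rat by (auto simp: code_def fragment_def rational_program_Cons)
  next
    fix e x P
    assume P: "placed P pc code" and x: "\<forall>i<length vs. x (rs ! i) = real ((vs ! i) e)"
    from P have Pa: "placed P pc ca" and Pb: "placed P (pc + length ca) cb"
      and Pc: "pc + length ca + length cb < length P"
        "P ! (pc + length ca + length cb) = I d d (Suc d)"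
      by (auto simp: code_def placed_append placed_Cons)
    obtain x1 where x1: "reaches (orc e) P (pc, x) (pc + length ca, x1)" "x1 d = a e"
      "\<And>i. i < d \<or> Ma \<le> i \<Longrightarrow> x1 i = x i"
      using fragment_run[OF ca Pa, of x e] x by blast
    have "x1 (rs ! i) = real ((vs ! i) e)" if "i < length vs" for i
      using x1(3)[of "rs ! i"] rs x that by auto
    then obtain x2 where x2: "reaches (orc e) P (pc + length ca, x1) (pc + length ca + length cb, x2)"
      "x2 (Suc d) = b e" "\<And>i. i < Suc d \<or> Mb \<le> i \<Longrightarrow> x2 i = x1 i"
      using fragment_run[OF cb Pb, of x1 e] by blast
    have len: "pc + length code = Suc (pc + length ca + length cb)" by (simp add: code_def)
    have "reaches (orc e) P (pc, x) (pc + length code, x2(d := g (a e) (b e)))"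
      unfolding len by (rule reaches_trans[OF x1(1)], rule reaches_trans[OF x2(1)], rule reaches_step[OF Pc(1)])
        (simp add: Pc(2) exec x2 x1(2) x2(3)[of d])
    then show "\<exists>x'. reaches (orc e) P (pc, x) (pc + length code, x') \<and> x' d = g (a e) (b e) \<and>
        (\<forall>i. i < d \<or> max (Suc d) (max Ma Mb) \<le> i \<longrightarrow> x' i = x i)"
      by (intro exI[of _ "x2(d := g (a e) (b e))"]) (auto simp: x2(3) x1(3))
  qed
  then show "\<exists>code M. fragment orc vs (\<lambda>e. g (a e) (b e)) rs d pc code M" by blast
qed

lemma computable_add: "computable orc vs a \<Longrightarrow> computable orc vs b \<Longrightarrow> computable orc vs (\<lambda>e. a e + b e)"
  by (rule computable_binop[of Add]) auto

lemma computable_diff: "computable orc vs a \<Longrightarrow> computable orc vs b \<Longrightarrow> computable orc vs (\<lambda>e. a e - b e)"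
  by (rule computable_binop[of Sub]) auto

lemma computable_mult: "computable orc vs a \<Longrightarrow> computable orc vs b \<Longrightarrow> computable orc vs (\<lambda>e. a e * b e)"
  by (rule computable_binop[of Mul]) auto

lemma computable_divide: "computable orc vs a \<Longrightarrow> computable orc vs b \<Longrightarrow> computable orc vs (\<lambda>e. a e / b e)"
  by (rule computable_binop[of Div]) auto

lemma computable_const:
  assumes "q \<in> \<rat>" shows "computable orc vs (\<lambda>e. q)"
proof (rule computableI)
  fix rs :: "nat list" and d pc :: nat
  have "fragment orc vs (\<lambda>e. q) rs d pc [Const d q] (Suc d)"
    unfolding fragment_def
  proof (intro conjI allI impI)
    show "rational_program [Const d q]" using assms by (simp add: rational_program_def)
    fix e x P assume "placed P pc [Const d q]"
    then have "pc < length P" "P ! pc = Const d q" by (auto simp: placed_Cons)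
    then have "reaches (orc e) P (pc, x) (Suc pc, x(d := q))"
      by (intro reaches_step) auto
    then show "\<exists>x'. reaches (orc e) P (pc, x) (pc + length [Const d q], x') \<and> x' d = q \<and>
        (\<forall>i. i < d \<or> Suc d \<le> i \<longrightarrow> x' i = x i)"
      by (intro exI[of _ "x(d := q)"]) auto
  qed
  then show "\<exists>code M. fragment orc vs (\<lambda>e. q) rs d pc code M" by blast
qed

lemma computable_var:
  assumes "u \<in> set vs" shows "computable orc vs (\<lambda>e. real (u e))"
proof (rule computableI)
  fix rs :: "nat list" and d pc :: nat assume rs: "length rs = length vs" "\<forall>r\<in>set rs. r < d"
  from assms obtain j where j: "j < length vs" "vs ! j = u"
    by (auto simp: in_set_conv_nth)
  with rs have jd: "rs ! j < d" by auto
  define code where "code = [Const d 0, Add d d (rs ! j)]"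
  have "fragment orc vs (\<lambda>e. real (u e)) rs d pc code (Suc d)"
    unfolding fragment_def
  proof (intro conjI allI impI)
    show "rational_program code" by (simp add: rational_program_def code_def)
    fix e x P assume "placed P pc code" and x: "\<forall>i<length vs. x (rs ! i) = real ((vs ! i) e)"
    then have *: "pc < length P" "P ! pc = Const d 0" "Suc pc < length P"
      "P ! (Suc pc) = Add d d (rs ! j)"
      by (auto simp: placed_Cons code_def)
    have "reaches (orc e) P (pc, x) (pc + 2, x(d := real (u e)))"
      using * jd x j by (intro reaches_step) (auto intro!: reaches_step)
    then show "\<exists>x'. reaches (orc e) P (pc, x) (pc + length code, x') \<and> x' d = real (u e) \<and>
        (\<forall>i. i < d \<or> Suc d \<le> i \<longrightarrow> x' i = x i)"
      by (intro exI[of _ "x(d := real (u e))"]) (auto simp: code_def)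
  qed
  then show "\<exists>code M. fragment orc vs (\<lambda>e. real (u e)) rs d pc code M" by blast
qed

lemma computable_query:
  assumes n: "computable orc vs (\<lambda>e. real (n e))"
  shows "computable orc vs (\<lambda>e. Re (orc e (n e)))" "computable orc vs (\<lambda>e. Im (orc e (n e)))"
proof -
  show "computable orc vs (\<lambda>e. Re (orc e (n e)))"
  proof (rule computableI)
    fix rs :: "nat list" and d pc :: nat assume rs: "length rs = length vs" "\<forall>r\<in>set rs. r < d"
    obtain c M where c: "fragment orc vs (\<lambda>e. real (n e)) rs d pc c M"
      using computableE[OF n rs] .
    define code where "code = c @ [Query d d]"
    have "fragment orc vs (\<lambda>e. Re (orc e (n e))) rs d pc code (max (Suc (Suc d)) M)"
      unfolding fragment_def
    proof (intro conjI allI impI)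
      show "rational_program code"
        using c by (auto simp: code_def fragment_def rational_program_Cons)
    next
      fix e x P
      assume P: "placed P pc code" and x: "\<forall>i<length vs. x (rs ! i) = real ((vs ! i) e)"
      from P have Pa: "placed P pc c" and Pc: "pc + length c < length P"
          "P ! (pc + length c) = Query d d"
        by (auto simp: code_def placed_append placed_Cons)
      obtain x1 where x1: "reaches (orc e) P (pc, x) (pc + length c, x1)" "x1 d = real (n e)"
        "\<And>i. i < d \<or> M \<le> i \<Longrightarrow> x1 i = x i"
        using fragment_run[OF c Pa, of x e] x by blast
      have "reaches (orc e) P (pc, x) (pc + length code,
          x1(d := Re (orc e (n e)), Suc d := Im (orc e (n e))))"
        by (rule reaches_trans[OF x1(1)], rule reaches_step[OF Pc(1)])
          (simp add: Pc(2) x1 code_def addr_def)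
      then show "\<exists>x'. reaches (orc e) P (pc, x) (pc + length code, x') \<and> x' d = Re (orc e (n e)) \<and>
          (\<forall>i. i < d \<or> max (Suc (Suc d)) M \<le> i \<longrightarrow> x' i = x i)"
        by (intro exI[of _ "x1(d := Re (orc e (n e)), Suc d := Im (orc e (n e)))"] conjI)
          (auto simp: x1(3))
    qed
    then show "\<exists>code M. fragment orc vs (\<lambda>e. Re (orc e (n e))) rs d pc code M" by blast
  qed
next
  show "computable orc vs (\<lambda>e. Im (orc e (n e)))"
  proof (rule computableI)
    fix rs :: "nat list" and d pc :: nat assume rs: "length rs = length vs" "\<forall>r\<in>set rs. r < d"
    obtain c M where c: "fragment orc vs (\<lambda>e. real (n e)) rs d pc c M"
      using computableE[OF n rs] .
    define code where "code = c @ [Query d d, Const d 0, Add d d (Suc d)]"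
    have "fragment orc vs (\<lambda>e. Im (orc e (n e))) rs d pc code (max (Suc (Suc d)) M)"
      unfolding fragment_def
    proof (intro conjI allI impI)
      show "rational_program code"
        using c by (auto simp: code_def fragment_def rational_program_Cons)
    next
      fix e x P
      assume P: "placed P pc code" and x: "\<forall>i<length vs. x (rs ! i) = real ((vs ! i) e)"
      from P have Pa: "placed P pc c" and Pc: "pc + length c < length P"
          "P ! (pc + length c) = Query d d" "Suc (pc + length c) < length P"
          "P ! Suc (pc + length c) = Const d 0" "Suc (Suc (pc + length c)) < length P"
          "P ! Suc (Suc (pc + length c)) = Add d d (Suc d)"
        by (auto simp: code_def placed_append placed_Cons)
      obtain x1 where x1: "reaches (orc e) P (pc, x) (pc + length c, x1)" "x1 d = real (n e)"
        "\<And>i. i < d \<or> M \<le> i \<Longrightarrow> x1 i = x i"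
        using fragment_run[OF c Pa, of x e] x by blast
      have "reaches (orc e) P (pc, x) (pc + length code,
          x1(d := Im (orc e (n e)), Suc d := Im (orc e (n e))))"
        by (rule reaches_trans[OF x1(1)], rule reaches_step[OF Pc(1)], simp add: Pc(2),
            rule reaches_step[OF Pc(3)], simp add: Pc(4), rule reaches_step[OF Pc(5)])
          (simp add: Pc(6) x1 code_def addr_def fun_upd_twist)
      then show "\<exists>x'. reaches (orc e) P (pc, x) (pc + length code, x') \<and> x' d = Im (orc e (n e)) \<and>
          (\<forall>i. i < d \<or> max (Suc (Suc d)) M \<le> i \<longrightarrow> x' i = x i)"
        by (intro exI[of _ "x1(d := Im (orc e (n e)), Suc d := Im (orc e (n e)))"] conjI)
          (auto simp: x1(3))
    qed
    then show "\<exists>code M. fragment orc vs (\<lambda>e. Im (orc e (n e))) rs d pc code M" by blast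
  qed
qed

lemma computable_if:
  assumes c: "computable orc vs c" and a: "computable orc vs a" and b: "computable orc vs b"
  shows "computable orc vs (\<lambda>e. if 0 \<le> c e then a e else b e)"
proof (rule computableI)
  fix rs :: "nat list" and d pc :: nat assume rs: "length rs = length vs" "\<forall>r\<in>set rs. r < d"
  obtain cc Mc where cc: "fragment orc vs c rs d pc cc Mc"
    using computableE[OF c rs] .
  obtain cb Mb where cb: "fragment orc vs b rs d (pc + length cc + 1) cb Mb"
    using computableE[OF b rs] .
  define l where "l = pc + length cc + 1 + length cb + 2"
  obtain ca Ma where ca: "fragment orc vs a rs d l ca Ma"
    using computableE[OF a rs] .
  define code where "code = cc @ [Branch d l] @ cb @ [Const (Suc d) 0, Branch (Suc d) (l + length ca)] @ ca"
  define M where "M = max (Suc (Suc d)) (max Ma (max Mb Mc))"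
  have "fragment orc vs (\<lambda>e. if 0 \<le> c e then a e else b e) rs d pc code M"
    unfolding fragment_def
  proof (intro conjI allI impI)
    show "rational_program code"
      using ca cb cc by (auto simp: code_def fragment_def rational_program_Cons)
  next
    fix e x P
    assume P: "placed P pc code" and x: "\<forall>i<length vs. x (rs ! i) = real ((vs ! i) e)"
    from P have Pcc: "placed P pc cc" and Pb: "placed P (pc + length cc + 1) cb"
      and Pa: "placed P l ca"
      and Pd: "pc + length cc < length P" "P ! (pc + length cc) = Branch d l"
        "pc + length cc + 1 + length cb < length P"
        "P ! (pc + length cc + 1 + length cb) = Const (Suc d) 0"
        "Suc (pc + length cc + 1 + length cb) < length P"
        "P ! Suc (pc + length cc + 1 + length cb) = Branch (Suc d) (l + length ca)"
      by (auto simp: code_def placed_append placed_Cons l_def)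
    have len: "pc + length code = l + length ca" by (simp add: code_def l_def)
    obtain x1 where x1: "reaches (orc e) P (pc, x) (pc + length cc, x1)" "x1 d = c e"
      "\<And>i. i < d \<or> Mc \<le> i \<Longrightarrow> x1 i = x i"
      using fragment_run[OF cc Pcc, of x e] x by blast
    have x1v: "x1 (rs ! i) = real ((vs ! i) e)" if "i < length vs" for i
      using x1(3)[of "rs ! i"] rs x that by auto
    show "\<exists>x'. reaches (orc e) P (pc, x) (pc + length code, x') \<and>
        x' d = (if 0 \<le> c e then a e else b e) \<and> (\<forall>i. i < d \<or> M \<le> i \<longrightarrow> x' i = x i)"
    proof (cases "0 \<le> c e")
      case True
      obtain x2 where x2: "reaches (orc e) P (l, x1) (l + length ca, x2)"
        "x2 d = a e" "\<And>i. i < d \<or> Ma \<le> i \<Longrightarrow> x2 i = x1 i"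
        using fragment_run[OF ca Pa, of x1 e] x1v by blast
      have "reaches (orc e) P (pc, x) (pc + length code, x2)"
        by (rule reaches_trans[OF x1(1)], rule reaches_step[OF Pd(1)])
          (use x2(1) in \<open>simp add: Pd(2) x1 True len\<close>)
      then show ?thesis using True x2 x1 by (auto intro!: exI[of _ x2] simp: M_def)
    next
      case False
      obtain x2 where x2: "reaches (orc e) P (pc + length cc + 1, x1) (pc + length cc + 1 + length cb, x2)"
        "x2 d = b e" "\<And>i. i < d \<or> Mb \<le> i \<Longrightarrow> x2 i = x1 i"
        using fragment_run[OF cb Pb, of x1 e] x1v by blast
      have "reaches (orc e) P (pc + length cc, x1) (pc + length cc + 1, x1)"
        by (rule reaches_step[OF Pd(1)]) (use False in \<open>simp add: Pd(2) x1\<close>)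
      then have "reaches (orc e) P (pc, x) (pc + length cc + 1 + length cb, x2)"
        using x1(1) x2(1) by (blast intro: reaches_trans)
      moreover have "reaches (orc e) P (pc + length cc + 1 + length cb, x2) (pc + length code, x2(Suc d := 0))"
        using Pd(3-6) by (intro reaches_step[OF Pd(3)]) (auto simp: len intro!: reaches_step)
      ultimately have "reaches (orc e) P (pc, x) (pc + length code, x2(Suc d := 0))"
        by (rule reaches_trans)
      then show ?thesis using False x2 x1
        by (auto intro!: exI[of _ "x2(Suc d := 0)"] simp: M_def)
    qed
  qed
  then show "\<exists>code M. fragment orc vs (\<lambda>e. if 0 \<le> c e then a e else b e) rs d pc code M" by blast
qed

text \<open>The premises about the body of a sum or product live in an extended environment; facts about the
  outer environment are transported there by this weakening.\<close>

lemma computable_lift: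
  assumes f: "computable orc vs f"
  shows "computable (\<lambda>p. orc (fst p)) (map (\<lambda>u p. u (fst p)) vs @ [snd]) (\<lambda>p. f (fst p))"
proof (rule computableI)
  let ?vs = "map (\<lambda>u p. u (fst p)) vs @ [snd] :: ('a \<times> nat \<Rightarrow> nat) list"
  fix rs :: "nat list" and d pc :: nat assume rs: "length rs = length ?vs" "\<forall>r\<in>set rs. r < d"
  have "length (take (length vs) rs) = length vs" "\<forall>r\<in>set (take (length vs) rs). r < d"
    using rs by (auto dest: in_set_takeD)
  then obtain c M where c: "fragment orc vs f (take (length vs) rs) d pc c M"
    using computableE[OF f] by blast
  have "fragment (\<lambda>p. orc (fst p)) ?vs (\<lambda>p. f (fst p)) rs d pc c M"
    unfolding fragment_def
  proof (intro conjI allI impI)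
    show "rational_program c" using c by (rule fragment_rational)
    fix p x P assume P: "placed P pc c" and x: "\<forall>i<length ?vs. x (rs ! i) = real ((?vs ! i) p)"
    have "x (take (length vs) rs ! i) = real ((vs ! i) (fst p))" if "i < length vs" for i
      using x that by (auto simp: nth_append dest!: spec[of _ i])
    then show "\<exists>x'. reaches (orc (fst p)) P (pc, x) (pc + length c, x') \<and> x' d = f (fst p) \<and>
        (\<forall>i. i < d \<or> M \<le> i \<longrightarrow> x' i = x i)"
      using fragment_run[OF c P, of x "fst p"] by blast
  qed
  then show "\<exists>code M. fragment (\<lambda>p. orc (fst p)) ?vs (\<lambda>p. f (fst p)) rs d pc code M" by blast
qed

text \<open>The loop behind bounded sums and products: register \<open>d\<close> accumulates, \<open>d + 1\<close> counts and
  \<open>d + 2\<close> holds the bound.\<close>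

lemma computable_fold:
  assumes exec: "\<And>orc r s t pc x. bss_exec orc (I r s t) (pc, x) = (pc + 1, x(r := g (x s) (x t)))"
    and rat: "\<And>r s t r' q. I r s t \<noteq> Const r' q"
    and F: "\<And>e. F e 0 = q" "\<And>e k. F e (Suc k) = g (F e k) (B e k)" and q: "q \<in> \<rat>"
    and n: "computable orc vs (\<lambda>e. real (n e))"
    and B: "computable (\<lambda>p. orc (fst p)) (map (\<lambda>u p. u (fst p)) vs @ [snd]) (\<lambda>p. B (fst p) (snd p))"
  shows "computable orc vs (\<lambda>e. F e (n e))"
proof (rule computableI)
  let ?vs = "map (\<lambda>u p. u (fst p)) vs @ [snd] :: ('a \<times> nat \<Rightarrow> nat) list"
  fix rs :: "nat list" and d pc :: nat assume rs: "length rs = length vs" "\<forall>r\<in>set rs. r < d"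
  have "\<forall>r\<in>set rs. r < d + 2" using rs by auto
  then obtain cn Mn where cn: "fragment orc vs (\<lambda>e. real (n e)) rs (d + 2) pc cn Mn"
    using computableE[OF n rs(1)] by blast
  define L where "L = pc + length cn + 2"
  have "length (rs @ [d + 1]) = length ?vs" "\<forall>r\<in>set (rs @ [d + 1]). r < d + 3"
    using rs by auto
  then obtain cb Mb where cb: "fragment (\<lambda>p. orc (fst p)) ?vs (\<lambda>p. B (fst p) (snd p)) (rs @ [d + 1])
      (d + 3) (L + 2) cb Mb"
    using computableE[OF B] by blast
  define E where "E = L + 2 + length cb"
  define code where "code = cn @ [Const d q, Const (d + 1) 0] @
    [Sub (d + 3) (d + 1) (d + 2), Branch (d + 3) (E + 5)] @ cb @
    [I d d (d + 3), Const (d + 3) 1, Add (d + 1) (d + 1) (d + 3), Const (d + 3) 0, Branch (d + 3) L]"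
  define M where "M = max (d + 4) (max Mn Mb)"
  have "fragment orc vs (\<lambda>e. F e (n e)) rs d pc code M"
    unfolding fragment_def
  proof (intro conjI allI impI)
    show "rational_program code"
      using cn cb rat q by (auto simp: code_def fragment_def rational_program_Cons)
  next
    fix e x P
    assume P: "placed P pc code" and x: "\<forall>i<length vs. x (rs ! i) = real ((vs ! i) e)"
    have Pn: "placed P pc cn" and Pb: "placed P (L + 2) cb"
      using P by (auto simp: code_def placed_append placed_Cons L_def)
    have P1: "pc + length cn < length P" "P ! (pc + length cn) = Const d q"
      "Suc (pc + length cn) < length P" "P ! Suc (pc + length cn) = Const (d + 1) 0"
      "L < length P" "P ! L = Sub (d + 3) (d + 1) (d + 2)"
      "Suc L < length P" "P ! Suc L = Branch (d + 3) (E + 5)"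
      "E < length P" "P ! E = I d d (d + 3)"
      "Suc E < length P" "P ! Suc E = Const (d + 3) 1"
      "Suc (Suc E) < length P" "P ! Suc (Suc E) = Add (d + 1) (d + 1) (d + 3)"
      "Suc (Suc (Suc E)) < length P" "P ! Suc (Suc (Suc E)) = Const (d + 3) 0"
      "Suc (Suc (Suc (Suc E))) < length P" "P ! Suc (Suc (Suc (Suc E))) = Branch (d + 3) L"
      using P by (auto simp: code_def placed_append placed_Cons L_def E_def)
    obtain x0 where x0: "reaches (orc e) P (pc, x) (pc + length cn, x0)" "x0 (d + 2) = real (n e)"
      "\<And>i. i < d + 2 \<or> Mn \<le> i \<Longrightarrow> x0 i = x i"
      using fragment_run[OF cn Pn, of x e] x by blast
    have start: "reaches (orc e) P (pc, x) (L, x0(d := q, d + 1 := 0))"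
      by (rule reaches_trans[OF x0(1)], rule reaches_step[OF P1(1)], unfold P1(2) bss_exec.simps
          Suc_eq_plus1[symmetric], rule reaches_step[OF P1(3)]) (simp add: P1(4) L_def)
    define inv where "inv k y \<longleftrightarrow> y d = F e k \<and> y (d + 1) = real k \<and> y (d + 2) = real (n e) \<and>
      (\<forall>i. i < d \<or> M \<le> i \<longrightarrow> y i = x i)" for k and y :: "nat \<Rightarrow> real"
    have step: "\<exists>y'. reaches (orc e) P (L, y) (L, y') \<and> inv (Suc k) y'" if y: "inv k y" and k: "k < n e" for k y
    proof -
      let ?y = "y(d + 3 := real k - real (n e))"
      have to_body: "reaches (orc e) P (L, y) (L + 2, ?y)"
        by (rule reaches_step[OF P1(5)], unfold P1(6) bss_exec.simps Suc_eq_plus1[symmetric],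
            rule reaches_step[OF P1(7)]) (use y k in \<open>simp add: P1(8) inv_def\<close>)
      have "?y ((rs @ [d + 1]) ! i) = real ((?vs ! i) (e, k))" if "i < length ?vs" for i
      proof (cases "i < length vs")
        case True
        then have "rs ! i < d" using rs by auto
        then have "rs ! i \<noteq> d + 3" by simp
        then show ?thesis using True \<open>rs ! i < d\<close> rs(1) y x by (simp add: nth_append inv_def)
      next
        case False
        then have "i = length vs" using that by simp
        then show ?thesis using rs y by (simp add: nth_append inv_def)
      qed
      then obtain z where z: "reaches (orc e) P (L + 2, ?y) (E, z)" "z (d + 3) = B e k"
        "\<And>i. i < d + 3 \<or> Mb \<le> i \<Longrightarrow> z i = ?y i"
        using fragment_run[OF cb Pb, of ?y "(e, k)"] unfolding E_def by auto
      let ?z = "z(d := g (z d) (z (d + 3)), d + 1 := z (d + 1) + 1, d + 3 := 0)"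
      have "reaches (orc e) P (E, z) (L, ?z)"
        by (rule reaches_step[OF P1(9)], unfold P1(10) exec Suc_eq_plus1[symmetric],
            rule reaches_step[OF P1(11)], unfold P1(12) bss_exec.simps Suc_eq_plus1[symmetric],
            rule reaches_step[OF P1(13)], unfold P1(14) bss_exec.simps Suc_eq_plus1[symmetric],
            rule reaches_step[OF P1(15)], unfold P1(16) bss_exec.simps Suc_eq_plus1[symmetric],
            rule reaches_step[OF P1(17)])
          (simp add: P1(18) fun_upd_twist)
      moreover have "inv (Suc k) ?z"
        using y z(2) z(3)[of d] z(3)[of "d + 1"] z(3)[of "d + 2"] z(3)
        by (auto simp: inv_def F M_def)
      ultimately show ?thesis
        using to_body z(1) by (blast intro: reaches_trans)
    qed
    have "k \<le> n e \<Longrightarrow> \<exists>y. reaches (orc e) P (pc, x) (L, y) \<and> inv k y" for k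
    proof (induction k)
      case 0
      have "inv 0 (x0(d := q, d + 1 := 0))"
        using x0 by (auto simp: inv_def F M_def)
      then show ?case using start by blast
    next
      case (Suc k)
      then show ?case using step[of k] by (auto intro: reaches_trans)
    qed
    then obtain y where y: "reaches (orc e) P (pc, x) (L, y)" "inv (n e) y" by blast
    have len: "pc + length code = E + 5" by (simp add: code_def E_def L_def)
    have "reaches (orc e) P (L, y) (E + 5, y(d + 3 := 0))"
      by (rule reaches_step[OF P1(5)], unfold P1(6) bss_exec.simps Suc_eq_plus1[symmetric],
          rule reaches_step[OF P1(7)]) (use y in \<open>simp add: P1(8) inv_def\<close>)
    with y(1) have "reaches (orc e) P (pc, x) (pc + length code, y(d + 3 := 0))"
      unfolding len by (rule reaches_trans)
    then show "\<exists>x'. reaches (orc e) P (pc, x) (pc + length code, x') \<and> x' d = F e (n e) \<and>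
        (\<forall>i. i < d \<or> M \<le> i \<longrightarrow> x' i = x i)"
      using y(2) by (intro exI[of _ "y(d + 3 := 0)"]) (auto simp: inv_def M_def)
  qed
  then show "\<exists>code M. fragment orc vs (\<lambda>e. F e (n e)) rs d pc code M" by blast
qed

lemma computable_sum:
  assumes "computable orc vs (\<lambda>e. real (n e))"
    "computable (\<lambda>p. orc (fst p)) (map (\<lambda>u p. u (fst p)) vs @ [snd]) (\<lambda>p. B (fst p) (snd p))"
  shows "computable orc vs (\<lambda>e. \<Sum>i<n e. B e i)"
  using computable_fold[of Add "(+)" "\<lambda>e k. \<Sum>i<k. B e i" 0 B orc vs n] assms by simp

lemma computable_prod:
  assumes "computable orc vs (\<lambda>e. real (n e))"
    "computable (\<lambda>p. orc (fst p)) (map (\<lambda>u p. u (fst p)) vs @ [snd]) (\<lambda>p. B (fst p) (snd p))"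
  shows "computable orc vs (\<lambda>e. \<Prod>i<n e. B e i)"
  using computable_fold[of Mul "(*)" "\<lambda>e k. \<Prod>i<k. B e i" 1 B orc vs n] assms by simp


lemma computable_uminus: "computable orc vs a \<Longrightarrow> computable orc vs (\<lambda>e. - a e)"
  using computable_diff[OF computable_const[of 0], of orc vs a] by simp

definition decidable ::
  "('e \<Rightarrow> nat \<Rightarrow> complex) \<Rightarrow> ('e \<Rightarrow> nat) list \<Rightarrow> ('e \<Rightarrow> bool) \<Rightarrow> bool" where
  "decidable orc vs Q \<longleftrightarrow> computable orc vs (\<lambda>e. of_bool (Q e))"

definition ccomputable ::
  "('e \<Rightarrow> nat \<Rightarrow> complex) \<Rightarrow> ('e \<Rightarrow> nat) list \<Rightarrow> ('e \<Rightarrow> complex) \<Rightarrow> bool" where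
  "ccomputable orc vs f \<longleftrightarrow> computable orc vs (\<lambda>e. Re (f e)) \<and> computable orc vs (\<lambda>e. Im (f e))"

lemma decidable_le:
  assumes "computable orc vs a" "computable orc vs b"
  shows "decidable orc vs (\<lambda>e. a e \<le> b e)"
proof -
  have "(\<lambda>e. of_bool (a e \<le> b e)) = (\<lambda>e. if 0 \<le> b e - a e then 1 else 0 :: real)"
    by (auto simp: fun_eq_iff)
  then show ?thesis unfolding decidable_def
    by (simp only:) (intro computable_if computable_diff assms computable_const; simp)
qed

lemma decidable_not:
  assumes "decidable orc vs Q" shows "decidable orc vs (\<lambda>e. \<not> Q e)"
proof -
  have "(\<lambda>e. of_bool (\<not> Q e)) = (\<lambda>e. 1 - of_bool (Q e) :: real)"
    by (auto simp: fun_eq_iff)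
  then show ?thesis using assms unfolding decidable_def
    by (simp only:) (intro computable_diff computable_const; simp)
qed

lemma decidable_less:
  assumes "computable orc vs a" "computable orc vs b"
  shows "decidable orc vs (\<lambda>e. a e < b e)"
  using decidable_not[OF decidable_le[OF assms(2,1)]] by (simp add: not_le)

lemma decidable_conj:
  assumes "decidable orc vs Q" "decidable orc vs R" shows "decidable orc vs (\<lambda>e. Q e \<and> R e)"
proof -
  have "(\<lambda>e. of_bool (Q e \<and> R e)) = (\<lambda>e. of_bool (Q e) * of_bool (R e) :: real)"
    by (auto simp: fun_eq_iff)
  then show ?thesis using assms unfolding decidable_def
    by (simp only:) (intro computable_mult)
qed

lemma decidable_disj:
  assumes "decidable orc vs Q" "decidable orc vs R" shows "decidable orc vs (\<lambda>e. Q e \<or> R e)"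
  using decidable_not[OF decidable_conj[OF assms[THEN decidable_not]]] by simp

lemma decidable_eq:
  assumes "computable orc vs a" "computable orc vs b"
  shows "decidable orc vs (\<lambda>e. a e = b e)"
  using decidable_conj[OF decidable_le[OF assms] decidable_le[OF assms(2,1)]]
  by (simp add: eq_iff)

lemma decidable_ex:
  assumes n: "computable orc vs (\<lambda>e. real (n e))"
    and Q: "decidable (\<lambda>p. orc (fst p)) (map (\<lambda>u p. u (fst p)) vs @ [snd]) (\<lambda>p. Q (fst p) (snd p))"
  shows "decidable orc vs (\<lambda>e. \<exists>i<n e. Q e i)"
proof -
  have "(\<exists>i<n e. Q e i) \<longleftrightarrow> 0 < (\<Sum>i<n e. of_bool (Q e i) :: real)" for e
    by (auto simp: sum_of_bool_eq card_gt_0_iff)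
  then show ?thesis
    using decidable_less[OF computable_const[of 0] computable_sum[OF n, of "\<lambda>e i. of_bool (Q e i)"]] Q
    by (simp add: decidable_def)
qed

lemma decidable_all:
  assumes n: "computable orc vs (\<lambda>e. real (n e))"
    and Q: "decidable (\<lambda>p. orc (fst p)) (map (\<lambda>u p. u (fst p)) vs @ [snd]) (\<lambda>p. Q (fst p) (snd p))"
  shows "decidable orc vs (\<lambda>e. \<forall>i<n e. Q e i)"
  using decidable_not[OF decidable_ex[OF n decidable_not[OF Q]]] by simp

lemma computable_if_dec:
  assumes "decidable orc vs Q" "computable orc vs a" "computable orc vs b"
  shows "computable orc vs (\<lambda>e. if Q e then a e else b e)"
proof -
  have "(\<lambda>e. if Q e then a e else b e) = (\<lambda>e. if 0 \<le> of_bool (Q e) - (1::real) then a e else b e)"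
    by (auto simp: fun_eq_iff)
  then show ?thesis using assms unfolding decidable_def
    by (simp only:) (intro computable_if computable_diff computable_const; simp)
qed

lemma computable_nat_add:
  "computable orc vs (\<lambda>e. real (m e)) \<Longrightarrow> computable orc vs (\<lambda>e. real (n e)) \<Longrightarrow>
   computable orc vs (\<lambda>e. real (m e + n e))"
  using computable_add by fastforce

lemma computable_nat_mult:
  "computable orc vs (\<lambda>e. real (m e)) \<Longrightarrow> computable orc vs (\<lambda>e. real (n e)) \<Longrightarrow>
   computable orc vs (\<lambda>e. real (m e * n e))"
  using computable_mult by fastforce

lemma computable_nat_const: "computable orc vs (\<lambda>e. real k)"
  by (rule computable_const) simp

lemma computable_nat_Suc:
  "computable orc vs (\<lambda>e. real (m e)) \<Longrightarrow> computable orc vs (\<lambda>e. real (Suc (m e)))"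
  using computable_nat_add[OF computable_nat_const[of _ _ 1]] by fastforce

lemma computable_nat_power:
  assumes m: "computable orc vs (\<lambda>e. real (m e))" and n: "computable orc vs (\<lambda>e. real (n e))"
  shows "computable orc vs (\<lambda>e. real (m e ^ n e))"
  using computable_prod[OF n computable_lift[OF m]] by simp

text \<open>The instruction set has no integer division; the quotient is obtained by counting the multiples
  of \<open>n\<close> up to \<open>m\<close>.\<close>

lemma div_eq_sum: "real (m div n) = (\<Sum>i<m. of_bool (0 < real n \<and> real (Suc i * n) \<le> real m))"
proof (cases "n = 0")
  case False
  have "{i. i < m \<and> Suc i * n \<le> m} = {..<m div n}"
  proof (rule set_eqI)
    fix i
    have "Suc i * n \<le> m \<longleftrightarrow> Suc i \<le> m div n"
      using False by (simp add: less_eq_div_iff_mult_less_eq)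
    moreover have "m div n \<le> m" by simp
    ultimately show "i \<in> {i. i < m \<and> Suc i * n \<le> m} \<longleftrightarrow> i \<in> {..<m div n}"
      by (simp only: mem_Collect_eq lessThan_iff) linarith
  qed
  then have "card {i. i < m \<and> Suc i * n \<le> m} = m div n" by simp
  moreover have "(\<Sum>i<m. of_bool (0 < real n \<and> real (Suc i * n) \<le> real m)) =
      real (card {i. i < m \<and> Suc i * n \<le> m})"
    using False by (simp only: of_nat_le_iff of_nat_0_less_iff) (simp add: Int_def)
  ultimately show ?thesis by simp
qed simp

lemma computable_nat_div:
  assumes m: "computable orc vs (\<lambda>e. real (m e))" and n: "computable orc vs (\<lambda>e. real (n e))"
  shows "computable orc vs (\<lambda>e. real (m e div n e))"
  unfolding div_eq_sum
proof (rule computable_sum[OF m], fold decidable_def)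
  let ?orc = "\<lambda>p. orc (fst p)" and ?vs = "map (\<lambda>u p. u (fst p)) vs @ [snd] :: ('a \<times> nat \<Rightarrow> nat) list"
  show "decidable ?orc ?vs (\<lambda>p. 0 < real (n (fst p)) \<and> real (Suc (snd p) * n (fst p)) \<le> real (m (fst p)))"
    by (intro decidable_conj decidable_less decidable_le computable_const computable_nat_mult
        computable_nat_Suc computable_var computable_lift[OF m] computable_lift[OF n]) auto
qed

lemma computable_nat_mod:
  assumes m: "computable orc vs (\<lambda>e. real (m e))" and n: "computable orc vs (\<lambda>e. real (n e))"
  shows "computable orc vs (\<lambda>e. real (m e mod n e))"
proof -
  have "real (m e mod n e) = real (m e) - real (m e div n e * n e)" for e
    by (metis add_diff_cancel_left' div_mult_mod_eq of_nat_add)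
  then show ?thesis
    using computable_diff[OF m computable_nat_mult[OF computable_nat_div[OF m n] n]] by simp
qed

lemma real_prod_encode: "real (prod_encode (i, j)) = real (i + j) * real (Suc (i + j)) / 2 + real i"
proof -
  have "2 * triangle k = k * Suc k" for k
    by (simp add: triangle_def)
  then have "2 * real (triangle k) = real k * real (Suc k)" for k
    by (metis of_nat_mult of_nat_numeral)
  from this[of "i + j"] show ?thesis by (simp add: prod_encode_def)
qed

lemma computable_prod_encode:
  assumes "computable orc vs (\<lambda>e. real (i e))" "computable orc vs (\<lambda>e. real (j e))"
  shows "computable orc vs (\<lambda>e. real (prod_encode (i e, j e)))"
  unfolding real_prod_encode
  by (intro computable_add computable_divide computable_mult computable_nat_add computable_nat_Suc
      computable_const assms) auto

lemma ccomputable_Complex: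
  "computable orc vs a \<Longrightarrow> computable orc vs b \<Longrightarrow> ccomputable orc vs (\<lambda>e. Complex (a e) (b e))"
  by (simp add: ccomputable_def)

lemma ccomputable_zero: "ccomputable orc vs (\<lambda>e. 0)"
  by (simp add: ccomputable_def computable_const)

lemma ccomputable_of_real:
  "computable orc vs a \<Longrightarrow> ccomputable orc vs (\<lambda>e. complex_of_real (a e))"
  by (simp add: ccomputable_def computable_const)

lemma ccomputable_query:
  "computable orc vs (\<lambda>e. real (n e)) \<Longrightarrow> ccomputable orc vs (\<lambda>e. orc e (n e))"
  by (simp add: ccomputable_def computable_query)

lemma ccomputable_add:
  "ccomputable orc vs a \<Longrightarrow> ccomputable orc vs b \<Longrightarrow> ccomputable orc vs (\<lambda>e. a e + b e)"
  by (simp add: ccomputable_def computable_add)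

lemma ccomputable_diff:
  "ccomputable orc vs a \<Longrightarrow> ccomputable orc vs b \<Longrightarrow> ccomputable orc vs (\<lambda>e. a e - b e)"
  by (simp add: ccomputable_def computable_diff)

lemma ccomputable_mult:
  "ccomputable orc vs a \<Longrightarrow> ccomputable orc vs b \<Longrightarrow> ccomputable orc vs (\<lambda>e. a e * b e)"
  by (simp add: ccomputable_def computable_add computable_diff computable_mult)

lemma ccomputable_cnj: "ccomputable orc vs a \<Longrightarrow> ccomputable orc vs (\<lambda>e. cnj (a e))"
  by (simp add: ccomputable_def computable_uminus)

lemma ccomputable_divide_real:
  "ccomputable orc vs a \<Longrightarrow> computable orc vs b \<Longrightarrow> ccomputable orc vs (\<lambda>e. a e / complex_of_real (b e))"
  by (simp add: ccomputable_def Re_divide_of_real Im_divide_of_real computable_divide)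

lemma ccomputable_sum:
  assumes "computable orc vs (\<lambda>e. real (n e))"
    "ccomputable (\<lambda>p. orc (fst p)) (map (\<lambda>u p. u (fst p)) vs @ [snd]) (\<lambda>p. B (fst p) (snd p))"
  shows "ccomputable orc vs (\<lambda>e. \<Sum>i<n e. B e i)"
  using assms by (simp add: ccomputable_def computable_sum)

lemma ccomputable_if_dec:
  assumes "decidable orc vs Q" "ccomputable orc vs a" "ccomputable orc vs b"
  shows "ccomputable orc vs (\<lambda>e. if Q e then a e else b e)"
  using assms by (simp add: ccomputable_def if_distrib computable_if_dec)

lemma computable_power2: "computable orc vs a \<Longrightarrow> computable orc vs (\<lambda>e. (a e)\<^sup>2)"
  by (simp add: power2_eq_square computable_mult)

lemma computable_cmod2: "ccomputable orc vs a \<Longrightarrow> computable orc vs (\<lambda>e. (cmod (a e))\<^sup>2)"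
  by (simp add: ccomputable_def cmod_power2 computable_add computable_power2)

lemmas computable_intros =
  decidable_conj decidable_disj decidable_less decidable_le decidable_eq decidable_ex decidable_all
  decidable_not computable_nat_add computable_nat_mult computable_nat_power computable_nat_div
  computable_nat_mod computable_nat_Suc computable_prod_encode computable_nat_const
  computable_cmod2 computable_power2 computable_add computable_diff computable_mult
  computable_divide computable_sum computable_if_dec
  ccomputable_Complex ccomputable_of_real ccomputable_query ccomputable_add ccomputable_diff
  ccomputable_mult ccomputable_cnj ccomputable_divide_real ccomputable_sum ccomputable_if_dec
  ccomputable_zero


section \<open>From machines to algorithms\<close>

type_synonym run = "(nat \<Rightarrow> complex) \<times> nat list"

text \<open>A run starts with the indices of the tower in the first registers; they are the variables of the
  compiled program.\<close>

definition arguments :: "nat \<Rightarrow> (run \<Rightarrow> nat) list" where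
  "arguments k = map (\<lambda>i e. snd e ! i) [0..<k]"

lemma decision_program:
  assumes Q: "decidable fst (arguments k) Q"
  obtains P where "rational_program P"
    "\<And>orc ns. length ns = k \<Longrightarrow> bss_computes orc P ns [of_nat (of_bool (Q (orc, ns)))]"
proof -
  define d where "d = k + 3"
  have "length [0..<k] = length (arguments k)" "\<forall>r\<in>set [0..<k]. r < d"
    by (auto simp: arguments_def d_def)
  then obtain c M where c: "fragment fst (arguments k) (\<lambda>e. of_bool (Q e)) [0..<k] d 0 c M"
    using computableE[OF Q[unfolded decidable_def]] by blast
  define P where "P = c @ [Const 0 1, Const 2 0, Add 1 d 2]"
  have "bss_computes orc P ns [of_nat (of_bool (Q (orc, ns)))]" if ns: "length ns = k" for orc ns
  proof -
    have pl: "placed P 0 c" and P1: "length c < length P" "P ! length c = Const 0 1"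
      "Suc (length c) < length P" "P ! Suc (length c) = Const 2 0"
      "Suc (Suc (length c)) < length P" "P ! Suc (Suc (length c)) = Add 1 d 2"
      using placed_self[of P] unfolding P_def placed_append placed_Cons by auto
    define x where "x = (\<lambda>i. if i < length ns then real (ns ! i) else 0)"
    have "x ([0..<k] ! i) = real ((arguments k ! i) (orc, ns))" if "i < length (arguments k)" for i
      using that ns by (simp add: arguments_def x_def)
    then obtain x1 where x1: "reaches orc P (0, x) (length c, x1)" "x1 d = of_bool (Q (orc, ns))"
      using fragment_run[OF c pl, of x "(orc, ns)"] unfolding fst_conv add_0 by blast
    have len: "length P = Suc (Suc (Suc (length c)))" by (simp add: P_def)
    have d: "d \<noteq> 0" "d \<noteq> 1" "d \<noteq> 2" "d \<noteq> Suc 0" by (auto simp: d_def)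
    define y where "y = x1(0 := 1, 2 := 0, 1 := of_bool (Q (orc, ns)))"
    have "reaches orc P (length c, x1) (length P, y)"
      by (rule reaches_step[OF P1(1)], unfold P1(2) bss_exec.simps Suc_eq_plus1[symmetric],
          rule reaches_step[OF P1(3)], unfold P1(4) bss_exec.simps Suc_eq_plus1[symmetric],
          rule reaches_step[OF P1(5)])
        (simp add: P1(6) x1(2) d y_def len)
    then have "reaches orc P (bss_init ns) (length P, y)"
      using x1(1) unfolding bss_init_def x_def by (blast intro: reaches_trans)
    moreover have "bss_output y = [of_nat (of_bool (Q (orc, ns)))]"
      by (auto simp: bss_output_def y_def addr_def complex_eq_iff)
    ultimately show ?thesis
      unfolding bss_computes_def reaches_def by (metis order_refl)
  qed
  moreover have "rational_program P"
    using fragment_rational[OF c] by (simp add: P_def rational_program_Cons)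
  ultimately show ?thesis using that by blast
qed

fun straight :: "(nat \<Rightarrow> complex) \<Rightarrow> bss_instr list \<Rightarrow> (nat \<Rightarrow> real) \<Rightarrow> nat \<Rightarrow> real" where
  "straight orc [] x = x"
| "straight orc (i # c) x = straight orc c (snd (bss_exec orc i (0, x)))"

lemma straight_append: "straight orc (c @ c') x = straight orc c' (straight orc c x)"
  by (induction c arbitrary: x) auto

lemma reaches_straight:
  assumes "placed P pc c" "\<forall>i\<in>set c. \<forall>r l. i \<noteq> Branch r l"
  shows "reaches orc P (pc, x) (pc + length c, straight orc c x)"
  using assms
proof (induction c arbitrary: pc x)
  case (Cons i c)
  have "bss_exec orc i (pc, x) = (Suc pc, snd (bss_exec orc i (0, x)))"
    using Cons.prems(2) by (cases i) auto
  then show ?case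
    using Cons.prems Cons.IH[of "Suc pc" "snd (bss_exec orc i (0, x))"]
    by (intro reaches_step) (auto simp: placed_Cons)
qed simp

text \<open>The output has to start at register \<open>0\<close>, where the working registers are.  Overwriting these with
  copies of a later entry leaves the set of entries unchanged.\<close>

definition fill :: "nat \<Rightarrow> bss_instr list" where
  "fill K = concat (map (\<lambda>l. [Const (2 * l + 1) 0, Add (2 * l + 1) (2 * l + 1) (2 * K + 1),
     Const (2 * l + 2) 0, Add (2 * l + 2) (2 * l + 2) (2 * K + 2)]) [0..<K])"

lemma straight_fill:
  "straight orc (fill K) x i =
     (if 1 \<le> i \<and> i \<le> 2 * K then if odd i then x (2 * K + 1) else x (2 * K + 2) else x i)"
proof -
  define g where "g = (\<lambda>l. [Const (2 * l + 1) 0, Add (2 * l + 1) (2 * l + 1) (2 * K + 1),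
     Const (2 * l + 2) 0, Add (2 * l + 2) (2 * l + 2) (2 * K + 2)])"
  define y where "y n = straight orc (concat (map g [0..<n])) x" for n
  have "n \<le> K \<Longrightarrow> y n i =
     (if 1 \<le> i \<and> i \<le> 2 * n then if odd i then x (2 * K + 1) else x (2 * K + 2) else x i)" for n i
  proof (induction n arbitrary: i)
    case (Suc n)
    have IH: "y n i = (if 1 \<le> i \<and> i \<le> 2 * n then if odd i then x (2 * K + 1) else x (2 * K + 2) else x i)" for i
      using Suc by simp
    have "y (Suc n) = straight orc (g n) (y n)"
      by (simp add: y_def straight_append)
    moreover have "straight orc (g n) (y n) = (y n)(2 * n + 1 := y n (2 * K + 1), 2 * n + 2 := y n (2 * K + 2))"
      using Suc.prems by (auto simp: g_def)
    moreover have "y n (2 * K + 1) = x (2 * K + 1)" "y n (2 * K + 2) = x (2 * K + 2)"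
      using Suc.prems by (auto simp: IH)
    ultimately have "y (Suc n) i = ((y n)(2 * n + 1 := x (2 * K + 1), 2 * n + 2 := x (2 * K + 2))) i"
      by simp
    moreover have "i \<le> 2 * Suc n \<longleftrightarrow> i \<le> 2 * n \<or> i = 2 * n + 1 \<or> i = 2 * n + 2" by auto
    ultimately show ?case by (auto simp: IH)
  qed (simp add: y_def)
  then show ?thesis by (simp only: fill_def y_def g_def order_refl)
qed

lemma straight_store:
  assumes ne: "a \<noteq> b" "a \<noteq> c" "a \<noteq> r" "a \<noteq> m" "b \<noteq> c" "b \<noteq> r" "b \<noteq> m" "c \<noteq> r" "c \<noteq> m" "r \<noteq> m"
    and D: "D = 2 * t + K" "a < D" "b < D" "c < D" "r < D" "m < D" and t: "y c = real t"
  shows "straight orc [Const a 2, Mul a a c, Const b (real K), Add a a b, Const b (real r),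
      Copy a b, Const b 1, Add a a b, Const b (real m), Copy a b, Const b 1, Add c c b, Const b 0] y =
    y(a := real (Suc D), D := y r, Suc D := y m, c := real (Suc t), b := 0)"
proof -
  have ad: "addr (real j) = j" for j by (simp add: addr_def)
  have val: "2 * real t + real K = real D" "real D + 1 = real (Suc D)" "real t + 1 = real (Suc t)"
    using D by simp_all
  have neD: "a \<noteq> D" "a \<noteq> Suc D" "b \<noteq> D" "b \<noteq> Suc D" "c \<noteq> D" "c \<noteq> Suc D" "r \<noteq> D" "r \<noteq> Suc D"
    "m \<noteq> D" "m \<noteq> Suc D" "D \<noteq> Suc D"
    using D by simp_all
  show ?thesis
    by (simp only: straight.simps bss_exec.simps snd_conv fun_upd_apply ad val t ne ne[symmetric]
        neD neD[symmetric] refl if_True if_False) (use neD in \<open>auto simp: fun_eq_iff\<close>)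
qed

text \<open>Entry \<open>t\<close> of the list is stored under the index \<open>K + t\<close> of the output, with \<open>K\<close> so large that the
  registers used by the loop lie below.  After the loop the first \<open>K\<close> entries are filled with copies of
  entry \<open>K\<close>; only the set of entries is asserted, so repetitions do no harm.\<close>

lemma list_program:
  assumes N: "computable fst (arguments k) (\<lambda>e. real (N e))" and N0: "\<And>e. 0 < N e"
    and z: "ccomputable (\<lambda>p. fst (fst p)) (map (\<lambda>u p. u (fst p)) (arguments k) @ [snd])
      (\<lambda>p. z (fst p) (snd p))"
  obtains P where "rational_program P"
    "\<And>orc ns. length ns = k \<Longrightarrow>
      \<exists>out. bss_computes orc P ns out \<and> set out = z (orc, ns) ` {..<N (orc, ns)}"
proof -
  let ?vs = "map (\<lambda>u p. u (fst p)) (arguments k) @ [snd] :: (run \<times> nat \<Rightarrow> nat) list"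
  let ?rs = "[0..<k] @ [k + 1]"
  have "length [0..<k] = length (arguments k)" "\<forall>r\<in>set [0..<k]. r < k"
    by (auto simp: arguments_def)
  then obtain cN MN where cN: "fragment fst (arguments k) (\<lambda>e. real (N e)) [0..<k] k 0 cN MN"
    using computableE[OF N] by blast
  define L where "L = length cN + 1"
  have "length ?rs = length ?vs" "\<forall>r\<in>set ?rs. r < k + 2"
    by (auto simp: arguments_def)
  then obtain cr Mr where cr: "fragment (\<lambda>p. fst (fst p)) ?vs (\<lambda>p. Re (z (fst p) (snd p))) ?rs (k + 2) (L + 2) cr Mr"
    using computableE z[unfolded ccomputable_def] by blast
  have "length ?rs = length ?vs" "\<forall>r\<in>set ?rs. r < k + 3"
    by (auto simp: arguments_def)
  then obtain ci Mi where ci: "fragment (\<lambda>p. fst (fst p)) ?vs (\<lambda>p. Im (z (fst p) (snd p))) ?rs (k + 3) (L + 2 + length cr) ci Mi"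
    using computableE z[unfolded ccomputable_def] by blast
  define K where "K = Max {k + 6, MN, Mr, Mi}"
  have K: "k + 6 \<le> K" "MN \<le> K" "Mr \<le> K" "Mi \<le> K" by (auto simp: K_def)
  define store where "store = [Const (k + 4) 2, Mul (k + 4) (k + 4) (k + 1),
    Const (k + 5) (real (2 * K + 1)), Add (k + 4) (k + 4) (k + 5), Const (k + 5) (real (k + 2)),
    Copy (k + 4) (k + 5), Const (k + 5) 1, Add (k + 4) (k + 4) (k + 5),
    Const (k + 5) (real (k + 3)), Copy (k + 4) (k + 5), Const (k + 5) 1,
    Add (k + 1) (k + 1) (k + 5), Const (k + 5) 0]"
  define E where "E = L + 2 + length cr + length ci + length store + 1"
  define finish where "finish = [Const (k + 1) (real K), Add 0 k (k + 1)] @ fill K"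
  define P where "P = cN @ [Const (k + 1) 0] @ [Sub (k + 2) (k + 1) k, Branch (k + 2) E] @ cr @ ci @
    store @ [Branch (k + 5) L] @ finish"
  have pl: "placed P 0 cN" "placed P (L + 2) cr" "placed P (L + 2 + length cr) ci"
      "placed P (L + 2 + length cr + length ci) store" "placed P E finish"
    and P1: "length cN < length P" "P ! length cN = Const (k + 1) 0"
      "L < length P" "P ! L = Sub (k + 2) (k + 1) k" "Suc L < length P" "P ! Suc L = Branch (k + 2) E"
      "L + 2 + length cr + length ci + length store < length P"
      "P ! (L + 2 + length cr + length ci + length store) = Branch (k + 5) L"
    using placed_self[of P] unfolding P_def placed_append placed_Cons
    by (simp_all add: L_def E_def add.assoc)
  have len: "length P = E + length finish" by (simp add: P_def E_def L_def)
  have "rational_program (fill n)" for n by (auto simp: fill_def rational_program_def)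
  then have rat: "rational_program P"
    using fragment_rational[OF cN] fragment_rational[OF cr] fragment_rational[OF ci]
    by (simp add: P_def rational_program_Cons store_def finish_def)
  have "\<exists>out. bss_computes orc P ns out \<and> set out = z (orc, ns) ` {..<N (orc, ns)}"
    if ns: "length ns = k" for orc ns
  proof -
    define x where "x = (\<lambda>i. if i < length ns then real (ns ! i) else 0)"
    let ?e = "(orc, ns)" let ?n = "N (orc, ns)"
    have x: "x ([0..<k] ! i) = real ((arguments k ! i) ?e)" if "i < length (arguments k)" for i
      using that ns by (simp add: arguments_def x_def)
    then obtain x0 where x0: "reaches orc P (0, x) (length cN, x0)" "x0 k = real ?n"
      "\<And>i. i < k \<or> MN \<le> i \<Longrightarrow> x0 i = x i"
      using fragment_run[OF cN pl(1), of x ?e] unfolding fst_conv add_0 by blast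
    define inv where "inv t y \<longleftrightarrow> (\<forall>i<k. y i = x i) \<and> y k = real ?n \<and> y (k + 1) = real t \<and>
      (\<forall>l<t. y (2 * (K + l) + 1) = Re (z ?e l) \<and> y (2 * (K + l) + 2) = Im (z ?e l))"
      for t and y :: "nat \<Rightarrow> real"
    have step: "\<exists>y'. reaches orc P (L, y) (L, y') \<and> inv (Suc t) y'" if y: "inv t y" and t: "t < ?n" for t y
    proof -
      let ?y = "y(k + 2 := real t - real ?n)"
      have r1: "reaches orc P (L, y) (L + 2, ?y)"
        by (rule reaches_step[OF P1(3)], unfold P1(4) bss_exec.simps Suc_eq_plus1[symmetric],
            rule reaches_step[OF P1(5)]) (use y t in \<open>simp add: P1(6) inv_def\<close>)
      have var: "w (?rs ! i) = real ((?vs ! i) (?e, t))"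
        if "i < length ?vs" "\<And>i. i < k + 2 \<Longrightarrow> w i = ?y i" for i w
        using that y x[of i] by (auto simp: nth_append inv_def arguments_def less_Suc_eq)
      obtain y1 where y1: "reaches orc P (L + 2, ?y) (L + 2 + length cr, y1)" "y1 (k + 2) = Re (z ?e t)"
        "\<And>i. i < k + 2 \<or> Mr \<le> i \<Longrightarrow> y1 i = ?y i"
        using fragment_run[OF cr pl(2), of ?y "(?e, t)"] var[of _ ?y] unfolding fst_conv snd_conv by blast
      obtain y2 where y2: "reaches orc P (L + 2 + length cr, y1) (L + 2 + length cr + length ci, y2)"
        "y2 (k + 3) = Im (z ?e t)" "\<And>i. i < k + 3 \<or> Mi \<le> i \<Longrightarrow> y2 i = y1 i"
        using fragment_run[OF ci pl(3), of y1 "(?e, t)"] var[of _ y1] y1(3) unfolding fst_conv snd_conv by blast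
      have low: "y2 i = y i" if "i < k + 2" for i using y2(3) y1(3) that by simp
      have high: "y2 i = y i" if "i \<ge> K" for i using y2(3)[of i] y1(3)[of i] that K by simp
      let ?z = "straight orc store y2"
      have "y2 (k + 1) = real t" "y2 (k + 2) = Re (z ?e t)"
        using low[of "k + 1"] y y2(3)[of "k + 2"] y1(2) by (auto simp: inv_def)
      then have z: "?z = y2(k + 4 := real (2 * (K + t) + 2), 2 * (K + t) + 1 := Re (z ?e t),
          2 * (K + t) + 2 := Im (z ?e t), k + 1 := real (Suc t), k + 5 := 0)"
        using straight_store[of "k + 4" "k + 5" "k + 1" "k + 2" "k + 3" "2 * (K + t) + 1" t "2 * K + 1" y2 orc]
          K(1) y2(2) unfolding store_def by simp
      have "inv (Suc t) ?z"
        unfolding inv_def z using y K(1) low high by (auto simp: inv_def less_Suc_eq)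
      moreover have "reaches orc P (L + 2 + length cr + length ci, y2) (L, ?z)"
      proof (rule reaches_trans[OF reaches_straight[OF pl(4)]])
        show "\<forall>i\<in>set store. \<forall>r l. i \<noteq> Branch r l" by (simp add: store_def)
        show "reaches orc P (L + 2 + length cr + length ci + length store, ?z) (L, ?z)"
          by (rule reaches_step[OF P1(7)]) (simp only: P1(8) z bss_exec.simps, simp)
      qed
      ultimately show ?thesis
        using r1 y1(1) y2(1) by (blast intro: reaches_trans)
    qed
    have "t \<le> ?n \<Longrightarrow> \<exists>y. reaches orc P (0, x) (L, y) \<and> inv t y" for t
    proof (induction t)
      case 0
      have "reaches orc P (0, x) (L, x0(k + 1 := 0))"
        by (rule reaches_trans[OF x0(1)], rule reaches_step[OF P1(1)]) (simp add: P1(2) L_def)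
      moreover have "inv 0 (x0(k + 1 := 0))" using x0 by (auto simp: inv_def)
      ultimately show ?case by blast
    next
      case (Suc t)
      then show ?case using step[of t] by (auto intro: reaches_trans)
    qed
    then obtain y where y: "reaches orc P (0, x) (L, y)" "inv ?n y" by blast
    have r2: "reaches orc P (L, y) (E, y(k + 2 := 0))"
      by (rule reaches_step[OF P1(3)], unfold P1(4) bss_exec.simps Suc_eq_plus1[symmetric],
          rule reaches_step[OF P1(5)]) (use y(2) in \<open>simp add: P1(6) inv_def\<close>)
    let ?w = "straight orc finish (y(k + 2 := 0))"
    have "reaches orc P (E, y(k + 2 := 0)) (length P, ?w)"
      unfolding len by (rule reaches_straight[OF pl(5)]) (auto simp: finish_def fill_def)
    then have "reaches orc P (bss_init ns) (length P, ?w)"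
      using y(1) r2 unfolding bss_init_def x_def by (blast intro: reaches_trans)
    then have "bss_computes orc P ns (bss_output ?w)"
      unfolding bss_computes_def reaches_def by (metis order_refl)
    moreover have "set (bss_output ?w) = z ?e ` {..<?n}"
    proof -
      let ?u = "y(k + 2 := 0, k + 1 := real K, 0 := real ?n + real K)"
      have u: "?w = straight orc (fill K) ?u"
        using y(2) by (simp add: finish_def inv_def)
      have "?w 0 = real (?n + K)" unfolding u straight_fill by simp
      then have len_out: "addr (?w 0) = ?n + K" by (simp only: addr_def floor_of_nat nat_int)
      have entry: "Complex (?w (2 * l + 1)) (?w (2 * l + 2)) = z ?e (l - K)" if "l < ?n + K" for l
      proof (cases "l < K")
        case True
        then have "?w (2 * l + 1) = y (2 * K + 1)" "?w (2 * l + 2) = y (2 * K + 2)"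
          using K(1) unfolding u straight_fill by auto
        then show ?thesis using True y(2) N0[of ?e] by (auto simp: inv_def complex_eq_iff)
      next
        case False
        then have "?w (2 * l + 1) = y (2 * l + 1)" "?w (2 * l + 2) = y (2 * l + 2)"
          using K(1) unfolding u straight_fill by auto
        moreover have "l - K < ?n" "K + (l - K) = l" using False that by auto
        ultimately show ?thesis using y(2) unfolding inv_def by (metis complex.exhaust_sel complex.sel)
      qed
      have "set (bss_output ?w) = (\<lambda>l. z ?e (l - K)) ` {..<?n + K}"
        unfolding bss_output_def len_out using entry by (auto simp: image_iff)
      also have "\<dots> = z ?e ` {..<?n}"
      proof -
        have "(\<lambda>l. l - K) ` {..<?n + K} = {..<?n}"
        proof (intro set_eqI iffI)
          fix i assume "i \<in> {..<?n}"
          then have "i = (i + K) - K" "i + K \<in> {..<?n + K}" by auto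
          then show "i \<in> (\<lambda>l. l - K) ` {..<?n + K}" by blast
        next
          fix i assume "i \<in> (\<lambda>l. l - K) ` {..<?n + K}"
          then show "i \<in> {..<?n}" using N0[of ?e] by auto
        qed
        then show ?thesis by (metis image_image)
      qed
      finally show ?thesis .
    qed
    ultimately show ?thesis by blast
  qed
  with rat show ?thesis using that by blast
qed

definition queried ::
  "bss_instr list \<Rightarrow> nat \<times> (nat \<Rightarrow> real) \<Rightarrow> nat set" where
  "queried P s = (if fst s < length P then
     case P ! fst s of Query r t \<Rightarrow> {addr (snd s r)} | _ \<Rightarrow> {} else {})"

lemma bss_step_cong:
  assumes "\<forall>i\<in>queried P s. orc i = orc' i"
  shows "bss_step orc P s = bss_step orc' P s"
proof (cases "fst s < length P")
  case True
  obtain pc x where "s = (pc, x)" by force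
  then show ?thesis using True assms
    by (cases "P ! pc") (auto simp: bss_step_def queried_def)
qed (simp add: bss_step_def)

lemma bss_run_cong:
  assumes "\<forall>t<T. \<forall>i\<in>queried P ((bss_step orc P ^^ t) s). orc i = orc' i"
  shows "t \<le> T \<Longrightarrow> (bss_step orc P ^^ t) s = (bss_step orc' P ^^ t) s"
proof (induction t)
  case (Suc t)
  then have "(bss_step orc P ^^ t) s = (bss_step orc' P ^^ t) s" by simp
  moreover have "bss_step orc P ((bss_step orc P ^^ t) s) = bss_step orc' P ((bss_step orc P ^^ t) s)"
    using assms Suc.prems by (intro bss_step_cong) (simp add: Suc_le_eq)
  ultimately show ?case by simp
qed simp

lemma finite_queried: "finite (queried P s)"
  by (simp add: queried_def split: bss_instr.split)

text \<open>A halting run makes finitely many queries, and another oracle with the same answers to these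
  queries leads to the same run.  The set of evaluations is read off from the run up to its first
  halting time.\<close>

lemma executed_general_algorithm:
  assumes P: "\<And>A. A \<in> inputs p \<Longrightarrow> executes p k \<Gamma> P A" and ns: "length ns = k"
    and outs: "\<Gamma> ns \<in> inputs p \<rightarrow> outs p"
    and unique: "\<And>out X Y. encodes p out X \<Longrightarrow> encodes p out Y \<Longrightarrow> X = Y"
  shows "general_algorithm p (\<Gamma> ns)"
proof -
  let ?orc = "\<lambda>A i. evals p i A"
  let ?run = "\<lambda>A t. (bss_step (?orc A) P ^^ t) (bss_init ns)"
  define halts where "halts A t \<longleftrightarrow> length P \<le> fst (?run A t)" for A t
  define T where "T A = (LEAST t. halts A t)" for A
  define Q where "Q A = insert 0 (\<Union>t<T A. queried P (?run A t))" for A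
  define L where "L A = evals p ` Q A" for A
  have ex: "\<exists>t. halts A t \<and> encodes p (bss_output (snd (?run A t))) (\<Gamma> ns A)" if A: "A \<in> inputs p" for A
  proof -
    obtain out t pc x where "?run A t = (pc, x)" "length P \<le> pc" "out = bss_output x"
      "encodes p out (\<Gamma> ns A)"
      using P[OF A] ns unfolding executes_def bss_computes_def by blast
    then show ?thesis by (intro exI[of _ t]) (simp add: halts_def)
  qed
  have stop: "?run A t = ?run A (T A)" if "halts A (T A)" "T A \<le> t" for A t
    using that(2)
  proof (induction t rule: dec_induct)
    case (step t)
    have "length P \<le> fst (?run A t)" using that(1) step.IH by (simp add: halts_def)
    then have "bss_step (?orc A) P (?run A t) = ?run A t" by (simp add: bss_step_def)
    then show ?case using step.IH by simp
  qed simp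
  have TA: "halts A (T A)" "encodes p (bss_output (snd (?run A (T A)))) (\<Gamma> ns A)"
    if A: "A \<in> inputs p" for A
  proof -
    obtain t where t: "halts A t" "encodes p (bss_output (snd (?run A t))) (\<Gamma> ns A)"
      using ex[OF A] by blast
    then show h: "halts A (T A)" unfolding T_def by (rule_tac LeastI)
    have "T A \<le> t" unfolding T_def using t(1) by (rule Least_le)
    from stop[OF h this] t(2) show "encodes p (bss_output (snd (?run A (T A)))) (\<Gamma> ns A)"
      by metis
  qed
  have "L A \<noteq> {} \<and> finite (L A) \<and> L A \<subseteq> range (evals p) \<and>
        (\<forall>B\<in>inputs p. (\<forall>h\<in>L A. h B = h A) \<longrightarrow> L B = L A \<and> \<Gamma> ns B = \<Gamma> ns A)"
    if A: "A \<in> inputs p" for A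
  proof (intro conjI ballI impI)
    show "L A \<noteq> {}" "finite (L A)" "L A \<subseteq> range (evals p)"
      by (auto simp: L_def Q_def finite_queried)
    fix B assume B: "B \<in> inputs p" and "\<forall>h\<in>L A. h B = h A"
    then have "\<forall>t<T A. \<forall>i\<in>queried P (?run A t). ?orc A i = ?orc B i"
      by (auto simp: L_def Q_def)
    then have run: "?run A t = ?run B t" if "t \<le> T A" for t
      using bss_run_cong[OF _ that] by simp
    have "T B = T A"
      unfolding T_def[of B]
    proof (rule Least_equality)
      show "halts B (T A)" using TA(1)[OF A] run[of "T A"] by (simp add: halts_def)
      fix t assume t: "halts B t"
      show "T A \<le> t"
      proof (rule ccontr)
        assume "\<not> T A \<le> t"
        then have "halts A t" using t run[of t] by (simp add: halts_def)
        then have "T A \<le> t" unfolding T_def by (rule Least_le)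
        with \<open>\<not> T A \<le> t\<close> show False by simp
      qed
    qed
    then show "L B = L A" using run by (simp add: L_def Q_def)
    show "\<Gamma> ns B = \<Gamma> ns A"
      using TA(2)[OF A] TA(2)[OF B] run[OF order_refl] \<open>T B = T A\<close> unique by metis
  qed
  then show ?thesis
    unfolding general_algorithm_def
    by (intro conjI outs exI[of _ L] ballI) blast+
qed

section \<open>Hausdorff convergence\<close>

lemma bdd_above_infdist: "compact X \<Longrightarrow> bdd_above ((\<lambda>x. infdist x Y) ` X)"
  by (intro bounded_imp_bdd_above compact_imp_bounded compact_continuous_image continuous_intros)

lemma hausdorff_dist_le:
  assumes "X \<in> ne_compacts" "Y \<in> ne_compacts" "\<And>x. x \<in> X \<Longrightarrow> infdist x Y \<le> r"
    "\<And>y. y \<in> Y \<Longrightarrow> infdist y X \<le> r"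
  shows "hausdorff_dist X Y \<le> r"
  using assms by (auto simp: hausdorff_dist_def ne_compacts_def intro!: cSUP_least)

lemma infdist_le_hausdorff:
  assumes "X \<in> ne_compacts" "Y \<in> ne_compacts" "x \<in> X"
  shows "infdist x Y \<le> hausdorff_dist X Y"
proof -
  have "infdist x Y \<le> (SUP x\<in>X. infdist x Y)"
    using assms by (intro cSUP_upper bdd_above_infdist) (auto simp: ne_compacts_def)
  then show ?thesis using assms by (simp add: hausdorff_dist_def)
qed

lemma hausdorff_dist_commute: "hausdorff_dist X Y = hausdorff_dist Y X"
  by (auto simp: hausdorff_dist_def max.commute)

lemma hausdorff_dist_nonneg: "0 \<le> hausdorff_dist X Y"
proof (cases "X \<in> ne_compacts \<and> Y \<in> ne_compacts")
  case True
  then obtain x where "x \<in> X" by (auto simp: ne_compacts_def)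
  then show ?thesis using True infdist_le_hausdorff[of X Y x] infdist_nonneg[of x Y] by linarith
next
  case False
  then show ?thesis unfolding hausdorff_dist_def by (simp only: if_False order_refl)
qed

lemma ne_compacts_closed: "X \<in> ne_compacts \<Longrightarrow> closed X \<and> X \<noteq> {}"
  by (auto simp: ne_compacts_def compact_imp_closed)

lemma hausdorff_dist_subset:
  assumes "X \<in> ne_compacts" "Y \<in> ne_compacts" "hausdorff_dist X Y = 0"
  shows "X \<subseteq> Y"
proof
  fix x assume "x \<in> X"
  then have "infdist x Y = 0"
    using infdist_le_hausdorff[OF assms(1,2)] assms(3) infdist_nonneg[of x Y] by (simp add: order_antisym)
  then show "x \<in> Y" using ne_compacts_closed[OF assms(2)] by (simp add: in_closed_iff_infdist_zero)
qed

lemma Metric_space_hausdorff: "Metric_space ne_compacts hausdorff_dist"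
proof
  fix X Y Z assume X: "X \<in> ne_compacts" and Y: "Y \<in> ne_compacts"
  show "hausdorff_dist X Y = 0 \<longleftrightarrow> X = Y"
  proof
    assume "hausdorff_dist X Y = 0"
    then show "X = Y"
      using hausdorff_dist_subset[OF X Y] hausdorff_dist_subset[OF Y X]
      by (simp add: hausdorff_dist_commute[of Y X])
  next
    assume "X = Y"
    then have "hausdorff_dist X Y \<le> 0" using X by (intro hausdorff_dist_le) auto
    then show "hausdorff_dist X Y = 0" using hausdorff_dist_nonneg[of X Y] by simp
  qed
  assume Z: "Z \<in> ne_compacts"
  have tri: "infdist x Z \<le> hausdorff_dist X Y + hausdorff_dist Y Z"
    if X: "X \<in> ne_compacts" and Y: "Y \<in> ne_compacts" and Z: "Z \<in> ne_compacts" and x: "x \<in> X" for X Y Z x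
  proof -
    obtain y where y: "y \<in> Y" "infdist x Y = dist x y"
      using infdist_attains_inf ne_compacts_closed[OF Y] by blast
    have "infdist x Z \<le> infdist y Z + dist x y" by (rule infdist_triangle)
    also have "\<dots> \<le> hausdorff_dist Y Z + hausdorff_dist X Y"
      using infdist_le_hausdorff[OF Y Z y(1)] infdist_le_hausdorff[OF X Y x] y(2) by simp
    finally show ?thesis by simp
  qed
  show "hausdorff_dist X Z \<le> hausdorff_dist X Y + hausdorff_dist Y Z"
  proof (rule hausdorff_dist_le[OF X Z])
    show "infdist x Z \<le> hausdorff_dist X Y + hausdorff_dist Y Z" if "x \<in> X" for x
      by (rule tri[OF X Y Z that])
    show "infdist z X \<le> hausdorff_dist X Y + hausdorff_dist Y Z" if "z \<in> Z" for z
      using tri[OF Z Y X that] by (simp add: hausdorff_dist_commute)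
  qed
qed (auto simp: hausdorff_dist_nonneg hausdorff_dist_commute)

lemma hausdorff_tendsto_zero_I:
  assumes "\<And>e. e > 0 \<Longrightarrow> \<exists>N. \<forall>n\<ge>N. hausdorff_dist (S n) Y \<le> e"
  shows "(\<lambda>n. hausdorff_dist (S n) Y) \<longlonglongrightarrow> 0"
proof (rule LIMSEQ_I)
  fix e :: real assume "e > 0"
  then obtain N where "\<forall>n\<ge>N. hausdorff_dist (S n) Y \<le> e / 2" using assms[of "e / 2"] by auto
  then show "\<exists>N. \<forall>n\<ge>N. norm (hausdorff_dist (S n) Y - 0) < e"
    using \<open>e > 0\<close> hausdorff_dist_nonneg by (intro exI[of _ N]) (force simp: abs_of_nonneg)
qed

text \<open>By compactness finitely many of the \<open>S n\<close>, hence a single one, form an \<open>e\<close>-net of the limit.\<close>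

lemma hausdorff_tendsto_increasing:
  assumes S: "\<And>n. S n \<in> ne_compacts" and mono: "\<And>m n. m \<le> n \<Longrightarrow> S m \<subseteq> S n"
    and Y: "Y \<in> ne_compacts" and cl: "closure (\<Union>n. S n) = Y"
  shows "(\<lambda>n. hausdorff_dist (S n) Y) \<longlonglongrightarrow> 0"
proof (rule hausdorff_tendsto_zero_I)
  fix e :: real assume e: "e > 0"
  have cover: "Y \<subseteq> (\<Union>n. \<Union>s\<in>S n. ball s e)"
  proof
    fix y assume "y \<in> Y"
    then obtain s where "s \<in> (\<Union>n. S n)" "dist s y < e"
      using cl e by (metis closure_approachable)
    then show "y \<in> (\<Union>n. \<Union>s\<in>S n. ball s e)" by auto
  qed
  have "compact Y" using Y by (simp add: ne_compacts_def)
  then obtain C where C: "finite C" "Y \<subseteq> (\<Union>n\<in>C. \<Union>s\<in>S n. ball s e)"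
    by (rule compactE_image[OF _ _ cover]) auto
  have "hausdorff_dist (S n) Y \<le> e" if n: "n \<ge> Max (insert 0 C)" for n
  proof (rule hausdorff_dist_le[OF S Y])
    fix s assume "s \<in> S n"
    then have "s \<in> (\<Union>n. S n)" by blast
    from subsetD[OF closure_subset this] have "s \<in> Y" unfolding cl .
    then show "infdist s Y \<le> e" using e by simp
  next
    fix y assume "y \<in> Y"
    then obtain m s where m: "m \<in> C" "s \<in> S m" "dist s y < e" using C(2) by auto
    have "m \<le> n" using n m(1) C(1) by auto
    then have "s \<in> S n" using mono m(2) by blast
    then have "infdist y (S n) \<le> dist y s" by (rule infdist_le)
    then show "infdist y (S n) \<le> e" using m(3) by (simp add: dist_commute)
  qed
  then show "\<exists>N. \<forall>n\<ge>N. hausdorff_dist (S n) Y \<le> e" by blast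
qed

text \<open>The points of \<open>S n\<close> at distance at least \<open>e\<close> from the limit form a decreasing sequence of
  compact sets with empty intersection.\<close>

lemma hausdorff_tendsto_decreasing:
  assumes S: "\<And>n. S n \<in> ne_compacts" and mono: "\<And>m n. m \<le> n \<Longrightarrow> S n \<subseteq> S m"
    and Y: "Y \<in> ne_compacts" and cap: "(\<Inter>n. S n) = Y"
  shows "(\<lambda>n. hausdorff_dist (S n) Y) \<longlonglongrightarrow> 0"
proof (rule hausdorff_tendsto_zero_I)
  fix e :: real assume e: "e > 0"
  define F where "F n = S n \<inter> {y. e \<le> infdist y Y}" for n
  have "compact (F n)" for n
    unfolding F_def using S[of n]
    by (intro compact_Int_closed closed_Collect_le continuous_intros) (auto simp: ne_compacts_def)
  moreover have "(\<Inter>n. F n) = {}"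
    using cap e by (auto simp: F_def)
  moreover have "F n \<subseteq> F m" if "m \<le> n" for m n using mono[OF that] by (auto simp: F_def)
  ultimately obtain N where N: "F N = {}" using compact_nest[of F] by blast
  have "hausdorff_dist (S n) Y \<le> e" if "n \<ge> N" for n
  proof (rule hausdorff_dist_le[OF S Y])
    fix s assume "s \<in> S n"
    then have "s \<in> S N" "s \<notin> F N" using mono[OF that] N by auto
    then show "infdist s Y \<le> e" by (auto simp: F_def)
  next
    fix y assume "y \<in> Y"
    then have "y \<in> S n" using cap by blast
    then show "infdist y (S n) \<le> e" using e by simp
  qed
  then show "\<exists>N. \<forall>n\<ge>N. hausdorff_dist (S n) Y \<le> e" by blast
qed


section \<open>Vectors with integer coordinates\<close>

definition int_box :: "nat \<Rightarrow> ell2 set" where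
  "int_box n = {x. (\<forall>i. Re (ell2_nth x i) \<in> \<int> \<and> Im (ell2_nth x i) \<in> \<int> \<and>
    \<bar>Re (ell2_nth x i)\<bar> \<le> n \<and> \<bar>Im (ell2_nth x i)\<bar> \<le> n) \<and> (\<forall>i\<ge>n. ell2_nth x i = 0)}"

lemma box_mono: "m \<le> n \<Longrightarrow> int_box m \<subseteq> int_box n"
  unfolding int_box_def by (fastforce intro: order_trans)

lemma zero_in_box: "0 \<in> int_box n"
  by (simp add: int_box_def)

text \<open>Truncation followed by rounding of the coordinates multiplied by a large \<open>N\<close>.\<close>

lemma box_dense:
  assumes "e > 0"
  obtains n x N where "x \<in> int_box n" "0 < N" "norm (y - (1 / real N) *\<^sub>R x) < e"
proof -
  obtain m where m: "norm (head m y - y) < e / 2"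
    using head_tendsto[of y] \<open>e > 0\<close> unfolding LIMSEQ_iff by (meson half_gt_zero order_refl)
  obtain N :: nat where N: "4 * real m / e < real N" "0 < N"
    using reals_Archimedean2[of "max (4 * real m / e) 0"] by auto
  define c where "c i = Complex \<lfloor>real N * Re (ell2_nth y i)\<rfloor> \<lfloor>real N * Im (ell2_nth y i)\<rfloor>" for i
  define x where "x = fin m c"
  have err: "\<bar>r - real_of_int \<lfloor>real N * r\<rfloor> / real N\<bar> \<le> 1 / real N" for r
  proof -
    have "\<bar>real N * r - real_of_int \<lfloor>real N * r\<rfloor>\<bar> \<le> 1" by linarith
    then have "\<bar>real N * r - real_of_int \<lfloor>real N * r\<rfloor>\<bar> / real N \<le> 1 / real N"
      by (intro divide_right_mono) auto
    moreover have "\<bar>real N * r - real_of_int \<lfloor>real N * r\<rfloor>\<bar> / real N = \<bar>(real N * r - real_of_int \<lfloor>real N * r\<rfloor>) / real N\<bar>"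
      by simp
    ultimately show ?thesis using N(2) by (simp add: diff_divide_distrib)
  qed
  have err2: "cmod (ell2_nth y i - of_real (1 / real N) * c i) \<le> 2 / real N" for i
  proof -
    have "cmod (ell2_nth y i - of_real (1 / real N) * c i) \<le>
        \<bar>Re (ell2_nth y i - of_real (1 / real N) * c i)\<bar> + \<bar>Im (ell2_nth y i - of_real (1 / real N) * c i)\<bar>"
      by (rule cmod_le)
    also have "\<dots> \<le> 1 / real N + 1 / real N"
      using err[of "Re (ell2_nth y i)"] err[of "Im (ell2_nth y i)"] by (intro add_mono) (auto simp: c_def)
    finally show ?thesis by simp
  qed
  have eq: "head m y - (1 / real N) *\<^sub>R x = fin m (\<lambda>i. ell2_nth y i - of_real (1 / real N) * c i)"
    by (auto intro!: ell2_eqI simp: x_def scaleR_conv_of_real)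
  have "norm (head m y - (1 / real N) *\<^sub>R x) \<le> (\<Sum>i<m. cmod (ell2_nth y i - of_real (1 / real N) * c i))"
    unfolding eq unfolding fin_eq_sum by (rule order_trans[OF norm_sum]) simp
  also have "\<dots> \<le> (\<Sum>i<m. 2 / real N)" by (intro sum_mono err2)
  also have "\<dots> < e / 2" using N \<open>e > 0\<close> by (simp add: field_simps)
  finally have "norm (y - (1 / real N) *\<^sub>R x) < e"
    using m norm_triangle_ineq[of "y - head m y" "head m y - (1 / real N) *\<^sub>R x"]
    by (simp add: norm_minus_commute)
  moreover have "x \<in> int_box (m + nat \<lceil>real N * norm y + 1\<rceil>)"
  proof -
    have bd: "\<bar>real_of_int \<lfloor>real N * r\<rfloor>\<bar> \<le> real (m + nat \<lceil>real N * norm y + 1\<rceil>)" if "\<bar>r\<bar> \<le> norm y" for r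
    proof -
      have "\<bar>real N * r\<bar> \<le> real N * norm y" using that by (simp add: abs_mult mult_left_mono)
      then have "\<bar>real_of_int \<lfloor>real N * r\<rfloor>\<bar> \<le> real N * norm y + 1" by linarith
      also have "\<dots> \<le> real (nat \<lceil>real N * norm y + 1\<rceil>)" by (rule real_nat_ceiling_ge)
      finally show ?thesis by simp
    qed
    have "\<bar>Re (ell2_nth y i)\<bar> \<le> norm y" "\<bar>Im (ell2_nth y i)\<bar> \<le> norm y" for i
      using abs_Re_le_cmod abs_Im_le_cmod cmod_nth_le order_trans by meson+
    then show ?thesis unfolding int_box_def x_def using bd by (auto simp: c_def)
  qed
  ultimately show ?thesis using that N(2) by blast
qed

lift_definition shift :: "nat \<Rightarrow> ell2 \<Rightarrow> ell2" is "\<lambda>n x k. if k < n then 0 else x (k - n)"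
  subgoal for n x by (subst summable_iff_shift[symmetric, of _ n]) simp
  done

lift_definition unshift :: "nat \<Rightarrow> ell2 \<Rightarrow> ell2" is "\<lambda>n x k. x (k + n)"
  by (rule summable_ignore_initial_segment)

declare shift.rep_eq [simp] unshift.rep_eq [simp]

lemma norm_shift [simp]: "norm (shift n x) = norm x"
proof -
  have "(norm (shift n x))\<^sup>2 = (norm x)\<^sup>2"
    unfolding norm_sq_suminf
    by (subst suminf_split_initial_segment[OF summable_cmod_sq[of "shift n x"], of n]) simp
  then show ?thesis by (simp add: power2_eq_iff_nonneg)
qed

lemma shift_unshift: "(\<And>i. i < n \<Longrightarrow> ell2_nth x i = 0) \<Longrightarrow> shift n (unshift n x) = x"
  by (auto intro!: ell2_eqI)

lemma shift_linear: "shift n (x + y) = shift n x + shift n y" "shift n (x - y) = shift n x - shift n y"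
  "shift n (scaleC c x) = scaleC c (shift n x)" "shift n (r *\<^sub>R x) = r *\<^sub>R shift n x"
  by (auto intro!: ell2_eqI)

lemma shift_eq_0_iff [simp]: "shift n x = 0 \<longleftrightarrow> x = 0"
  by (metis norm_shift norm_eq_zero)

lemma bounded_linear_shift: "bounded_linear (shift n)"
  by (rule bounded_linear_intro[where K = 1]) (auto simp: shift_linear)

lemma bounded_bilinear_cinner: "bounded_bilinear cinner"
proof
  show "\<exists>K. \<forall>a b. norm (cinner a b) \<le> norm a * norm b * K"
    using cauchy_schwarz by (intro exI[of _ 1]) simp
qed (simp_all add: cinner_add_left cinner_add_right scaleR_eq_scaleC cinner_scaleC_left
    cinner_scaleC_right scaleR_conv_of_real)

text \<open>The values \<open>\<langle>A y, y\<rangle> / \<langle>y, y\<rangle>\<close> for shifted integer vectors \<open>y\<close> are dense in the tail range.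
  The zero vector is given the value of a basis vector.\<close>

definition tail_value :: "op2 \<Rightarrow> nat \<Rightarrow> ell2 \<Rightarrow> complex" where
  "tail_value A n x = (if x = 0 then cinner (blinfun_apply A (ell2_basis n)) (ell2_basis n)
     else cinner (blinfun_apply A (shift n x)) (shift n x) / of_real ((norm x)\<^sup>2))"

lemma tail_value_in_tail_range:
  assumes "A \<in> Omega_B" shows "tail_value A n x \<in> tail_range A n"
  using quotient_in_tail_range[OF assms, of "shift n x" n] tail_range_I[of "ell2_basis n" n A]
  by (auto simp: tail_value_def)

lemma tail_value_dense:
  assumes A: "A \<in> Omega_B" and w: "w \<in> tail_range A n" and e: "e > 0"
  obtains m x where "x \<in> int_box m" "x \<noteq> 0" "dist (tail_value A n x) w < e"
proof -
  obtain y where y: "norm y = 1" "\<And>i. i < n \<Longrightarrow> ell2_nth y i = 0" "w = cinner (blinfun_apply A y) y"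
    using w by (auto simp: tail_range_def)
  let ?y = "unshift n y"
  have sh: "shift n ?y = y" using y(2) by (rule shift_unshift)
  then have ny: "norm ?y = 1" using y(1) norm_shift by metis
  let ?q = "\<lambda>v. cinner (blinfun_apply A (shift n v)) (shift n v) / of_real ((norm v)\<^sup>2)"
  have "\<exists>m x N. x \<in> int_box m \<and> 0 < N \<and> norm (?y - (1 / real N) *\<^sub>R x) < inverse (real (Suc k))" for k
    using box_dense[of "inverse (real (Suc k))" ?y] by (metis inverse_positive_iff_positive of_nat_0_less_iff zero_less_Suc)
  then obtain m x N where x: "\<And>k. x k \<in> int_box (m k)" "\<And>k. 0 < N k"
    "\<And>k. norm (?y - (1 / real (N k)) *\<^sub>R x k) < inverse (real (Suc k))" by metis
  define v where "v k = (1 / real (N k)) *\<^sub>R x k" for k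
  have v: "v \<longlonglongrightarrow> ?y"
  proof (rule LIM_zero_cancel, rule Lim_null_comparison[OF always_eventually[OF allI]])
    show "norm (v k - ?y) \<le> inverse (real (Suc k))" for k
      using less_imp_le[OF x(3)[of k]] by (simp add: v_def norm_minus_commute)
  qed (rule LIMSEQ_inverse_real_of_nat)
  have "(\<lambda>k. ?q (v k)) \<longlonglongrightarrow> ?q ?y"
    using ny by (intro tendsto_divide bounded_bilinear.tendsto[OF bounded_bilinear_cinner] tendsto_intros
        bounded_linear.tendsto[OF bounded_linear_shift] v) auto
  moreover have "?q ?y = w" by (simp add: sh ny y(3))
  ultimately have "eventually (\<lambda>k. dist (?q (v k)) w < e) sequentially"
    using e by (simp add: tendsto_iff)
  moreover have "eventually (\<lambda>k. dist (v k) ?y < 1) sequentially"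
    using v by (auto simp: tendsto_iff)
  ultimately have "eventually (\<lambda>k. dist (?q (v k)) w < e \<and> dist (v k) ?y < 1) sequentially"
    by (rule eventually_conj)
  then obtain k where k: "dist (?q (v k)) w < e" "dist (v k) ?y < 1"
    using eventually_happens'[OF sequentially_bot] by blast
  have x0: "x k \<noteq> 0" using k(2) ny by (auto simp: v_def)
  have "?q (v k) = ?q (x k)"
    using x(2)[of k] by (simp add: v_def shift_linear scaleR_eq_scaleC Omega_B_scaleC[OF A] cinner_scaleC_left
        cinner_scaleC_right power_mult_distrib power2_eq_square norm_divide)
  then have "dist (tail_value A n (x k)) w < e" using k(1) x0 by (simp add: tail_value_def)
  then show ?thesis using that x(1) x0 by blast
qed

lemma closure_tail_values:
  assumes A: "A \<in> Omega_B"
  shows "closure (\<Union>m. tail_value A n ` int_box m) = closure (tail_range A n)"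
proof
  show "closure (\<Union>m. tail_value A n ` int_box m) \<subseteq> closure (tail_range A n)"
    using tail_value_in_tail_range[OF A] by (intro closure_mono) auto
  have "tail_range A n \<subseteq> closure (\<Union>m. tail_value A n ` int_box m)"
  proof
    fix w assume w: "w \<in> tail_range A n"
    show "w \<in> closure (\<Union>m. tail_value A n ` int_box m)"
      unfolding closure_approachable
    proof (intro allI impI)
      fix e :: real assume "e > 0"
      then show "\<exists>z\<in>\<Union>m. tail_value A n ` int_box m. dist z w < e"
        using tail_value_dense[OF A w] by (metis UN_iff UNIV_I imageI)
    qed
  qed
  then show "closure (tail_range A n) \<subseteq> closure (\<Union>m. tail_value A n ` int_box m)"
    by (rule closure_minimal) simp
qed

definition dig :: "nat \<Rightarrow> nat \<Rightarrow> nat \<Rightarrow> nat" where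
  "dig b k t = t div b ^ k mod b"

lemma digits_exist:
  assumes "\<And>k. k < m \<Longrightarrow> f k < b"
  shows "\<exists>t<b ^ m. \<forall>k<m. dig b k t = f k"
  using assms
proof (induction m arbitrary: f)
  case (Suc m)
  obtain t where t: "t < b ^ m" "\<And>k. k < m \<Longrightarrow> dig b k t = f (Suc k)"
    using Suc.IH[of "\<lambda>k. f (Suc k)"] Suc.prems by auto
  have f0: "f 0 < b" using Suc.prems by simp
  let ?t = "f 0 + b * t"
  have "?t < b * b ^ m"
  proof -
    have "Suc t \<le> b ^ m" using t(1) by simp
    then have "b * Suc t \<le> b * b ^ m" by (rule mult_le_mono2)
    then show ?thesis using f0 by simp
  qed
  moreover have "dig b k ?t = f k" if "k < Suc m" for k
  proof (cases k)
    case 0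
    then show ?thesis using f0 by (simp add: dig_def)
  next
    case (Suc j)
    have "?t div b ^ Suc j = (?t div b) div b ^ j" by (simp add: div_mult2_eq)
    also have "?t div b = t" using f0 by simp
    finally show ?thesis using t(2)[of j] that Suc by (simp add: dig_def)
  qed
  ultimately show ?case by (intro exI[of _ ?t]) simp
qed simp

definition coord :: "nat \<Rightarrow> nat \<Rightarrow> nat \<Rightarrow> complex" where
  "coord b t i = Complex (real (dig b (4 * i) t) - real (dig b (4 * i + 1) t))
     (real (dig b (4 * i + 2) t) - real (dig b (4 * i + 3) t))"

text \<open>A number is read as an expansion in base \<open>n + 1\<close> with four digits for each coordinate, the positive
  and negative parts of its real and imaginary part.  In this way a loop of a machine runs through
  all integer vectors of a box.\<close>

definition coded :: "nat \<Rightarrow> nat \<Rightarrow> ell2" where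
  "coded n t = fin n (coord (Suc n) t)"

lemma coded_box: "coded n ` {..<Suc n ^ (4 * n)} = int_box n"
proof (intro subset_antisym subsetI)
  fix x assume "x \<in> coded n ` {..<Suc n ^ (4 * n)}"
  then obtain t where x: "x = coded n t" by blast
  have d: "dig (Suc n) k t \<le> n" for k
    using mod_less_divisor[of "Suc n"] by (simp add: dig_def less_Suc_eq_le)
  have "\<bar>real (dig (Suc n) k t) - real (dig (Suc n) l t)\<bar> \<le> real n" for k l
    using d[of k] d[of l] by linarith
  then show "x \<in> int_box n" by (auto simp: x int_box_def coded_def coord_def)
next
  fix x assume x: "x \<in> int_box n"
  define c where "c i = ell2_nth x i" for i
  define f where "f k = (let z = c (k div 4) in
    if k mod 4 = 0 then nat \<lfloor>Re z\<rfloor> else if k mod 4 = 1 then nat \<lfloor>- Re z\<rfloor>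
    else if k mod 4 = 2 then nat \<lfloor>Im z\<rfloor> else nat \<lfloor>- Im z\<rfloor>)" for k
  have b: "\<bar>Re (c i)\<bar> \<le> real n" "\<bar>Im (c i)\<bar> \<le> real n" "Re (c i) \<in> \<int>" "Im (c i) \<in> \<int>" for i
    using x by (auto simp: int_box_def c_def)
  have nf: "nat \<lfloor>r\<rfloor> < Suc n" if "\<bar>r\<bar> \<le> real n" for r
    using that by linarith
  have "f k < Suc n" for k
    unfolding f_def Let_def using nf b(1,2)[of "k div 4"] by auto
  then obtain t where t: "t < Suc n ^ (4 * n)" "\<And>k. k < 4 * n \<Longrightarrow> dig (Suc n) k t = f k"
    using digits_exist[of "4 * n" f "Suc n"] by blast
  have part: "real (nat \<lfloor>r\<rfloor>) - real (nat \<lfloor>- r\<rfloor>) = r" if r: "r \<in> \<int>" for r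
    using r by (auto elim!: Ints_cases)
  have "coord (Suc n) t i = c i" if "i < n" for i
  proof -
    have f_at: "f (4 * i + r) = (if r = 0 then nat \<lfloor>Re (c i)\<rfloor> else if r = 1 then nat \<lfloor>- Re (c i)\<rfloor>
        else if r = 2 then nat \<lfloor>Im (c i)\<rfloor> else nat \<lfloor>- Im (c i)\<rfloor>)" if "r < 4" for r
    proof -
      have "(4 * i + r) div 4 = i" "(4 * i + r) mod 4 = r" using that by simp_all
      then show ?thesis by (simp only: f_def Let_def)
    qed
    have "dig (Suc n) (4 * i + r) t = f (4 * i + r)" if "r < 4" for r
      using that \<open>i < n\<close> by (intro t(2)) linarith
    from this[of 0] this[of 1] this[of 2] this[of 3]
    have "dig (Suc n) (4 * i) t = nat \<lfloor>Re (c i)\<rfloor>" "dig (Suc n) (4 * i + 1) t = nat \<lfloor>- Re (c i)\<rfloor>"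
      "dig (Suc n) (4 * i + 2) t = nat \<lfloor>Im (c i)\<rfloor>" "dig (Suc n) (4 * i + 3) t = nat \<lfloor>- Im (c i)\<rfloor>"
      using f_at[of 0] f_at[of 1] f_at[of 2] f_at[of 3] by simp_all
    then show ?thesis using part b(3,4)[of i] by (simp only: coord_def complex_eq_iff complex.sel)
  qed
  then have "coded n t = x"
    using x by (auto intro!: ell2_eqI simp: coded_def c_def int_box_def)
  then show "x \<in> coded n ` {..<Suc n ^ (4 * n)}" using t(1) by blast
qed

lemma finite_box: "finite (int_box n)"
  by (subst coded_box[symmetric]) simp

section \<open>The essential numerical range is computable in two limits\<close>

text \<open>Each time further evaluations are interleaved, the indices of the matrix entries are multiplied by
  three; \<open>c\<close> stands for the resulting factor.\<close>

definition matrix_oracle :: "nat \<Rightarrow> (nat \<Rightarrow> complex) \<Rightarrow> op2 \<Rightarrow> bool" where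
  "matrix_oracle c orc A \<longleftrightarrow>
     (\<forall>i j. orc (c * prod_encode (i, j)) = ell2_nth (blinfun_apply A (ell2_basis j)) i)"

lemma matrix_oracle_eval:
  "matrix_oracle 1 (\<lambda>n. eval_1 n A) A" "matrix_oracle 3 (\<lambda>n. eval_2 n A) A"
  by (auto simp: matrix_oracle_def eval_1_def eval_2_def interleave_def pairs_def cinner_basis_right)

definition entry :: "nat \<Rightarrow> (nat \<Rightarrow> complex) \<Rightarrow> nat \<Rightarrow> nat \<Rightarrow> complex" where
  "entry c orc i j = orc (c * prod_encode (i, j))"

lemma form_fin:
  assumes A: "A \<in> Omega_B" and M: "matrix_oracle c orc A"
  shows "cinner (blinfun_apply A (shift s (fin n f))) (shift s (fin n f))
    = (\<Sum>i<n. \<Sum>j<n. entry c orc (s + i) (s + j) * f j * cnj (f i))"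
proof -
  have "shift s (fin n f) = (\<Sum>i<n. scaleC (f i) (ell2_basis (s + i)))"
    unfolding fin_eq_sum
    by (induction n) (auto simp: shift_linear intro!: ell2_eqI)
  moreover have "blinfun_apply A (\<Sum>i<n. scaleC (f i) (ell2_basis (s + i)))
      = (\<Sum>j<n. scaleC (f j) (blinfun_apply A (ell2_basis (s + j))))"
    by (simp add: blinfun.sum_right Omega_B_scaleC[OF A])
  moreover have "cinner (\<Sum>j<n. scaleC (f j) (blinfun_apply A (ell2_basis (s + j))))
        (\<Sum>i<n. scaleC (f i) (ell2_basis (s + i)))
      = (\<Sum>i<n. \<Sum>j<n. cnj (f i) * (f j * ell2_nth (blinfun_apply A (ell2_basis (s + j))) (s + i)))"
    by (simp add: cinner_sum_left cinner_sum_right cinner_scaleC_left cinner_scaleC_right cinner_basis_right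
        sum_distrib_left)
  ultimately show ?thesis
    using M by (simp add: matrix_oracle_def entry_def mult_ac)
qed

definition value_formula :: "nat \<Rightarrow> (nat \<Rightarrow> complex) \<Rightarrow> nat \<Rightarrow> nat \<Rightarrow> nat \<Rightarrow> complex" where
  "value_formula c orc s n t = (if (\<Sum>i<n. (cmod (coord (Suc n) t i))\<^sup>2) = 0 then entry c orc s s
     else (\<Sum>i<n. \<Sum>j<n. entry c orc (s + i) (s + j) * coord (Suc n) t j * cnj (coord (Suc n) t i))
       / of_real (\<Sum>i<n. (cmod (coord (Suc n) t i))\<^sup>2))"

lemma value_formula:
  assumes A: "A \<in> Omega_B" and M: "matrix_oracle c orc A"
  shows "value_formula c orc s n t = tail_value A s (coded n t)"
proof -
  have "(norm (coded n t))\<^sup>2 = (\<Sum>i<n. (cmod (coord (Suc n) t i))\<^sup>2)"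
    by (simp add: coded_def norm_fin_sq)
  moreover from this have "coded n t = 0 \<longleftrightarrow> (\<Sum>i<n. (cmod (coord (Suc n) t i))\<^sup>2) = 0"
    by (metis norm_eq_zero zero_eq_power2)
  ultimately show ?thesis
    using M form_fin[OF A M, of s n "coord (Suc n) t"] unfolding value_formula_def tail_value_def
    by (simp add: coded_def cinner_basis_right matrix_oracle_def entry_def)
qed

lemma ccomputable_coord:
  assumes "computable orc vs (\<lambda>e. real (b e))" "computable orc vs (\<lambda>e. real (t e))"
    "computable orc vs (\<lambda>e. real (i e))"
  shows "ccomputable orc vs (\<lambda>e. coord (b e) (t e) (i e))"
  unfolding coord_def dig_def
  by (intro ccomputable_Complex computable_diff computable_nat_mod computable_nat_div
      computable_nat_power computable_nat_add computable_nat_mult computable_nat_const assms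
      computable_const[of 1])

lemma ccomputable_entry:
  assumes "computable orc vs (\<lambda>e. real (i e))" "computable orc vs (\<lambda>e. real (j e))"
  shows "ccomputable orc vs (\<lambda>e. entry c (orc e) (i e) (j e))"
  unfolding entry_def
  by (intro ccomputable_query computable_nat_mult computable_nat_const computable_prod_encode assms)

lemma arguments_2: "arguments 2 = [\<lambda>e. snd e ! 0, \<lambda>e. snd e ! 1]"
  by (simp add: arguments_def numeral_2_eq_2)

definition we_tower :: "nat list \<Rightarrow> op2 \<Rightarrow> complex set" where
  "we_tower ns A = (case ns of [] \<Rightarrow> ess_num_range A
     | [n2] \<Rightarrow> closure (tail_range A n2)
     | n2 # n1 # _ \<Rightarrow> tail_value A n2 ` int_box n1)"

lemma we_program:
  obtains P where "rational_program P"
    "\<And>A orc ns. A \<in> Omega_B \<Longrightarrow> matrix_oracle c orc A \<Longrightarrow> length ns = 2 \<Longrightarrow>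
      \<exists>out. bss_computes orc P ns out \<and> set out = we_tower ns A"
proof -
  let ?N = "\<lambda>e :: run. Suc (snd e ! 1) ^ (4 * snd e ! 1)"
  let ?z = "\<lambda>(e :: run) t. value_formula c (fst e) (snd e ! 0) (snd e ! 1) t"
  have N: "computable fst (arguments 2) (\<lambda>e. real (?N e))"
    unfolding arguments_2
    by (intro computable_intros computable_var) auto
  have z: "ccomputable (\<lambda>p. fst (fst p)) (map (\<lambda>u p. u (fst p)) (arguments 2) @ [snd]) (\<lambda>p. ?z (fst p) (snd p))"
    unfolding arguments_2 value_formula_def
    by (simp, intro computable_intros computable_const ccomputable_coord ccomputable_entry computable_var) auto
  obtain P where P: "rational_program P"
    "\<And>orc ns. length ns = 2 \<Longrightarrow> \<exists>out. bss_computes orc P ns out \<and> set out = ?z (orc, ns) ` {..<?N (orc, ns)}"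
    using list_program[OF N _ z] by auto
  have "\<exists>out. bss_computes orc P ns out \<and> set out = we_tower ns A"
    if "A \<in> Omega_B" "matrix_oracle c orc A" "length ns = 2" for A orc ns
  proof -
    obtain n2 n1 where ns: "ns = [n2, n1]"
      using \<open>length ns = 2\<close> by (auto simp: numeral_2_eq_2 length_Suc_conv)
    have "?z (orc, ns) ` {..<?N (orc, ns)} = tail_value A n2 ` coded n1 ` {..<Suc n1 ^ (4 * n1)}"
      by (simp add: ns value_formula[OF that(1,2)] image_image)
    also have "\<dots> = we_tower ns A" by (simp only: coded_box) (simp add: ns we_tower_def)
    finally show ?thesis using P(2)[OF that(3), of orc] by simp
  qed
  then show ?thesis using that P(1) by blast
qed

lemma eval_separates:
  assumes "A \<in> Omega_B" "B \<in> Omega_B" "matrix_oracle c orc A" "matrix_oracle c orc B"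
  shows "A = B"
proof -
  have "blinfun_apply A (ell2_basis j) = blinfun_apply B (ell2_basis j)" for j
    using assms(3,4) by (intro ell2_eqI) (simp add: matrix_oracle_def)
  then have eq: "blinfun_apply A (head m x) = blinfun_apply B (head m x)" for m x
    by (simp add: Omega_B_fin assms)
  have "blinfun_apply A x = blinfun_apply B x" for x
  proof (rule LIMSEQ_unique)
    show "(\<lambda>m. blinfun_apply A (head m x)) \<longlonglongrightarrow> blinfun_apply A x"
      by (intro tendsto_intros head_tendsto)
    show "(\<lambda>m. blinfun_apply A (head m x)) \<longlonglongrightarrow> blinfun_apply B x"
      unfolding eq by (intro tendsto_intros head_tendsto)
  qed
  then show ?thesis by (rule blinfun_eqI)
qed

lemma we_tower_ne_compact:
  assumes A: "A \<in> Omega_B" shows "we_tower ns A \<in> ne_compacts"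
proof -
  consider "ns = []" | n2 where "ns = [n2]" | n2 n1 r where "ns = n2 # n1 # r"
    by (metis list.exhaust)
  then show ?thesis
  proof cases
    case 1
    then show ?thesis using ess_num_range_ne_compact[OF A] by (simp add: we_tower_def)
  next
    case 2
    then show ?thesis using tail_range_nonempty[of A] compact_closure_tail_range[of A n2]
      by (auto simp add: we_tower_def ne_compacts_def)
  next
    case 3
    then show ?thesis using finite_box[of n1] zero_in_box[of n1]
      by (auto simp: we_tower_def ne_compacts_def finite_imp_compact)
  qed
qed

lemma we_computational_problem:
  assumes "\<Omega> \<subseteq> Omega_B" and M: "\<And>A. matrix_oracle c (\<lambda>n. ev n A) A"
  shows "computational_problem (we_problem \<Omega> ev)"
  unfolding computational_problem_def we_problem_def
proof (simp add: Metric_space_hausdorff, intro conjI ballI impI funcsetI)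
  show "ess_num_range A \<in> ne_compacts" if "A \<in> \<Omega>" for A
    using ess_num_range_ne_compact assms(1) that by auto
  fix A B assume AB: "A \<in> \<Omega>" "B \<in> \<Omega>" and eq: "\<forall>n. ev n A = ev n B"
  show "A = B"
  proof (rule eval_separates)
    show "matrix_oracle c (\<lambda>n. ev n A) A" by (rule M)
    show "matrix_oracle c (\<lambda>n. ev n A) B" using M[of B] by (simp add: eq)
  qed (use AB assms in auto)
qed

text \<open>The innermost limit fills a tail range from below, the outer limit runs through the tail ranges, which
  decrease.  The tail ranges contain the essential numerical range, so they are themselves the sets
  required for convergence from above.\<close>

lemma we_in_Pi:
  assumes \<Omega>: "\<Omega> \<subseteq> Omega_B" and M: "\<And>A. matrix_oracle c (\<lambda>n. ev n A) A"
  shows "we_problem \<Omega> ev \<in> Pi_Haus Arithmetic 2"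
proof -
  let ?p = "we_problem \<Omega> ev"
  have p [simp]: "inputs ?p = \<Omega>" "evals ?p = ev" "outs ?p = ne_compacts" "odist ?p = hausdorff_dist"
    "encodes ?p = (\<lambda>out X. X = set out)" "target ?p = ess_num_range"
    by (simp_all add: we_problem_def)
  obtain P where P: "rational_program P" and run: "\<And>A orc ns. A \<in> Omega_B \<Longrightarrow> matrix_oracle c orc A \<Longrightarrow>
      length ns = 2 \<Longrightarrow> \<exists>out. bss_computes orc P ns out \<and> set out = we_tower ns A"
    using we_program by blast
  have ex: "executes ?p 2 we_tower P A" if A: "A \<in> \<Omega>" for A
    unfolding executes_def p
  proof (intro allI impI)
    fix ns :: "nat list" assume "length ns = 2"
    then obtain out where "bss_computes (\<lambda>i. ev i A) P ns out" "set out = we_tower ns A"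
      using run[OF subsetD[OF \<Omega> A] M] by blast
    then show "\<exists>out. bss_computes (\<lambda>i. ev i A) P ns out \<and> we_tower ns A = set out" by auto
  qed
  have outs: "we_tower ns \<in> \<Omega> \<rightarrow> ne_compacts" for ns
    using we_tower_ne_compact \<Omega> by blast
  have lim1: "(\<lambda>n. hausdorff_dist (we_tower [n2, n] A) (we_tower [n2] A)) \<longlonglongrightarrow> 0" if "A \<in> \<Omega>" for A n2
  proof (rule hausdorff_tendsto_increasing)
    have A: "A \<in> Omega_B" using \<Omega> that by blast
    show "we_tower [n2, n] A \<in> ne_compacts" "we_tower [n2] A \<in> ne_compacts" for n
      by (rule we_tower_ne_compact[OF A])+
    show "we_tower [n2, m] A \<subseteq> we_tower [n2, n] A" if "m \<le> n" for m n
      using box_mono[OF that] by (auto simp: we_tower_def)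
    show "closure (\<Union>n. we_tower [n2, n] A) = we_tower [n2] A"
      using closure_tail_values[OF A] by (simp add: we_tower_def)
  qed
  have lim2: "(\<lambda>n. hausdorff_dist (we_tower [n] A) (we_tower [] A)) \<longlonglongrightarrow> 0" if "A \<in> \<Omega>" for A
  proof (rule hausdorff_tendsto_decreasing)
    have A: "A \<in> Omega_B" using \<Omega> that by blast
    show "we_tower [n] A \<in> ne_compacts" "we_tower [] A \<in> ne_compacts" for n
      by (rule we_tower_ne_compact[OF A])+
    show "we_tower [n] A \<subseteq> we_tower [m] A" if "m \<le> n" for m n
      using closure_mono[OF tail_range_antimono[OF that]] by (simp add: we_tower_def)
    show "(\<Inter>n. we_tower [n] A) = we_tower [] A"
      using ess_num_range_eq[OF A] by (simp add: we_tower_def)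
  qed
  have "tower ?p 2 we_tower"
    unfolding tower_def
  proof (intro conjI allI impI ballI)
    show "we_tower [] A = target ?p A" for A by (simp add: we_tower_def)
    show "we_tower ns \<in> inputs ?p \<rightarrow> outs ?p" for ns using outs by simp
    show "(\<lambda>n. odist ?p (we_tower (ns @ [n]) A) (we_tower ns A)) \<longlonglongrightarrow> 0"
      if "length ns < 2" "A \<in> inputs ?p" for ns A
    proof (cases ns)
      case Nil
      then show ?thesis using lim2 that by simp
    next
      case (Cons n2 r)
      then have "ns = [n2]" using that(1) by simp
      then show ?thesis using lim1 that by simp
    qed
    show "general_algorithm ?p (we_tower ns)" if "length ns = 2" for ns
      by (rule executed_general_algorithm[where P = P and k = 2]) (use that ex outs in auto)
  qed
  moreover have "recursive_tower ?p 2 we_tower"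
    unfolding recursive_tower_def using ex P by auto
  ultimately have tt: "typed_tower Arithmetic ?p 2 we_tower"
    by (simp add: typed_tower_def)
  have "\<exists>X\<in>ne_compacts. ess_num_range A \<subseteq> X \<and> hausdorff_dist X (we_tower [n] A) \<le> 1 / 2 ^ n"
    if "A \<in> \<Omega>" for A n
  proof (intro bexI conjI)
    have A: "A \<in> Omega_B" using \<Omega> that by blast
    show X: "we_tower [n] A \<in> ne_compacts" by (rule we_tower_ne_compact[OF A])
    show "ess_num_range A \<subseteq> we_tower [n] A"
      using ess_num_range_subset[OF A] by (simp add: we_tower_def)
    show "hausdorff_dist (we_tower [n] A) (we_tower [n] A) \<le> 1 / 2 ^ n"
      by (rule hausdorff_dist_le[OF X X]) auto
  qed
  then show ?thesis
    unfolding Pi_Haus_def Delta_def using tt we_computational_problem[OF \<Omega> M]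
    by (auto intro!: exI[of _ "2 :: nat"] exI[of _ we_tower])
qed

section \<open>Spectral pollution is decidable in three limits from below\<close>

text \<open>One stage of the search for a point of pollution.  The conditions on \<open>y\<close> say that \<open>z\<close> has distance
  less than \<open>1 / (n2 + 1)\<close> from the tail range number \<open>n2\<close>; those on \<open>x\<close> approximate the lower bound
  \<open>1 / (n3 + 1)\<close> for the squared norms of \<open>(A - z) x\<close> and of its adjoint counterpart, relaxed by
  \<open>1 / (n2 + 1)\<close> so that they persist at rational points near a point where the lower bound holds.  Everything is written without roots and
  without division by computed quantities.\<close>

definition poll_step :: "op2 \<Rightarrow> (nat \<Rightarrow> complex set) \<Rightarrow> nat \<Rightarrow> nat \<Rightarrow> nat \<Rightarrow> bool" where
  "poll_step A D n3 n2 n1 \<longleftrightarrow> (\<exists>z\<in>D n1.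
     (\<exists>y\<in>int_box n1. 0 < (norm y)\<^sup>2 \<and>
        (cmod (cinner (blinfun_apply A (shift n2 y)) (shift n2 y) - z * of_real ((norm y)\<^sup>2)))\<^sup>2
          * (real (Suc n2))\<^sup>2 < ((norm y)\<^sup>2)\<^sup>2) \<and>
     (\<forall>x\<in>int_box n2. (1 / real (Suc n3) - 1 / real (Suc n2)) * (norm x)\<^sup>2
          \<le> (norm (head n1 (blinfun_apply A x - scaleC z x)))\<^sup>2 \<and>
        (1 / real (Suc n3) - 1 / real (Suc n2)) * (norm x)\<^sup>2
          \<le> (norm (head n1 (blinfun_apply (adj A) x - scaleC (cnj z) x)))\<^sup>2))"

lemma near_tail_value_iff:
  assumes "y \<noteq> 0"
  shows "(cmod (cinner (blinfun_apply A (shift n y)) (shift n y) - z * of_real ((norm y)\<^sup>2)))\<^sup>2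
      * (real (Suc k))\<^sup>2 < ((norm y)\<^sup>2)\<^sup>2 \<longleftrightarrow> dist (tail_value A n y) z < 1 / real (Suc k)"
proof -
  let ?N = "(norm y)\<^sup>2" and ?f = "cinner (blinfun_apply A (shift n y)) (shift n y)"
  have N: "?N > 0" using assms by simp
  have "dist (tail_value A n y) z = cmod (?f / of_real ?N - z)"
    using assms by (simp add: tail_value_def dist_norm)
  also have "?f / of_real ?N - z = (?f - z * of_real ?N) / of_real ?N"
    using N by (simp add: diff_divide_distrib)
  also have "cmod \<dots> = cmod (?f - z * of_real ?N) / ?N"
    by (simp add: norm_divide norm_power)
  finally have dist: "dist (tail_value A n y) z = cmod (?f - z * of_real ?N) / ?N" .
  have "C / N < 1 / K \<longleftrightarrow> C * K < N" if "N > 0" "K > 0" for C N K :: real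
    using that by (simp add: field_simps)
  from this[OF N, of "real (Suc k)"]
  have "dist (tail_value A n y) z < 1 / real (Suc k) \<longleftrightarrow> cmod (?f - z * of_real ?N) * real (Suc k) < ?N"
    unfolding dist by simp
  also have "\<dots> \<longleftrightarrow> (cmod (?f - z * of_real ?N) * real (Suc k))\<^sup>2 < ?N\<^sup>2"
    by (simp only: not_le[symmetric] power_mono_iff[OF zero_le_power2 mult_nonneg_nonneg[OF norm_ge_zero of_nat_0_le_iff] zero_less_numeral])
  finally show ?thesis by (simp add: power_mult_distrib)
qed

lemma shift_shift: "shift m (shift n x) = shift (m + n) x"
  by (rule ell2_eqI) (auto simp: add.commute)

lemma shift_box: "x \<in> int_box n \<Longrightarrow> shift d x \<in> int_box (n + d)"
proof -
  have le: "r \<le> real (n + d)" if "r \<le> real n" for r using that by simp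
  assume "x \<in> int_box n"
  then show ?thesis
    unfolding int_box_def mem_Collect_eq shift.rep_eq by (auto simp del: of_nat_add intro: le)
qed

lemma inverse_Suc_mono: "m \<le> n \<Longrightarrow> 1 / real (Suc n) \<le> 1 / real (Suc m)"
  by (simp add: frac_le)

text \<open>A witness for a later tail serves an earlier one after shifting it, at the cost of a larger box; this is
  why a smaller \<open>n2\<close> may need a larger \<open>n1\<close>.\<close>

lemma poll_step_mono:
  assumes D: "\<And>m n. m \<le> n \<Longrightarrow> D m \<subseteq> D n"
    and le: "m3 \<le> n3" "n2 \<le> m2" "m1 + (m2 - n2) \<le> n1" and step: "poll_step A D m3 m2 m1"
  shows "poll_step A D n3 n2 n1"
proof -
  let ?c = "\<lambda>k2 k3. 1 / real (Suc k3) - 1 / real (Suc k2)"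
  from step obtain z y where z: "z \<in> D m1" and y: "y \<in> int_box m1" "0 < (norm y)\<^sup>2"
    "(cmod (cinner (blinfun_apply A (shift m2 y)) (shift m2 y) - z * of_real ((norm y)\<^sup>2)))\<^sup>2
          * (real (Suc m2))\<^sup>2 < ((norm y)\<^sup>2)\<^sup>2"
    and x: "\<And>x. x \<in> int_box m2 \<Longrightarrow> ?c m2 m3 * (norm x)\<^sup>2 \<le> (norm (head m1 (blinfun_apply A x - scaleC z x)))\<^sup>2"
     "\<And>x. x \<in> int_box m2 \<Longrightarrow> ?c m2 m3 * (norm x)\<^sup>2 \<le> (norm (head m1 (blinfun_apply (adj A) x - scaleC (cnj z) x)))\<^sup>2"
    unfolding poll_step_def by blast
  have c: "?c n2 n3 * (norm x)\<^sup>2 \<le> ?c m2 m3 * (norm x)\<^sup>2" for x :: ell2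
    using inverse_Suc_mono[OF le(1)] inverse_Suc_mono[OF le(2)] by (intro mult_right_mono) auto
  have hd: "(norm (head m1 v))\<^sup>2 \<le> (norm (head n1 v))\<^sup>2" for v
    using le(3) by (intro power_mono norm_head_mono) auto
  show ?thesis unfolding poll_step_def
  proof (intro bexI[of _ z] conjI ballI)
    show "z \<in> D n1" using z D[of m1 n1] le(3) by auto
    have "shift (m2 - n2) y \<in> int_box n1"
      using shift_box[OF y(1), of "m2 - n2"] box_mono[OF le(3)] by blast
    moreover have "(real (Suc n2))\<^sup>2 \<le> (real (Suc m2))\<^sup>2" using le(2) by (intro power_mono) auto
    then have "(cmod (cinner (blinfun_apply A (shift m2 y)) (shift m2 y) - z * of_real ((norm y)\<^sup>2)))\<^sup>2
        * (real (Suc n2))\<^sup>2 < ((norm y)\<^sup>2)\<^sup>2"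
      using y(3) by (meson le_less_trans mult_left_mono zero_le_power2)
    ultimately show "\<exists>y\<in>int_box n1. 0 < (norm y)\<^sup>2 \<and>
        (cmod (cinner (blinfun_apply A (shift n2 y)) (shift n2 y) - z * of_real ((norm y)\<^sup>2)))\<^sup>2
          * (real (Suc n2))\<^sup>2 < ((norm y)\<^sup>2)\<^sup>2"
      using y(2) le(2) by (intro bexI[of _ "shift (m2 - n2) y"]) (simp_all add: shift_shift)
    fix x assume "x \<in> int_box n2"
    then have "x \<in> int_box m2" using box_mono[OF le(2)] by blast
    then show "?c n2 n3 * (norm x)\<^sup>2 \<le> (norm (head n1 (blinfun_apply A x - scaleC z x)))\<^sup>2"
      "?c n2 n3 * (norm x)\<^sup>2 \<le> (norm (head n1 (blinfun_apply (adj A) x - scaleC (cnj z) x)))\<^sup>2"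
      using order_trans[OF c order_trans[OF x(1) hd]] order_trans[OF c order_trans[OF x(2) hd]] by blast+
  qed
qed

text \<open>The inequality is homogeneous and closed, and multiples of integer vectors are dense.\<close>

lemma bounded_below_from_box:
  assumes B: "B \<in> Omega_B" and int_box: "\<And>n x. x \<in> int_box n \<Longrightarrow> e * (norm x)\<^sup>2 \<le> (norm (blinfun_apply B x - scaleC z x))\<^sup>2"
  shows "e * (norm y)\<^sup>2 \<le> (norm (blinfun_apply B y - scaleC z y))\<^sup>2"
proof -
  have "\<exists>m x N. x \<in> int_box m \<and> 0 < N \<and> norm (y - (1 / real N) *\<^sub>R x) < inverse (real (Suc k))" for k
    using box_dense[of "inverse (real (Suc k))" y] by (metis inverse_positive_iff_positive of_nat_0_less_iff zero_less_Suc)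
  then obtain m x N where x: "\<And>k. x k \<in> int_box (m k)" "\<And>k. 0 < N k"
    "\<And>k. norm (y - (1 / real (N k)) *\<^sub>R x k) < inverse (real (Suc k))" by metis
  define v where "v k = (1 / real (N k)) *\<^sub>R x k" for k
  have v: "v \<longlonglongrightarrow> y"
  proof (rule LIM_zero_cancel, rule Lim_null_comparison[OF always_eventually[OF allI]])
    show "norm (v k - y) \<le> inverse (real (Suc k))" for k
      using less_imp_le[OF x(3)[of k]] by (simp add: v_def norm_minus_commute)
  qed (rule LIMSEQ_inverse_real_of_nat)
  let ?T = "B - scalar z"
  have T: "blinfun_apply ?T w = blinfun_apply B w - scaleC z w" for w by (simp add: blinfun.diff_left)
  have "e * (norm (v k))\<^sup>2 \<le> (norm (blinfun_apply ?T (v k)))\<^sup>2" for k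
  proof -
    have "e * (norm (v k))\<^sup>2 = (1 / real (N k))\<^sup>2 * (e * (norm (x k))\<^sup>2)"
      by (simp add: v_def power_mult_distrib power_divide)
    also have "\<dots> \<le> (1 / real (N k))\<^sup>2 * (norm (blinfun_apply ?T (x k)))\<^sup>2"
      unfolding T by (intro mult_left_mono int_box[OF x(1)]) simp
    also have "\<dots> = (norm (blinfun_apply ?T (v k)))\<^sup>2"
      by (simp add: v_def blinfun.scaleR_right power_mult_distrib power_divide)
    finally show ?thesis .
  qed
  moreover have "(\<lambda>k. e * (norm (v k))\<^sup>2) \<longlonglongrightarrow> e * (norm y)\<^sup>2"
    "(\<lambda>k. (norm (blinfun_apply ?T (v k)))\<^sup>2) \<longlonglongrightarrow> (norm (blinfun_apply ?T y))\<^sup>2"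
    by (intro tendsto_intros v)+
  ultimately show ?thesis unfolding T[symmetric] by (meson LIMSEQ_le)
qed

text \<open>The limit over \<open>n2\<close> is a compactness argument: the approximate points \<open>z\<close> accumulate at a point
  of the essential numerical range at which both \<open>A\<close> and its adjoint are bounded below.\<close>

lemma pollution_iff:
  assumes A: "A \<in> Omega_B" and D: "\<And>m n. m \<le> n \<Longrightarrow> D m \<subseteq> D n"
  shows "closure (\<Union>n. D n) \<inter> (ess_num_range A - Sp A) \<noteq> {} \<longleftrightarrow> (\<exists>n3. \<forall>n2. \<exists>n1. poll_step A D n3 n2 n1)"
proof
  assume "\<exists>n3. \<forall>n2. \<exists>n1. poll_step A D n3 n2 n1"
  then obtain n3 where "\<forall>n2. \<exists>n1. poll_step A D n3 n2 n1" by blast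
  then have "\<forall>n2. \<exists>n1 z y. z \<in> D n1 \<and> y \<noteq> 0 \<and> dist (tail_value A n2 y) z < 1 / real (Suc n2) \<and>
     (\<forall>x\<in>int_box n2. (1 / real (Suc n3) - 1 / real (Suc n2)) * (norm x)\<^sup>2
          \<le> (norm (head n1 (blinfun_apply A x - scaleC z x)))\<^sup>2 \<and>
        (1 / real (Suc n3) - 1 / real (Suc n2)) * (norm x)\<^sup>2
          \<le> (norm (head n1 (blinfun_apply (adj A) x - scaleC (cnj z) x)))\<^sup>2)"
    unfolding poll_step_def by (metis near_tail_value_iff norm_zero order_less_irrefl zero_power2)
  then obtain N z y where zy: "\<And>n. z n \<in> D (N n)" "\<And>n. dist (tail_value A n (y n)) (z n) < 1 / real (Suc n)"
    and low: "\<And>n x. x \<in> int_box n \<Longrightarrow> (1 / real (Suc n3) - 1 / real (Suc n)) * (norm x)\<^sup>2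
          \<le> (norm (head (N n) (blinfun_apply A x - scaleC (z n) x)))\<^sup>2"
      "\<And>n x. x \<in> int_box n \<Longrightarrow> (1 / real (Suc n3) - 1 / real (Suc n)) * (norm x)\<^sup>2
          \<le> (norm (head (N n) (blinfun_apply (adj A) x - scaleC (cnj (z n)) x)))\<^sup>2"
    by metis
  define w where "w n = tail_value A n (y n)" for n
  have w: "w n \<in> tail_range A n" for n unfolding w_def by (rule tail_value_in_tail_range[OF A])
  have "z n \<in> cball 0 (norm A + 1)" for n
  proof -
    have "cmod (z n) \<le> cmod (w n) + dist (w n) (z n)"
      using norm_triangle_ineq[of "w n" "z n - w n"] by (simp add: dist_norm norm_minus_commute)
    moreover have "dist (w n) (z n) < 1"
    proof -
      have "1 / real (Suc n) \<le> 1" by simp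
      with zy(2)[of n] show ?thesis unfolding w_def by linarith
    qed
    ultimately show ?thesis using tail_range_bound[OF w, of n] by simp
  qed
  then obtain l r where r: "strict_mono r" "(z \<circ> r) \<longlonglongrightarrow> l"
    using seq_compactE[of "cball 0 (norm A + 1)" z] compact_eq_seq_compact_metric compact_cball by metis
  then have zr: "(\<lambda>k. z (r k)) \<longlonglongrightarrow> l" by (simp add: o_def)
  have ge: "k \<le> r k" for k using r(1) by (rule seq_suble)
  have small: "(\<lambda>k. 1 / real (Suc (r k))) \<longlonglongrightarrow> 0"
    using LIMSEQ_subseq_LIMSEQ[OF LIMSEQ_inverse_real_of_nat r(1)] by (simp add: o_def inverse_eq_divide)
  have "(\<lambda>k. w (r k) - z (r k)) \<longlonglongrightarrow> 0"
    by (rule Lim_null_comparison[OF always_eventually[OF allI] small])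
      (use zy(2) in \<open>simp add: w_def dist_norm less_imp_le\<close>)
  from tendsto_add[OF this zr] have wr: "(\<lambda>k. w (r k)) \<longlonglongrightarrow> l" by simp
  have "l \<in> closure (tail_range A m)" for m
  proof (rule Lim_in_closed_set[OF closed_closure _ _ wr])
    have "w (r k) \<in> closure (tail_range A m)" if "k \<ge> m" for k
      using w[of "r k"] tail_range_antimono[of m "r k" A] ge[of k] that closure_subset by fastforce
    then show "\<forall>\<^sub>F k in sequentially. w (r k) \<in> closure (tail_range A m)"
      unfolding eventually_sequentially by blast
  qed simp
  then have "l \<in> ess_num_range A" by (simp add: ess_num_range_eq[OF A])
  moreover have "l \<in> closure (\<Union>n. D n)"
    unfolding closure_sequential
  proof (intro exI conjI allI)
    show "z (r k) \<in> (\<Union>n. D n)" for k using zy(1)[of "r k"] by blast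
  qed (rule zr)
  moreover have "l \<notin> Sp A"
  proof -
    have lowbox: "1 / real (Suc n3) * (norm x)\<^sup>2 \<le> (norm (blinfun_apply B x - scaleC l' x))\<^sup>2"
      if x: "x \<in> int_box n" and zl: "(\<lambda>k. z' (r k)) \<longlonglongrightarrow> l'"
        and low: "\<And>n x. x \<in> int_box n \<Longrightarrow> (1 / real (Suc n3) - 1 / real (Suc n)) * (norm x)\<^sup>2
          \<le> (norm (head (N n) (blinfun_apply B x - scaleC (z' n) x)))\<^sup>2"
      for n x B z' l'
    proof -
      have "(1 / real (Suc n3) - 1 / real (Suc (r k))) * (norm x)\<^sup>2 \<le> (norm (blinfun_apply B x - scaleC (z' (r k)) x))\<^sup>2"
        if "k \<ge> n" for k
      proof -
        have "x \<in> int_box (r k)" using x box_mono[of n "r k"] ge[of k] that by auto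
        from order_trans[OF low[OF this] power_mono[OF norm_head_le norm_ge_zero]] show ?thesis .
      qed
      moreover have "(\<lambda>k. (1 / real (Suc n3) - 1 / real (Suc (r k))) * (norm x)\<^sup>2) \<longlonglongrightarrow> (1 / real (Suc n3) - 0) * (norm x)\<^sup>2"
        by (intro tendsto_intros small)
      moreover have "(\<lambda>k. (norm (blinfun_apply B x - scaleC (z' (r k)) x))\<^sup>2) \<longlonglongrightarrow> (norm (blinfun_apply B x - scaleC l' x))\<^sup>2"
      proof -
        have "bounded_linear (\<lambda>c. scaleC c x)"
          by (rule bounded_linear_intro[where K = "norm x"])
            (auto simp: scaleC_distribs scaleR_eq_scaleC scaleR_conv_of_real)
        then show ?thesis by (intro tendsto_intros bounded_linear.tendsto[of "\<lambda>c. scaleC c x"] zl)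
      qed
      ultimately have "(1 / real (Suc n3) - 0) * (norm x)\<^sup>2 \<le> (norm (blinfun_apply B x - scaleC l' x))\<^sup>2"
        by (intro LIMSEQ_le[of "\<lambda>k. (1 / real (Suc n3) - 1 / real (Suc (r k))) * (norm x)\<^sup>2"]) blast+
      then show ?thesis by simp
    qed
    have "1 / real (Suc n3) * (norm x)\<^sup>2 \<le> (norm (blinfun_apply A x - scaleC l x))\<^sup>2" for x
      by (rule bounded_below_from_box[OF A]) (rule lowbox[OF _ zr low(1)])
    moreover have "1 / real (Suc n3) * (norm x)\<^sup>2 \<le> (norm (blinfun_apply (adj A) x - scaleC (cnj l) x))\<^sup>2" for x
      by (rule bounded_below_from_box[OF adj(1)[OF A]])
        (rule lowbox[OF _ tendsto_cnj[OF zr] low(2)])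
    ultimately show ?thesis unfolding not_in_Sp_iff[OF A]
      by (intro exI[of _ "1 / real (Suc n3)"]) auto
  qed
  ultimately show "closure (\<Union>n. D n) \<inter> (ess_num_range A - Sp A) \<noteq> {}" by blast
next
  assume "closure (\<Union>n. D n) \<inter> (ess_num_range A - Sp A) \<noteq> {}"
  then obtain l where l: "l \<in> closure (\<Union>n. D n)" "l \<in> ess_num_range A" "l \<notin> Sp A" by blast
  obtain e where e: "e > 0" "\<And>x. e * (norm x)\<^sup>2 \<le> (norm (blinfun_apply A x - scaleC l x))\<^sup>2"
    "\<And>x. e * (norm x)\<^sup>2 \<le> (norm (blinfun_apply (adj A) x - scaleC (cnj l) x))\<^sup>2"
    using l(3) unfolding not_in_Sp_iff[OF A] by blast
  obtain n3 where "inverse (real (Suc n3)) < e" using reals_Archimedean[OF e(1)] by blast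
  then have n3: "1 / real (Suc n3) \<le> e" by (simp add: inverse_eq_divide)
  have "\<exists>n1. poll_step A D n3 n2 n1" for n2
  proof -
    let ?c = "1 / real (Suc n3) - 1 / real (Suc n2)" and ?d = "1 / real (Suc n2)"
    define f where "f B x z = (norm (blinfun_apply B x - scaleC z x))\<^sup>2" for B :: op2 and x z
    have strict: "?c * (norm x)\<^sup>2 < f B x l'" if "x \<noteq> 0" "e * (norm x)\<^sup>2 \<le> f B x l'" for B x l'
    proof -
      have "?c * (norm x)\<^sup>2 < e * (norm x)\<^sup>2"
      proof (rule mult_strict_right_mono)
        have "0 < ?d" by simp
        then show "?c < e" using n3 by linarith
      qed (use that in simp)
      then show ?thesis using that(2) by (rule less_le_trans)
    qed
    have cont: "isCont (\<lambda>z. f B x z) l'" for B x l'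
    proof -
      have "bounded_linear (\<lambda>c. scaleC c x)"
        by (rule bounded_linear_intro[where K = "norm x"])
          (auto simp: scaleC_distribs scaleR_eq_scaleC scaleR_conv_of_real)
      then have "isCont (\<lambda>z. scaleC z x) l'" by (rule linear_continuous_at)
      then show ?thesis unfolding f_def by (intro continuous_intros)
    qed
    have ev1: "eventually (\<lambda>z. ?c * (norm x)\<^sup>2 < f A x z \<and> ?c * (norm x)\<^sup>2 < f (adj A) x (cnj z)) (nhds l)"
      if "x \<noteq> 0" for x
    proof (rule eventually_conj)
      show "eventually (\<lambda>z. ?c * (norm x)\<^sup>2 < f A x z) (nhds l)"
        using order_tendstoD(1)[OF cont[of l A x, unfolded isCont_def continuous_within, THEN tendsto_at_iff_tendsto_nhds[THEN iffD1]]]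
          strict[OF that, where B = A and l' = l] e(2) by (simp add: f_def)
      have "isCont (\<lambda>z. f (adj A) x (cnj z)) l"
        by (rule isCont_o2[OF _ cont]) (intro continuous_intros)
      from order_tendstoD(1)[OF this[unfolded isCont_def continuous_within, THEN tendsto_at_iff_tendsto_nhds[THEN iffD1]]]
      show "eventually (\<lambda>z. ?c * (norm x)\<^sup>2 < f (adj A) x (cnj z)) (nhds l)"
        using strict[OF that, where B = "adj A" and l' = "cnj l"] e(3) by (simp add: f_def)
    qed
    \<comment> \<open>Only finitely many \<open>x\<close> are tested, so one neighbourhood of \<open>l\<close> serves all of them.\<close>
    have "eventually (\<lambda>z. \<forall>x\<in>int_box n2 - {0}. ?c * (norm x)\<^sup>2 < f A x z \<and> ?c * (norm x)\<^sup>2 < f (adj A) x (cnj z)) (nhds l)"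
      using finite_box[of n2] ev1 by (intro eventually_ball_finite) auto
    then obtain \<delta> where \<delta>: "\<delta> > 0" "\<And>z x. dist z l < \<delta> \<Longrightarrow> x \<in> int_box n2 - {0} \<Longrightarrow>
        ?c * (norm x)\<^sup>2 < f A x z \<and> ?c * (norm x)\<^sup>2 < f (adj A) x (cnj z)"
      unfolding eventually_nhds_metric by blast
    have "min \<delta> (?d / 3) > 0" using \<delta>(1) by simp
    then obtain z where z: "z \<in> (\<Union>n. D n)" "dist z l < min \<delta> (?d / 3)"
      using l(1) unfolding closure_approachable by blast
    have "l \<in> closure (tail_range A n2)" using ess_num_range_subset[OF A] l(2) by blast
    then obtain v where v: "v \<in> tail_range A n2" "dist v l < ?d / 3"
      unfolding closure_approachable by (metis divide_pos_pos of_nat_0_less_iff zero_less_Suc zero_less_numeral zero_less_one)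
    have "?d / 3 > 0" by simp
    then obtain m y where y: "y \<in> int_box m" "y \<noteq> 0" "dist (tail_value A n2 y) v < ?d / 3"
      by (rule tail_value_dense[OF A v(1)])
    have near: "dist (tail_value A n2 y) z < ?d"
    proof -
      have "dist (tail_value A n2 y) z \<le> dist (tail_value A n2 y) v + (dist v l + dist z l)"
        by (metis dist_triangle dist_triangle2 add_left_mono order_trans)
      moreover have "t < d" if "t \<le> a + (b + c)" "a < d / 3" "b < d / 3" "c < min \<delta> (d / 3)"
        for t a b c d :: real
        using that by simp
      ultimately show ?thesis using y(3) v(2) z(2) by blast
    qed
    obtain k where k: "z \<in> D k" using z(1) by blast
    have lim: "(\<lambda>n. (norm (head n u))\<^sup>2) \<longlonglongrightarrow> (norm u)\<^sup>2" for u
      by (intro tendsto_intros head_tendsto)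
    have ev2: "eventually (\<lambda>n. ?c * (norm x)\<^sup>2 \<le> (norm (head n (blinfun_apply A x - scaleC z x)))\<^sup>2 \<and>
        ?c * (norm x)\<^sup>2 \<le> (norm (head n (blinfun_apply (adj A) x - scaleC (cnj z) x)))\<^sup>2) sequentially"
      if "x \<in> int_box n2" for x
    proof (cases "x = 0")
      case False
      then have "?c * (norm x)\<^sup>2 < (norm (blinfun_apply A x - scaleC z x))\<^sup>2"
        "?c * (norm x)\<^sup>2 < (norm (blinfun_apply (adj A) x - scaleC (cnj z) x))\<^sup>2"
        using \<delta>(2)[of z x] z(2) that by (auto simp: f_def)
      from order_tendstoD(1)[OF lim this(1)] order_tendstoD(1)[OF lim this(2)] show ?thesis
        by eventually_elim auto
    qed simp
    have "eventually (\<lambda>n. \<forall>x\<in>int_box n2. ?c * (norm x)\<^sup>2 \<le> (norm (head n (blinfun_apply A x - scaleC z x)))\<^sup>2 \<and>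
        ?c * (norm x)\<^sup>2 \<le> (norm (head n (blinfun_apply (adj A) x - scaleC (cnj z) x)))\<^sup>2) sequentially"
      using finite_box[of n2] ev2 by (intro eventually_ball_finite) auto
    then obtain K where K: "\<And>n x. n \<ge> K \<Longrightarrow> x \<in> int_box n2 \<Longrightarrow> ?c * (norm x)\<^sup>2 \<le> (norm (head n (blinfun_apply A x - scaleC z x)))\<^sup>2 \<and>
        ?c * (norm x)\<^sup>2 \<le> (norm (head n (blinfun_apply (adj A) x - scaleC (cnj z) x)))\<^sup>2"
      unfolding eventually_sequentially by blast
    define n1 where "n1 = max K (max k m)"
    have n1: "K \<le> n1" "k \<le> n1" "m \<le> n1" by (auto simp: n1_def)
    have "poll_step A D n3 n2 n1"
      unfolding poll_step_def
    proof (intro bexI[of _ z] conjI bexI[of _ y])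
      show "z \<in> D n1" "y \<in> int_box n1" using D[OF n1(2)] k box_mono[OF n1(3)] y(1) by auto
      show "0 < (norm y)\<^sup>2" using y(2) by simp
      show "(cmod (cinner (blinfun_apply A (shift n2 y)) (shift n2 y) - z * of_real ((norm y)\<^sup>2)))\<^sup>2
          * (real (Suc n2))\<^sup>2 < ((norm y)\<^sup>2)\<^sup>2"
        using near near_tail_value_iff[OF y(2)] by blast
    qed (use K[OF n1(1)] in blast)
    then show ?thesis by blast
  qed
  then show "\<exists>n3. \<forall>n2. \<exists>n1. poll_step A D n3 n2 n1" by blast
qed

text \<open>Every Gaussian rational has this form, and the five parameters can be searched by bounded loops.\<close>

definition point :: "nat \<Rightarrow> nat \<Rightarrow> nat \<Rightarrow> nat \<Rightarrow> nat \<Rightarrow> complex" where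
  "point p p' q q' r = Complex ((real p - real p') / real (Suc r)) ((real q - real q') / real (Suc r))"

text \<open>Infinite endpoints and radii are coded by non-real numbers, hence the conditions on imaginary
  parts.  With a flag for the real problem one machine and one verification serve both problems.\<close>

definition ball_test :: "bool \<Rightarrow> (nat \<Rightarrow> complex) \<Rightarrow> nat \<Rightarrow> complex \<Rightarrow> bool" where
  "ball_test real_case orc m z \<longleftrightarrow>
     (if real_case then Im z = 0 \<and>
        (\<not> Im (orc (3 * m + 1)) = 0 \<or> Re (orc (3 * m + 1)) < Re z) \<and>
        (\<not> Im (orc (3 * m + 2)) = 0 \<or> Re z < Re (orc (3 * m + 2)))
      else \<not> Im (orc (3 * m + 1)) = 0 \<or>
        (cmod (orc (3 * m + 2) - z))\<^sup>2 < (Re (orc (3 * m + 1)))\<^sup>2)"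

definition test_points :: "bool \<Rightarrow> (nat \<Rightarrow> complex) \<Rightarrow> nat \<Rightarrow> complex set" where
  "test_points fl orc n = {z. \<exists>p<n. \<exists>p'<n. \<exists>q<n. \<exists>q'<n. \<exists>r<n. \<exists>m<n.
     z = point p p' q q' r \<and> ball_test fl orc m z}"

text \<open>The next two formulas spell out the conditions of \<open>poll_step\<close> on coded vectors in terms of matrix
  entries.\<close>

definition near_formula :: "nat \<Rightarrow> (nat \<Rightarrow> complex) \<Rightarrow> nat \<Rightarrow> nat \<Rightarrow> complex \<Rightarrow> nat \<Rightarrow> bool" where
  "near_formula c orc s n z t \<longleftrightarrow> 0 < (\<Sum>i<n. (cmod (coord (Suc n) t i))\<^sup>2) \<and>
     (cmod ((\<Sum>i<n. \<Sum>j<n. entry c orc (s + i) (s + j) * coord (Suc n) t j * cnj (coord (Suc n) t i))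
        - z * of_real (\<Sum>i<n. (cmod (coord (Suc n) t i))\<^sup>2)))\<^sup>2 * (real (Suc s))\<^sup>2
     < (\<Sum>i<n. (cmod (coord (Suc n) t i))\<^sup>2)\<^sup>2"

definition below_formula :: "nat \<Rightarrow> (nat \<Rightarrow> complex) \<Rightarrow> nat \<Rightarrow> nat \<Rightarrow> nat \<Rightarrow> complex \<Rightarrow> nat \<Rightarrow> bool" where
  "below_formula c orc n3 n2 n1 z u \<longleftrightarrow>
     (1 / real (Suc n3) - 1 / real (Suc n2)) * (\<Sum>i<n2. (cmod (coord (Suc n2) u i))\<^sup>2)
       \<le> (\<Sum>i<n1. (cmod ((\<Sum>j<n2. entry c orc i j * coord (Suc n2) u j)
            - z * (if real i < real n2 then coord (Suc n2) u i else 0)))\<^sup>2) \<and>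
     (1 / real (Suc n3) - 1 / real (Suc n2)) * (\<Sum>i<n2. (cmod (coord (Suc n2) u i))\<^sup>2)
       \<le> (\<Sum>i<n1. (cmod ((\<Sum>j<n2. cnj (entry c orc j i) * coord (Suc n2) u j)
            - cnj z * (if real i < real n2 then coord (Suc n2) u i else 0)))\<^sup>2)"

definition poll_formula :: "bool \<Rightarrow> nat \<Rightarrow> (nat \<Rightarrow> complex) \<Rightarrow> nat \<Rightarrow> nat \<Rightarrow> nat \<Rightarrow> bool" where
  "poll_formula fl c orc n3 n2 n1 \<longleftrightarrow> (\<exists>p<n1. \<exists>p'<n1. \<exists>q<n1. \<exists>q'<n1. \<exists>r<n1. \<exists>m<n1.
     ball_test fl orc m (point p p' q q' r) \<and>
     (\<exists>t<Suc n1 ^ (4 * n1). near_formula c orc n2 n1 (point p p' q q' r) t) \<and>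
     (\<forall>u<Suc n2 ^ (4 * n2). below_formula c orc n3 n2 n1 (point p p' q q' r) u))"

lemma adj_coords:
  assumes A: "A \<in> Omega_B" and M: "matrix_oracle c orc A"
  shows "ell2_nth (blinfun_apply (adj A) (ell2_basis j)) i = cnj (entry c orc j i)"
proof -
  have "ell2_nth (blinfun_apply (adj A) (ell2_basis j)) i = cinner (blinfun_apply (adj A) (ell2_basis j)) (ell2_basis i)"
    by (simp add: cinner_basis_right)
  also have "\<dots> = cinner (ell2_basis j) (blinfun_apply A (ell2_basis i))" by (simp add: adj(3)[OF A])
  also have "\<dots> = cnj (entry c orc j i)"
    using M by (simp add: cinner_basis_left matrix_oracle_def entry_def)
  finally show ?thesis .
qed

lemma norm_head_residual:
  assumes B: "B \<in> Omega_B" and b: "\<And>i j. ell2_nth (blinfun_apply B (ell2_basis j)) i = b i j"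
  shows "(norm (head k (blinfun_apply B (fin n f) - scaleC z (fin n f))))\<^sup>2
    = (\<Sum>i<k. (cmod ((\<Sum>j<n. b i j * f j) - z * (if real i < real n then f i else 0)))\<^sup>2)"
  unfolding norm_fin_sq Omega_B_fin[OF B] by (simp add: b mult.commute)

lemma poll_formula:
  assumes A: "A \<in> Omega_B" and M: "matrix_oracle c orc A"
  shows "poll_formula fl c orc n3 n2 n1 \<longleftrightarrow> poll_step A (test_points fl orc) n3 n2 n1"
proof -
  have nsq: "(norm (coded n t))\<^sup>2 = (\<Sum>i<n. (cmod (coord (Suc n) t i))\<^sup>2)" for n t
    by (simp add: coded_def norm_fin_sq)
  have near: "near_formula c orc n2 n1 z t \<longleftrightarrow> 0 < (norm (coded n1 t))\<^sup>2 \<and>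
        (cmod (cinner (blinfun_apply A (shift n2 (coded n1 t))) (shift n2 (coded n1 t)) - z * of_real ((norm (coded n1 t))\<^sup>2)))\<^sup>2
          * (real (Suc n2))\<^sup>2 < ((norm (coded n1 t))\<^sup>2)\<^sup>2" for z t
    unfolding near_formula_def nsq using form_fin[OF A M, of n2 n1 "coord (Suc n1) t"] by (simp only: coded_def)
  have below: "below_formula c orc n3 n2 n1 z u \<longleftrightarrow>
        (1 / real (Suc n3) - 1 / real (Suc n2)) * (norm (coded n2 u))\<^sup>2
          \<le> (norm (head n1 (blinfun_apply A (coded n2 u) - scaleC z (coded n2 u))))\<^sup>2 \<and>
        (1 / real (Suc n3) - 1 / real (Suc n2)) * (norm (coded n2 u))\<^sup>2
          \<le> (norm (head n1 (blinfun_apply (adj A) (coded n2 u) - scaleC (cnj z) (coded n2 u))))\<^sup>2" for z u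
  proof -
    have "ell2_nth (blinfun_apply A (ell2_basis j)) i = entry c orc i j" for i j
      using M by (simp add: matrix_oracle_def entry_def)
    from norm_head_residual[OF A this] norm_head_residual[OF adj(1)[OF A] adj_coords[OF A M]]
    show ?thesis unfolding below_formula_def nsq unfolding coded_def by simp
  qed
  show ?thesis
    unfolding poll_formula_def poll_step_def coded_box[symmetric] bex_simps ball_simps near below
    unfolding test_points_def by (auto; blast)
qed

lemma ccomputable_point:
  assumes "computable orc vs (\<lambda>e. real (p e))" "computable orc vs (\<lambda>e. real (p' e))"
    "computable orc vs (\<lambda>e. real (q e))" "computable orc vs (\<lambda>e. real (q' e))"
    "computable orc vs (\<lambda>e. real (r e))"
  shows "ccomputable orc vs (\<lambda>e. point (p e) (p' e) (q e) (q' e) (r e))"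
  unfolding point_def
  by (intro ccomputable_Complex computable_divide computable_diff computable_nat_Suc assms)

lemma decidable_ball_test:
  assumes m: "computable orc vs (\<lambda>e. real (m e))" and z: "ccomputable orc vs z"
  shows "decidable orc vs (\<lambda>e. ball_test fl (orc e) (m e) (z e))"
proof -
  have o: "ccomputable orc vs (\<lambda>e. orc e (3 * m e + k))" for k
    by (intro ccomputable_query computable_nat_add computable_nat_mult computable_nat_const m)
  note o' = o[unfolded ccomputable_def, THEN conjunct1] o[unfolded ccomputable_def, THEN conjunct2]
  note z' = z[unfolded ccomputable_def, THEN conjunct1] z[unfolded ccomputable_def, THEN conjunct2]
  show ?thesis
  proof (cases fl)
    case True
    then show ?thesis unfolding ball_test_def
      by (simp only: if_True) (intro decidable_conj decidable_disj decidable_not decidable_eq decidable_less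
          z' o' computable_const Rats_0)
  next
    case False
    then show ?thesis unfolding ball_test_def
      by (simp only: if_False) (intro decidable_disj decidable_not decidable_eq decidable_less
          computable_cmod2 computable_power2 ccomputable_diff z o o' computable_const Rats_0)
  qed
qed

lemma arguments_3: "arguments 3 = [\<lambda>e. snd e ! 0, \<lambda>e. snd e ! 1, \<lambda>e. snd e ! 2]"
  by (simp add: arguments_def numeral_3_eq_3 numeral_2_eq_2)

lemma decidable_near_formula:
  assumes s: "computable orc vs (\<lambda>e. real (s e))" and n: "computable orc vs (\<lambda>e. real (n e))"
    and z: "ccomputable orc vs z" and t: "computable orc vs (\<lambda>e. real (t e))"
  shows "decidable orc vs (\<lambda>e. near_formula c (orc e) (s e) (n e) (z e) (t e))"
proof -
  note lift1 = s[THEN computable_lift] n[THEN computable_lift] t[THEN computable_lift]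
  have var: "computable orc' (vs' @ [snd]) (\<lambda>p. real (snd p))" for orc' :: "'a \<times> nat \<Rightarrow> _" and vs'
    by (rule computable_var) simp
  have var2: "computable orc' (vs' @ [snd]) (\<lambda>p. real (snd p))" for orc' :: "('a \<times> nat) \<times> nat \<Rightarrow> _" and vs'
    by (rule computable_var) simp
  have nsq: "computable orc vs (\<lambda>e. \<Sum>i<n e. (cmod (coord (Suc (n e)) (t e) i))\<^sup>2)"
    by (intro computable_sum computable_cmod2 ccomputable_coord computable_nat_Suc lift1 n var)
  have form: "ccomputable orc vs (\<lambda>e. \<Sum>i<n e. \<Sum>j<n e. entry c (orc e) (s e + i) (s e + j)
      * coord (Suc (n e)) (t e) j * cnj (coord (Suc (n e)) (t e) i))"
    by (intro ccomputable_sum ccomputable_mult ccomputable_cnj ccomputable_coord ccomputable_entry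
        computable_nat_add computable_nat_Suc n lift1 lift1[THEN computable_lift] var2
        var var[THEN computable_lift])
  show ?thesis unfolding near_formula_def
    by (intro decidable_conj decidable_less computable_mult computable_power2 computable_cmod2
        ccomputable_diff ccomputable_mult ccomputable_of_real computable_nat_Suc nsq form z s
        computable_const Rats_0)
qed

lemma ccomputable_lift:
  "ccomputable orc vs f \<Longrightarrow> ccomputable (\<lambda>p. orc (fst p)) (map (\<lambda>u p. u (fst p)) vs @ [snd]) (\<lambda>p. f (fst p))"
  using computable_lift[of orc vs "\<lambda>e. Re (f e)"] computable_lift[of orc vs "\<lambda>e. Im (f e)"]
  by (simp add: ccomputable_def)

lemma decidable_below_formula:
  assumes n3: "computable orc vs (\<lambda>e. real (n3 e))" and n2: "computable orc vs (\<lambda>e. real (n2 e))"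
    and n1: "computable orc vs (\<lambda>e. real (n1 e))"
    and z: "ccomputable orc vs z" and u: "computable orc vs (\<lambda>e. real (u e))"
  shows "decidable orc vs (\<lambda>e. below_formula c (orc e) (n3 e) (n2 e) (n1 e) (z e) (u e))"
proof -
  note lift1 = n2[THEN computable_lift] u[THEN computable_lift]
  have var: "computable orc' (vs' @ [snd]) (\<lambda>p. real (snd p))" for orc' :: "'a \<times> nat \<Rightarrow> _" and vs'
    by (rule computable_var) simp
  have var2: "computable orc' (vs' @ [snd]) (\<lambda>p. real (snd p))" for orc' :: "('a \<times> nat) \<times> nat \<Rightarrow> _" and vs'
    by (rule computable_var) simp
  have low: "computable orc vs (\<lambda>e. (1 / real (Suc (n3 e)) - 1 / real (Suc (n2 e))) *
      (\<Sum>i<n2 e. (cmod (coord (Suc (n2 e)) (u e) i))\<^sup>2))"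
    by (intro computable_mult computable_diff computable_divide computable_const Rats_1 computable_sum
        computable_cmod2 ccomputable_coord computable_nat_Suc lift1 n3 n2 var)
  have up1: "computable orc vs (\<lambda>e. \<Sum>i<n1 e. (cmod ((\<Sum>j<n2 e. entry c (orc e) i j * coord (Suc (n2 e)) (u e) j)
      - z e * (if real i < real (n2 e) then coord (Suc (n2 e)) (u e) i else 0)))\<^sup>2)"
    by (intro computable_sum computable_cmod2 ccomputable_diff ccomputable_sum ccomputable_mult
        ccomputable_coord ccomputable_entry ccomputable_if_dec decidable_less ccomputable_zero
        computable_nat_Suc n1 ccomputable_lift[OF z] lift1 lift1[THEN computable_lift] var2 var
        var[THEN computable_lift])
  have up2: "computable orc vs (\<lambda>e. \<Sum>i<n1 e. (cmod ((\<Sum>j<n2 e. cnj (entry c (orc e) j i) * coord (Suc (n2 e)) (u e) j)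
      - cnj (z e) * (if real i < real (n2 e) then coord (Suc (n2 e)) (u e) i else 0)))\<^sup>2)"
    by (intro computable_sum computable_cmod2 ccomputable_diff ccomputable_sum ccomputable_mult ccomputable_cnj
        ccomputable_coord ccomputable_entry ccomputable_if_dec decidable_less ccomputable_zero
        computable_nat_Suc n1 ccomputable_lift[OF z] lift1 lift1[THEN computable_lift] var2 var
        var[THEN computable_lift])
  show ?thesis unfolding below_formula_def
    by (intro decidable_conj decidable_le low up1 up2)
qed

lemma poll_program:
  obtains P where "rational_program P"
    "\<And>orc ns. length ns = 3 \<Longrightarrow>
      bss_computes orc P ns [of_nat (of_bool (poll_formula fl c orc (ns ! 0) (ns ! 1) (ns ! 2)))]"
proof -
  have "decidable fst (arguments 3) (\<lambda>e. poll_formula fl c (fst e) (snd e ! 0) (snd e ! 1) (snd e ! 2))"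
    unfolding arguments_3 poll_formula_def
    by (intro decidable_ex decidable_all decidable_conj decidable_ball_test decidable_near_formula
        decidable_below_formula ccomputable_point computable_nat_power computable_nat_mult
        computable_nat_Suc computable_nat_const computable_var) simp_all
  from decision_program[OF this] that show ?thesis by auto
qed

lemma dd_tendsto_zero_iff:
  "(\<lambda>n. discrete_metric.dd (f n) a) \<longlonglongrightarrow> 0 \<longleftrightarrow> (\<exists>N. \<forall>n\<ge>N. f n = a)"
proof
  assume "(\<lambda>n. discrete_metric.dd (f n) a) \<longlonglongrightarrow> 0"
  then have "eventually (\<lambda>n. discrete_metric.dd (f n) a < 1) sequentially"
    by (rule order_tendstoD) simp
  then show "\<exists>N. \<forall>n\<ge>N. f n = a"
    unfolding eventually_sequentially discrete_metric.dd_def by (metis less_irrefl)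
next
  assume "\<exists>N. \<forall>n\<ge>N. f n = a"
  then have "eventually (\<lambda>n. discrete_metric.dd (f n) a = 0) sequentially"
    unfolding eventually_sequentially discrete_metric.dd_def by auto
  then show "(\<lambda>n. discrete_metric.dd (f n) a) \<longlonglongrightarrow> 0" by (rule tendsto_eventually)
qed

lemma dd_increasing:
  assumes "\<And>m n :: nat. m \<le> n \<Longrightarrow> Q m \<Longrightarrow> Q n"
  shows "(\<lambda>n. discrete_metric.dd (of_bool (Q n) :: nat) (of_bool (\<exists>n. Q n))) \<longlonglongrightarrow> 0"
  unfolding dd_tendsto_zero_iff using assms by (cases "\<exists>n. Q n") auto

lemma dd_decreasing:
  assumes "\<And>m n :: nat. m \<le> n \<Longrightarrow> Q n \<Longrightarrow> Q m"
  shows "(\<lambda>n. discrete_metric.dd (of_bool (Q n) :: nat) (of_bool (\<forall>n. Q n))) \<longlonglongrightarrow> 0"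
proof (cases "\<forall>n. Q n")
  case False
  then obtain N where "\<not> Q N" by blast
  then have "\<forall>n\<ge>N. \<not> Q n" using assms by blast
  then show ?thesis unfolding dd_tendsto_zero_iff using False by (intro exI[of _ N]) auto
qed (auto simp: dd_tendsto_zero_iff)

lemma computational_decision_problem:
  assumes "\<And>A. A \<in> I \<Longrightarrow> \<Xi> A \<in> {0, 1}"
    and "\<And>A B. A \<in> I \<Longrightarrow> B \<in> I \<Longrightarrow> (\<And>n. ev n A = ev n B) \<Longrightarrow> A = B"
  shows "computational_problem (decision_problem I ev \<Xi>)"
  using assms by (auto simp: computational_problem_def decision_problem_def metric_M_dd)

text \<open>A decision \<open>\<exists>n3. \<forall>n2. \<exists>n1\<close> about a recursive predicate with the matching monotonicity is the
  limit of its three natural truncations.\<close>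

lemma Sigma_dec_3_I:
  fixes \<phi> :: "'a \<Rightarrow> nat \<Rightarrow> nat \<Rightarrow> nat \<Rightarrow> bool"
  assumes sep: "\<And>A B. A \<in> I \<Longrightarrow> B \<in> I \<Longrightarrow> (\<And>n. ev n A = ev n B) \<Longrightarrow> A = B"
    and target: "\<And>A. A \<in> I \<Longrightarrow> \<Xi> A = of_bool (\<exists>n3. \<forall>n2. \<exists>n1. \<phi> A n3 n2 n1)"
    and mono1: "\<And>A n3 n2 m n. A \<in> I \<Longrightarrow> m \<le> n \<Longrightarrow> \<phi> A n3 n2 m \<Longrightarrow> \<phi> A n3 n2 n"
    and mono2: "\<And>A n3 m n n1. A \<in> I \<Longrightarrow> m \<le> n \<Longrightarrow> \<phi> A n3 n n1 \<Longrightarrow> \<exists>k. \<phi> A n3 m k"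
    and mono3: "\<And>A m n n2 n1. A \<in> I \<Longrightarrow> m \<le> n \<Longrightarrow> \<phi> A m n2 n1 \<Longrightarrow> \<phi> A n n2 n1"
    and P: "rational_program P"
    and run: "\<And>A ns. A \<in> I \<Longrightarrow> length ns = 3 \<Longrightarrow>
      bss_computes (\<lambda>i. ev i A) P ns [of_nat (of_bool (\<phi> A (ns ! 0) (ns ! 1) (ns ! 2)))]"
  shows "decision_problem I ev \<Xi> \<in> Sigma_dec Arithmetic 3"
proof -
  let ?p = "decision_problem I ev \<Xi>"
  have p [simp]: "inputs ?p = I" "evals ?p = ev" "outs ?p = {0, 1}" "odist ?p = discrete_metric.dd"
    "encodes ?p = (\<lambda>out b. out = [of_nat b])" "target ?p = \<Xi>"
    by (simp_all add: decision_problem_def)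
  define \<Gamma> :: "nat list \<Rightarrow> 'a \<Rightarrow> nat" where
    "\<Gamma> ns A = of_bool (case ns of [] \<Rightarrow> \<exists>n3. \<forall>n2. \<exists>n1. \<phi> A n3 n2 n1
       | [n3] \<Rightarrow> \<forall>n2. \<exists>n1. \<phi> A n3 n2 n1 | [n3, n2] \<Rightarrow> \<exists>n1. \<phi> A n3 n2 n1
       | n3 # n2 # n1 # _ \<Rightarrow> \<phi> A n3 n2 n1)" for ns A
  have outs: "\<Gamma> ns \<in> I \<rightarrow> {0, 1}" for ns by (simp add: \<Gamma>_def)
  have ex: "executes ?p 3 \<Gamma> P A" if A: "A \<in> I" for A
    unfolding executes_def p
  proof (intro allI impI exI conjI)
    fix ns :: "nat list" assume ns: "length ns = 3"
    then obtain n3 n2 n1 where "ns = [n3, n2, n1]"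
      by (auto simp: numeral_3_eq_3 length_Suc_conv)
    then have "\<Gamma> ns A = of_bool (\<phi> A (ns ! 0) (ns ! 1) (ns ! 2))" by (simp add: \<Gamma>_def)
    then show "bss_computes (\<lambda>i. ev i A) P ns [of_nat (\<Gamma> ns A)]" using run[OF A ns] by simp
  qed (rule refl)
  have lim: "(\<lambda>n. discrete_metric.dd (\<Gamma> (ns @ [n]) A) (\<Gamma> ns A)) \<longlonglongrightarrow> 0"
    if A: "A \<in> I" and ns: "length ns < 3" for A ns
  proof -
    consider "ns = []" | n3 where "ns = [n3]" | n3 n2 where "ns = [n3, n2]"
      using ns by (auto simp: numeral_3_eq_3 less_Suc_eq length_Suc_conv)
    then show ?thesis
    proof cases
      case 1
      show ?thesis unfolding 1 \<Gamma>_def append.simps list.case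
        by (rule dd_increasing) (use mono3[OF A] in blast)
    next
      case 2
      show ?thesis unfolding 2 \<Gamma>_def append.simps list.case
        by (rule dd_decreasing) (use mono2[OF A] in blast)
    next
      case 3
      show ?thesis unfolding 3 \<Gamma>_def append.simps list.case
        by (rule dd_increasing) (use mono1[OF A] in blast)
    qed
  qed
  have "tower ?p 3 \<Gamma>"
    unfolding tower_def
  proof (intro conjI allI impI ballI)
    show "\<Gamma> [] A = target ?p A" if "A \<in> inputs ?p" for A using target that by (simp add: \<Gamma>_def)
    show "\<Gamma> ns \<in> inputs ?p \<rightarrow> outs ?p" for ns using outs by simp
    show "(\<lambda>n. odist ?p (\<Gamma> (ns @ [n]) A) (\<Gamma> ns A)) \<longlonglongrightarrow> 0"
      if "length ns < 3" "A \<in> inputs ?p" for ns A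
      using lim that by simp
    show "general_algorithm ?p (\<Gamma> ns)" if "length ns = 3" for ns
      by (rule executed_general_algorithm[where P = P and k = 3]) (use that ex outs in auto)
  qed
  moreover have "recursive_tower ?p 3 \<Gamma>"
    unfolding recursive_tower_def using ex P by auto
  ultimately have tt: "typed_tower Arithmetic ?p 3 \<Gamma>" by (simp add: typed_tower_def)
  have "computational_problem ?p"
    by (rule computational_decision_problem) (auto simp: target intro: sep)
  moreover have "\<Gamma> [n] A \<le> \<Xi> A" if "A \<in> I" for A n
    using target[OF that] by (auto simp: \<Gamma>_def)
  ultimately show ?thesis
    unfolding Sigma_dec_def Delta_def using tt by (auto intro!: exI[of _ "3 :: nat"] exI[of _ \<Gamma>])
qed

text \<open>The common part of the real and the complex problem: all that matters about the balls is that
  their rational points, as found by the test, are dense in the closure of their union.\<close>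

lemma poll_in_Sigma:
  fixes ev :: "nat \<Rightarrow> op2 \<times> 'u \<Rightarrow> complex"
  assumes I: "I \<subseteq> Omega_B \<times> UNIV"
    and M: "\<And>A U. matrix_oracle c (\<lambda>n. ev n (A, U)) A"
    and sep: "\<And>A U V. (A, U) \<in> I \<Longrightarrow> (A, V) \<in> I \<Longrightarrow> (\<And>n. ev n (A, U) = ev n (A, V)) \<Longrightarrow> U = V"
    and target: "\<And>A U. (A, U) \<in> I \<Longrightarrow> \<Xi> (A, U) =
      (if closure (\<Union>n. test_points fl (\<lambda>i. ev i (A, U)) n) \<inter> (ess_num_range A - Sp A) \<noteq> {} then 1 else 0)"
  shows "decision_problem I ev \<Xi> \<in> Sigma_dec Arithmetic 3"
proof -
  let ?\<phi> = "\<lambda>x n3 n2 n1. poll_step (fst x) (test_points fl (\<lambda>i. ev i x)) n3 n2 n1"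
  have D: "test_points fl orc m \<subseteq> test_points fl orc n" if "m \<le> n" for orc m n
  proof
    fix z assume "z \<in> test_points fl orc m"
    then obtain p p' q q' r k where lt: "p < m" "p' < m" "q < m" "q' < m" "r < m" "k < m"
      and z: "z = point p p' q q' r \<and> ball_test fl orc k z"
      unfolding test_points_def by blast
    show "z \<in> test_points fl orc n"
      unfolding test_points_def mem_Collect_eq
      by (rule exI[of _ p], rule conjI[OF order_less_le_trans[OF lt(1) that]],
          rule exI[of _ p'], rule conjI[OF order_less_le_trans[OF lt(2) that]],
          rule exI[of _ q], rule conjI[OF order_less_le_trans[OF lt(3) that]],
          rule exI[of _ q'], rule conjI[OF order_less_le_trans[OF lt(4) that]],
          rule exI[of _ r], rule conjI[OF order_less_le_trans[OF lt(5) that]],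
          rule exI[of _ k], rule conjI[OF order_less_le_trans[OF lt(6) that]], rule z)
  qed
  obtain P where P: "rational_program P" "\<And>orc ns. length ns = 3 \<Longrightarrow>
      bss_computes orc P ns [of_nat (of_bool (poll_formula fl c orc (ns ! 0) (ns ! 1) (ns ! 2)))]"
    using poll_program by blast
  show ?thesis
  proof (rule Sigma_dec_3_I[where \<phi> = ?\<phi> and P = P])
    fix x y assume x: "x \<in> I" and y: "y \<in> I" and eq: "\<And>n. ev n x = ev n y"
    obtain A U B V where xy: "x = (A, U)" "y = (B, V)" by fastforce
    have "A = B"
    proof (rule eval_separates)
      show "matrix_oracle c (\<lambda>n. ev n (A, U)) A" by (rule M)
      show "matrix_oracle c (\<lambda>n. ev n (A, U)) B" using M[of B V] eq by (simp add: xy)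
    qed (use I x y xy in auto)
    then show "x = y" using sep[of A U V] x y eq by (simp add: xy)
  next
    fix x assume x: "x \<in> I"
    obtain A U where AU: "x = (A, U)" by fastforce
    then have "A \<in> Omega_B" using I x by blast
    from pollution_iff[OF this D] show "\<Xi> x = of_bool (\<exists>n3. \<forall>n2. \<exists>n1. ?\<phi> x n3 n2 n1)"
      using target[of A U] x unfolding AU fst_conv by simp
  next
    fix x n3 n2 and m n :: nat assume "m \<le> n" and step: "?\<phi> x n3 n2 m"
    then show "?\<phi> x n3 n2 n"
      by (intro poll_step_mono[OF D _ _ _ step]) simp_all
  next
    fix x n3 n1 and m n :: nat assume "m \<le> n" and step: "?\<phi> x n3 n n1"
    then have "?\<phi> x n3 m (n1 + (n - m))" by (intro poll_step_mono[OF D _ _ _ step]) simp_all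
    then show "\<exists>k. ?\<phi> x n3 m k" by blast
  next
    fix x n2 n1 and m n :: nat assume "m \<le> n" and step: "?\<phi> x m n2 n1"
    then show "?\<phi> x n n2 n1" by (intro poll_step_mono[OF D _ _ _ step]) simp_all
  next
    fix x and ns :: "nat list" assume x: "x \<in> I" and ns: "length ns = 3"
    obtain A U where AU: "x = (A, U)" by fastforce
    then have "A \<in> Omega_B" using I x by blast
    from poll_formula[OF this M[of A U], of fl]
    show "bss_computes (\<lambda>i. ev i x) P ns [of_nat (of_bool (?\<phi> x (ns ! 0) (ns ! 1) (ns ! 2)))]"
      using P(2)[OF ns, of "\<lambda>i. ev i x"] unfolding AU fst_conv by simp
  qed (rule P(1))
qed

lemma point_surj:
  assumes "x \<in> \<rat>" "y \<in> \<rat>"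
  obtains p p' q q' r where "point p p' q q' r = Complex x y"
proof -
  obtain a b where x: "x = real_of_int a / real_of_int b" "b > 0"
    using assms(1) by (metis Rats_cases' )
  obtain a' b' where y: "y = real_of_int a' / real_of_int b'" "b' > 0"
    using assms(2) by (metis Rats_cases')
  define r where "r = nat (b * b') - 1"
  have bb: "b * b' > 0" using x(2) y(2) by simp
  then have r: "real (Suc r) = real_of_int (b * b')"
    unfolding r_def by (simp add: Suc_nat_eq_nat_zadd1 of_nat_diff)
  have diff: "real (nat k) - real (nat (- k)) = real_of_int k" for k by (cases "k \<ge> 0") auto
  have "point (nat (a * b')) (nat (- (a * b'))) (nat (a' * b)) (nat (- (a' * b))) r = Complex x y"
    unfolding point_def r diff using x y by (simp add: field_simps)
  then show ?thesis by (rule that)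
qed

lemma point_rational: "Re (point p p' q q' r) \<in> \<rat>" "Im (point p p' q q' r) \<in> \<rat>"
  by (simp_all add: point_def)

lemma UN_test_points:
  "(\<Union>n. test_points fl orc n) = {z \<in> gauss_rat. \<exists>m. ball_test fl orc m z}"
proof (intro subset_antisym subsetI)
  fix z assume "z \<in> (\<Union>n. test_points fl orc n)"
  then show "z \<in> {z \<in> gauss_rat. \<exists>m. ball_test fl orc m z}"
    by (auto simp: test_points_def gauss_rat_def point_rational)
next
  fix z assume "z \<in> {z \<in> gauss_rat. \<exists>m. ball_test fl orc m z}"
  then obtain m where m: "ball_test fl orc m z" "Re z \<in> \<rat>" "Im z \<in> \<rat>" by (auto simp: gauss_rat_def)
  obtain p p' q q' r where "point p p' q q' r = Complex (Re z) (Im z)" using point_surj[OF m(2,3)] .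
  then have pt: "z = point p p' q q' r" by simp
  have "z \<in> test_points fl orc (Suc (p + p' + q + q' + r + m))"
    unfolding test_points_def mem_Collect_eq
    by (intro exI[of _ p] exI[of _ p'] exI[of _ q] exI[of _ q'] exI[of _ r] exI[of _ m] conjI pt m(1))
      (simp_all only: less_Suc_eq_le le_add1 le_add2 trans_le_add1)
  then show "z \<in> (\<Union>n. test_points fl orc n)" by blast
qed

lemma gauss_rat_dense:
  assumes "e > 0" obtains q where "q \<in> gauss_rat" "dist q z < e"
proof -
  obtain a where a: "a \<in> \<rat>" "Re z < a" "a < Re z + e / 2" using Rats_dense_in_real[of "Re z" "Re z + e / 2"] assms by auto
  obtain b where b: "b \<in> \<rat>" "Im z < b" "b < Im z + e / 2" using Rats_dense_in_real[of "Im z" "Im z + e / 2"] assms by auto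
  have "cmod (Complex a b - z) \<le> \<bar>a - Re z\<bar> + \<bar>b - Im z\<bar>"
    using cmod_le[of "Complex a b - z"] by simp
  also have "\<dots> < e" using a b by simp
  finally show ?thesis using that[of "Complex a b"] a b by (simp add: gauss_rat_def dist_norm)
qed

text \<open>The union of the balls is open, so its rational points are dense in it.\<close>

lemma closure_complex_test:
  assumes U: "U \<in> complex_ball_seqs"
    and o: "\<And>m. orc (3 * m + 1) = ereal_code (fst (U m))" "\<And>m. orc (3 * m + 2) = snd (U m)"
  shows "closure (\<Union>n. test_points False orc n) = closure (\<Union>m. complex_ball (U m))"
proof -
  have test: "ball_test False orc m z \<longleftrightarrow> z \<in> complex_ball (U m)" for m z
  proof (cases "fst (U m)")
    case (real r)
    then have "0 < r" using U by (auto simp: complex_ball_seqs_def dest!: spec[of _ m])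
    have "dist (snd (U m)) z < r \<longleftrightarrow> (cmod (snd (U m) - z))\<^sup>2 < r\<^sup>2"
    proof
      assume "dist (snd (U m)) z < r"
      then show "(cmod (snd (U m) - z))\<^sup>2 < r\<^sup>2" unfolding dist_norm by (rule power_strict_mono) auto
    next
      assume "(cmod (snd (U m) - z))\<^sup>2 < r\<^sup>2"
      then show "dist (snd (U m)) z < r"
        unfolding dist_norm using \<open>0 < r\<close> by (rule power2_less_imp_less[OF _ less_imp_le])
    qed
    then show ?thesis unfolding ball_test_def o by (simp add: real complex_ball_def ereal_code_def)
  next
    case PInf
    then show ?thesis unfolding ball_test_def o by (simp add: complex_ball_def ereal_code_def)
  next
    case MInf
    then show ?thesis using U by (auto simp: complex_ball_seqs_def dest!: spec[of _ m])
  qed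
  have op: "open (complex_ball (U m))" for m
  proof (cases "fst (U m)")
    case (real r)
    then have "complex_ball (U m) = ball (snd (U m)) r" by (auto simp: complex_ball_def)
    then show ?thesis by simp
  qed (auto simp: complex_ball_def)
  let ?S = "\<Union>m. complex_ball (U m)"
  have S: "open ?S" using op by blast
  have "(\<Union>n. test_points False orc n) = gauss_rat \<inter> ?S"
    unfolding UN_test_points test by auto
  moreover have "closure (gauss_rat \<inter> ?S) = closure ?S"
  proof (rule subset_antisym)
    show "closure (gauss_rat \<inter> ?S) \<subseteq> closure ?S" by (intro closure_mono) auto
    have "w \<in> closure (gauss_rat \<inter> ?S)" if w: "w \<in> ?S" for w
    proof -
    obtain d where d: "d > 0" "ball w d \<subseteq> ?S" using S w unfolding open_contains_ball by blast
    show ?thesis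
      unfolding closure_approachable
    proof (intro allI impI)
      fix e :: real assume "e > 0"
      then have "min d e > 0" using d(1) by simp
      then obtain q where "q \<in> gauss_rat" "dist q w < min d e" by (rule gauss_rat_dense)
      then show "\<exists>y\<in>gauss_rat \<inter> ?S. dist y w < e"
        using d(2) by (intro bexI[of _ q]) (auto simp: dist_commute subset_iff)
    qed
    qed
    then show "closure ?S \<subseteq> closure (gauss_rat \<inter> ?S)" by (intro closure_minimal subsetI) auto
  qed
  ultimately show ?thesis by simp
qed

lemma closure_real_test:
  assumes U: "U \<in> real_ball_seqs"
    and o: "\<And>m. orc (3 * m + 1) = ereal_code (fst (U m))" "\<And>m. orc (3 * m + 2) = ereal_code (snd (U m))"
  shows "closure (\<Union>n. test_points True orc n) = complex_of_real ` closure (\<Union>m. real_ball (U m))"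
proof -
  have test: "ball_test True orc m z \<longleftrightarrow> Im z = 0 \<and> Re z \<in> real_ball (U m)" for m z
  proof -
    have lt: "fst (U m) < snd (U m)" using U by (auto simp: real_ball_seqs_def)
    have "\<not> Im (orc (3 * m + 1)) = 0 \<or> Re (orc (3 * m + 1)) < Re z \<longleftrightarrow> fst (U m) < ereal (Re z)"
      unfolding o using lt by (cases "fst (U m)") (auto simp: ereal_code_def)
    moreover have "\<not> Im (orc (3 * m + 2)) = 0 \<or> Re z < Re (orc (3 * m + 2)) \<longleftrightarrow> ereal (Re z) < snd (U m)"
      unfolding o using lt by (cases "snd (U m)") (auto simp: ereal_code_def)
    ultimately show ?thesis unfolding ball_test_def if_True by (simp add: real_ball_def)
  qed
  let ?S = "\<Union>m. real_ball (U m)"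
  have op: "open (real_ball (U m))" for m
  proof -
    have "real_ball (U m) = ereal -` {fst (U m)<..<snd (U m)}" by (auto simp: real_ball_def)
    then show ?thesis by (simp add: open_ereal_vimage)
  qed
  then have S: "open ?S" by blast
  have eq: "(\<Union>n. test_points True orc n) = {z \<in> gauss_rat. Im z = 0 \<and> Re z \<in> ?S}"
    unfolding UN_test_points test by auto
  show ?thesis
  proof (intro subset_antisym subsetI)
    have "closed {z. Im z = 0 \<and> Re z \<in> closure ?S}"
      by (intro closed_Collect_conj closed_Collect_eq continuous_intros
          continuous_closed_vimage[of "closure ?S" Re, unfolded vimage_def]) auto
    then have "closure (\<Union>n. test_points True orc n) \<subseteq> {z. Im z = 0 \<and> Re z \<in> closure ?S}"
      unfolding eq using subsetD[OF closure_subset[of ?S]] by (intro closure_minimal) blast+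
    moreover have "z \<in> complex_of_real ` closure ?S" if "Im z = 0 \<and> Re z \<in> closure ?S" for z
      using that by (intro image_eqI[of _ _ "Re z"]) (auto simp: complex_eq_iff)
    ultimately show "z \<in> complex_of_real ` closure ?S" if "z \<in> closure (\<Union>n. test_points True orc n)" for z
      using that by blast
  next
    fix z assume "z \<in> complex_of_real ` closure ?S"
    then obtain x where x: "x \<in> closure ?S" "z = of_real x" by blast
    show "z \<in> closure (\<Union>n. test_points True orc n)"
      unfolding eq closure_approachable
    proof (intro allI impI)
      fix e :: real assume e: "e > 0"
      then obtain y where y: "y \<in> ?S" "dist y x < e / 2"
        using x(1) unfolding closure_approachable by (meson half_gt_zero)
      obtain d where d: "d > 0" "ball y d \<subseteq> ?S" using S y(1) unfolding open_contains_ball by blast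
      have "y < y + min d (e / 2)" using d(1) e by simp
      then obtain q where q: "q \<in> \<rat>" "y < q" "q < y + min d (e / 2)" using Rats_dense_in_real by blast
      have "q \<in> ?S" using q d(2) by (auto simp: subset_iff dist_real_def)
      moreover have "dist (complex_of_real q) z < e"
      proof -
        have "q < y + e / 2" using q(3) by simp
        then show ?thesis using q(2) y(2) unfolding x(2) dist_of_real dist_real_def by linarith
      qed
      ultimately show "\<exists>w\<in>{z \<in> gauss_rat. Im z = 0 \<and> Re z \<in> ?S}. dist w z < e"
        using q(1) by (intro bexI[of _ "complex_of_real q"]) (auto simp: gauss_rat_def)
    qed
  qed
qed

lemma ereal_code_inj: "ereal_code a = ereal_code b \<Longrightarrow> a = b"
  by (cases a; cases b) (auto simp: ereal_code_def complex_eq_iff split: if_splits)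

lemma interleave_simps:
  "interleave f g h (3 * n) = f n" "interleave f g h (3 * n + 1) = g n" "interleave f g h (3 * n + 2) = h n"
proof -
  have "(3 * n + 1) div 3 = n" "(3 * n + 2) div 3 = n" "(3 * n + 1) mod 3 = 1" "(3 * n + 2) mod 3 = 2" by presburger+
  then show "interleave f g h (3 * n) = f n" "interleave f g h (3 * n + 1) = g n" "interleave f g h (3 * n + 2) = h n"
    unfolding interleave_def by (simp_all del: One_nat_def add_2_eq_Suc' Suc_eq_plus1)
qed

lemma real_poll_in_Sigma:
  assumes M: "\<And>A. matrix_oracle c (\<lambda>n. ev n A) A" and U: "\<U> \<subseteq> real_ball_seqs"
  shows "real_poll_problem Omega_SA \<U> ev \<in> Sigma_dec Arithmetic 3"
  unfolding real_poll_problem_def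
proof (rule poll_in_Sigma[where fl = True and c = "3 * c"])
  show "Omega_SA \<times> \<U> \<subseteq> Omega_B \<times> UNIV" by (auto simp: Omega_SA_def)
  show "matrix_oracle (3 * c) (\<lambda>n. real_poll_eval ev n (A, U)) A" for A U
    using M[of A] unfolding matrix_oracle_def real_poll_eval_def mult.assoc interleave_simps by simp
  fix A U assume AU: "(A, U) \<in> Omega_SA \<times> \<U>"
  have o: "real_poll_eval ev (3 * m + 1) (A, U) = ereal_code (fst (U m))"
    "real_poll_eval ev (3 * m + 2) (A, U) = ereal_code (snd (U m))" for A U m
    unfolding real_poll_eval_def interleave_simps by simp_all
  then show "real_poll (A, U) = (if closure (\<Union>n. test_points True (\<lambda>i. real_poll_eval ev i (A, U)) n)
      \<inter> (ess_num_range A - Sp A) \<noteq> {} then 1 else 0)"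
    using AU U by (subst closure_real_test[of U]) (auto simp: real_poll_def)
  fix V assume eq: "\<And>n. real_poll_eval ev n (A, U) = real_poll_eval ev n (A, V)"
  have "fst (U m) = fst (V m)" "snd (U m) = snd (V m)" for m
    using eq[of "3 * m + 1"] eq[of "3 * m + 2"] ereal_code_inj unfolding o by blast+
  then show "U = V" by (auto simp: prod_eq_iff)
qed

lemma complex_poll_in_Sigma:
  assumes M: "\<And>A. matrix_oracle c (\<lambda>n. ev n A) A" and U: "\<U> \<subseteq> complex_ball_seqs"
  shows "complex_poll_problem Omega_B \<U> ev \<in> Sigma_dec Arithmetic 3"
  unfolding complex_poll_problem_def
proof (rule poll_in_Sigma[where fl = False and c = "3 * c"])
  show "Omega_B \<times> \<U> \<subseteq> Omega_B \<times> UNIV" by auto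
  show "matrix_oracle (3 * c) (\<lambda>n. complex_poll_eval ev n (A, U)) A" for A U
    using M[of A] unfolding matrix_oracle_def complex_poll_eval_def mult.assoc interleave_simps by simp
  fix A U assume AU: "(A, U) \<in> Omega_B \<times> \<U>"
  have o: "complex_poll_eval ev (3 * m + 1) (A, U) = ereal_code (fst (U m))"
    "complex_poll_eval ev (3 * m + 2) (A, U) = snd (U m)" for A U m
    unfolding complex_poll_eval_def interleave_simps by simp_all
  then show "complex_poll (A, U) = (if closure (\<Union>n. test_points False (\<lambda>i. complex_poll_eval ev i (A, U)) n)
      \<inter> (ess_num_range A - Sp A) \<noteq> {} then 1 else 0)"
    using AU U by (subst closure_complex_test[of U]) (auto simp: complex_poll_def)
  fix V assume eq: "\<And>n. complex_poll_eval ev n (A, U) = complex_poll_eval ev n (A, V)"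
  have "fst (U m) = fst (V m)" "snd (U m) = snd (V m)" for m
    using eq[of "3 * m + 1"] eq[of "3 * m + 2"] ereal_code_inj unfolding o by blast+
  then show "U = V" by (auto simp: prod_eq_iff)
qed

section \<open>Diagonal operators\<close>

definition diag :: "(nat \<Rightarrow> complex) \<Rightarrow> op2" where
  "diag d = mk_op (\<lambda>x. Abs_ell2 (\<lambda>n. d n * ell2_nth x n))"

lemma diag:
  assumes d: "\<And>n. cmod (d n) \<le> 1"
  shows "ell2_nth (blinfun_apply (diag d) x) n = d n * ell2_nth x n" "diag d \<in> Omega_B"
proof -
  define f where "f = (\<lambda>x. Abs_ell2 (\<lambda>n. d n * ell2_nth x n))"
  have le: "(cmod (d n * ell2_nth x n))\<^sup>2 \<le> (cmod (ell2_nth x n))\<^sup>2" for x n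
    using d[of n] by (intro power_mono) (auto simp: norm_mult mult_left_le_one_le)
  then have s: "summable (\<lambda>n. (cmod (d n * ell2_nth x n))\<^sup>2)" for x
    by (intro summable_comparison_test'[OF summable_cmod_sq[of x]]) auto
  then have nth: "ell2_nth (f x) n = d n * ell2_nth x n" for x n
    unfolding f_def by (subst Abs_ell2_inverse) auto
  have "norm (f x) \<le> 1 * norm x" for x
  proof -
    have "(norm (f x))\<^sup>2 \<le> (norm x)\<^sup>2"
      unfolding norm_sq_suminf nth by (intro suminf_le le s summable_cmod_sq)
    then show ?thesis by (simp add: power2_le_iff_abs_le)
  qed
  moreover have "f (x + y) = f x + f y" "f (scaleC c x) = scaleC c (f x)" for x y c
    by (auto intro!: ell2_eqI simp: nth algebra_simps)
  ultimately have "blinfun_apply (mk_op f) = f" "mk_op f \<in> Omega_B"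
    using mk_op[of f 1] by blast+
  moreover have "diag d = mk_op f" by (simp add: diag_def f_def)
  ultimately show "ell2_nth (blinfun_apply (diag d) x) n = d n * ell2_nth x n" "diag d \<in> Omega_B"
    by (simp_all add: nth)
qed

lemma diag_basis:
  assumes "\<And>n. cmod (d n) \<le> 1"
  shows "blinfun_apply (diag d) (ell2_basis j) = scaleC (d j) (ell2_basis j)"
  by (rule ell2_eqI) (simp add: diag(1)[of d, OF assms])

lemma adj_diag:
  assumes "\<And>n. cmod (d n) \<le> 1" "\<And>n. d n \<in> \<real>"
  shows "adj (diag d) = diag d"
proof (rule adj_eqI)
  fix x y
  have "cnj (d n) = d n" for n using assms(2)[of n] by (simp add: Reals_cnj_iff)
  then show "cinner (blinfun_apply (diag d) x) y = cinner x (blinfun_apply (diag d) y)"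
    unfolding cinner_def diag(1)[of d, OF assms(1)] by (simp add: mult_ac)
qed

lemma diag_SA:
  assumes "\<And>n. cmod (d n) \<le> 1" "\<And>n. d n \<in> \<real>"
  shows "diag d \<in> Omega_SA"
  by (simp add: Omega_SA_def adj_diag[of d, OF assms] diag(2)[of d, OF assms(1)])

text \<open>On vectors supported beyond \<open>M\<close> the operator differs from the scalar \<open>c\<close> by at most \<open>e\<close>.\<close>

lemma ess_num_range_subset_ball:
  assumes d: "\<And>n. cmod (d n) \<le> 1" and near: "\<And>n. n \<ge> M \<Longrightarrow> cmod (d n - c) \<le> e"
  shows "ess_num_range (diag d) \<subseteq> cball c e"
proof -
  have "tail_range (diag d) M \<subseteq> cball c e"
  proof
    fix w assume "w \<in> tail_range (diag d) M"
    then obtain x where x: "norm x = 1" "\<And>i. i < M \<Longrightarrow> ell2_nth x i = 0" "w = cinner (blinfun_apply (diag d) x) x"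
      by (auto simp: tail_range_def)
    let ?y = "blinfun_apply (diag d) x - scaleC c x"
    have e: "e \<ge> 0" using near[of M] norm_ge_zero[of "d M - c"] by (meson order_refl order_trans)
    have nth: "ell2_nth ?y n = (d n - c) * ell2_nth x n" for n by (simp add: diag(1)[of d, OF d] algebra_simps)
    have "(norm ?y)\<^sup>2 \<le> (\<Sum>n. e\<^sup>2 * (cmod (ell2_nth x n))\<^sup>2)"
      unfolding norm_sq_suminf
    proof (intro suminf_le summable_cmod_sq summable_mult)
      fix n
      show "(cmod (ell2_nth ?y n))\<^sup>2 \<le> e\<^sup>2 * (cmod (ell2_nth x n))\<^sup>2"
      proof (cases "n < M")
        case True
        then show ?thesis unfolding nth by (simp add: x(2))
      next
        case False
        then show ?thesis using near[of n] unfolding nth norm_mult power_mult_distrib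
          by (intro mult_right_mono power_mono) auto
      qed
    qed
    also have "\<dots> = e\<^sup>2"
      by (simp add: suminf_mult[OF summable_cmod_sq] norm_sq_suminf[symmetric] x(1))
    finally have "norm ?y \<le> e" using e by (simp add: power2_le_iff_abs_le)
    moreover have "w - c = cinner ?y x"
      by (simp add: x(1,3) cinner_diff_left cinner_scaleC_left cinner_self)
    ultimately have "cmod (w - c) \<le> e" using cauchy_schwarz[of ?y x] x(1) by simp
    then show "w \<in> cball c e" by (simp add: dist_norm norm_minus_commute)
  qed
  then have "closure (tail_range (diag d) M) \<subseteq> cball c e" by (rule closure_minimal) simp
  then show ?thesis using ess_num_range_subset[OF diag(2)[of d, OF d], of M] by blast
qed

lemma ess_num_range_diag_singleton:
  assumes d: "\<And>n. cmod (d n) \<le> 1" and near: "\<And>e. e > 0 \<Longrightarrow> \<exists>M. \<forall>n\<ge>M. cmod (d n - c) \<le> e"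
  shows "ess_num_range (diag d) = {c}"
proof -
  have "z = c" if z: "z \<in> ess_num_range (diag d)" for z
  proof (rule ccontr)
    assume "z \<noteq> c"
    then have "dist c z / 2 > 0" by simp
    then obtain M where "\<And>n. n \<ge> M \<Longrightarrow> cmod (d n - c) \<le> dist c z / 2" using near by blast
    then have "ess_num_range (diag d) \<subseteq> cball c (dist c z / 2)"
      by (intro ess_num_range_subset_ball[of d, OF d]) auto
    then have "dist c z \<le> dist c z / 2" using z by auto
    then show False using \<open>z \<noteq> c\<close> by simp
  qed
  then show ?thesis using ess_num_range_ne_compact[OF diag(2)[of d, OF d]] unfolding ne_compacts_def by blast
qed

text \<open>These operators carry the lower bounds: each evaluation of them depends on finitely many bits
  of \<open>a\<close>.\<close>

definition switched :: "(nat \<Rightarrow> real) \<Rightarrow> (nat \<Rightarrow> bool) \<Rightarrow> op2" where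
  "switched w a = diag (\<lambda>n. of_real (of_bool (a n) * w n))"

definition agree :: "nat \<Rightarrow> (nat \<Rightarrow> 'b) \<Rightarrow> (nat \<Rightarrow> 'b) \<Rightarrow> bool" where
  "agree l a b \<longleftrightarrow> (\<forall>i<l. a i = b i)"

lemma agree_trans: "agree l a b \<Longrightarrow> agree l b c \<Longrightarrow> agree l a c"
  by (simp add: agree_def)

lemma agree_less: "k \<le> l \<Longrightarrow> agree l a b \<Longrightarrow> agree k a b"
  by (simp add: agree_def)

lemma agree_limit:
  assumes step: "\<And>k :: nat. agree (l k) (a k) (a (Suc k))" and l: "\<And>k. l k < l (Suc k)"
  obtains x where "\<And>k. agree (l k) (a k) x"
proof -
  have mono: "l m \<le> l n" if "m \<le> n" for m n
    using that by (induction n rule: dec_induct) (use l in \<open>auto intro: order_trans less_imp_le\<close>)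
  have ge: "k \<le> l k" for k
  proof (induction k)
    case (Suc k)
    then show ?case using l[of k] by simp
  qed simp
  have later: "agree (l m) (a m) (a n)" if "m \<le> n" for m n
    using that
  proof (induction n rule: dec_induct)
    case (step n)
    then show ?case using assms(1)[of n] mono[of m n] by (auto intro: agree_trans agree_less)
  qed (simp add: agree_def)
  have "agree (l k) (a k) (\<lambda>i. a (Suc i) i)" for k
    unfolding agree_def
  proof (intro allI impI)
    fix i assume i: "i < l k"
    have "i < l (Suc i)" using ge[of "Suc i"] by simp
    show "a k i = a (Suc i) i"
    proof (cases "k \<le> Suc i")
      case True
      from later[OF this] i show ?thesis unfolding agree_def by blast
    next
      case False
      then have "agree (l (Suc i)) (a (Suc i)) (a k)" by (intro later) simp
      with \<open>i < l (Suc i)\<close> show ?thesis unfolding agree_def by simp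
    qed
  qed
  then show ?thesis by (rule that)
qed

context
  fixes w :: "nat \<Rightarrow> real"
  assumes w: "\<And>n. 0 \<le> w n" "\<And>n. w n \<le> 1"
begin

lemma switched_le: "cmod (of_real (of_bool (a n) * w n)) \<le> 1"
  using w[of n] by (simp only: norm_of_real) simp

lemma switched_SA: "switched w a \<in> Omega_SA"
  unfolding switched_def by (intro diag_SA switched_le) simp

lemma switched_basis:
  "blinfun_apply (switched w a) (ell2_basis j) = scaleC (of_real (of_bool (a j) * w j)) (ell2_basis j)"
  unfolding switched_def by (rule diag_basis) (rule switched_le)

lemma switched_eval:
  assumes "ev \<in> {eval_1, eval_2}"
  shows "\<exists>N. \<forall>a b. agree N a b \<longrightarrow> ev n (switched w a) = ev n (switched w b)"
proof -
  have adj: "adj (switched w a) = switched w a" for a using switched_SA[of a] by (simp add: Omega_SA_def)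
  have "ev n \<in> Lambda_2"
  proof (cases "ev = eval_1")
    case True
    have "eval_1 n \<in> Lambda_1" using rangeI[of eval_1 n] unfolding range_eval_1 .
    then show ?thesis unfolding True Lambda_2_def by blast
  next
    case False
    then show ?thesis using assms rangeI[of eval_2 n] unfolding range_eval_2 by blast
  qed
  then consider i j where "ev n = (\<lambda>A. cinner (blinfun_apply A (ell2_basis j)) (ell2_basis i))"
    | i j where "ev n = (\<lambda>A. cinner (blinfun_apply A (ell2_basis j)) (blinfun_apply A (ell2_basis i)))"
    | i j where "ev n = (\<lambda>A. cinner (blinfun_apply (adj A) (ell2_basis j)) (blinfun_apply (adj A) (ell2_basis i)))"
    unfolding Lambda_2_def Lambda_1_def by blast
  then show ?thesis
  proof cases
    case (1 i j)
    show ?thesis unfolding 1 switched_basis by (intro exI[of _ "Suc j"]) (simp add: agree_def)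
  next
    case (2 i j)
    show ?thesis unfolding 2 switched_basis by (intro exI[of _ "Suc (i + j)"]) (simp add: agree_def)
  next
    case (3 i j)
    show ?thesis unfolding 3 adj switched_basis by (intro exI[of _ "Suc (i + j)"]) (simp add: agree_def)
  qed
qed

end


section \<open>Algorithms on sequences of bits\<close>

text \<open>The algorithm consults finitely many evaluations, and each of them depends on finitely many bits.\<close>

lemma general_algorithm_locally_constant:
  assumes alg: "general_algorithm p \<Gamma>" and \<kappa>: "\<And>a. \<kappa> a \<in> inputs p"
    and ev: "\<And>n. \<exists>N. \<forall>a b. agree N a b \<longrightarrow> evals p n (\<kappa> a) = evals p n (\<kappa> b)"
  shows "\<exists>N. \<forall>b. agree N a b \<longrightarrow> \<Gamma> (\<kappa> b) = \<Gamma> (\<kappa> a)"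
proof -
  obtain L where "\<forall>A\<in>inputs p. L A \<noteq> {} \<and> finite (L A) \<and> L A \<subseteq> range (evals p) \<and>
        (\<forall>B\<in>inputs p. (\<forall>h\<in>L A. h B = h A) \<longrightarrow> L B = L A \<and> \<Gamma> B = \<Gamma> A)"
    using alg unfolding general_algorithm_def by blast
  with \<kappa>[of a] have L: "finite (L (\<kappa> a))" "L (\<kappa> a) \<subseteq> range (evals p)"
    "\<And>B. B \<in> inputs p \<Longrightarrow> (\<forall>h\<in>L (\<kappa> a). h B = h (\<kappa> a)) \<Longrightarrow> \<Gamma> B = \<Gamma> (\<kappa> a)" by blast+
  have "\<forall>h\<in>L (\<kappa> a). \<exists>N. \<forall>b. agree N a b \<longrightarrow> h (\<kappa> b) = h (\<kappa> a)"
  proof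
    fix h assume "h \<in> L (\<kappa> a)"
    then obtain n where "h = evals p n" using L(2) by blast
    then show "\<exists>N. \<forall>b. agree N a b \<longrightarrow> h (\<kappa> b) = h (\<kappa> a)" using ev[of n] by metis
  qed
  then obtain N where N: "\<And>h b. h \<in> L (\<kappa> a) \<Longrightarrow> agree (N h) a b \<Longrightarrow> h (\<kappa> b) = h (\<kappa> a)" by metis
  have "\<Gamma> (\<kappa> b) = \<Gamma> (\<kappa> a)" if b: "agree (Max (N ` L (\<kappa> a))) a b" for b
  proof (rule L(3)[OF \<kappa>], rule ballI)
    fix h assume h: "h \<in> L (\<kappa> a)"
    then have "N h \<le> Max (N ` L (\<kappa> a))" using L(1) by simp
    then show "h (\<kappa> b) = h (\<kappa> a)" using N[OF h] agree_less b by blast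
  qed
  then show ?thesis by blast
qed

text \<open>The sequence alternates between blocks of zeros and blocks of ones.  Each block is continued until one
  more map of the required kind has committed itself on the bits chosen so far.\<close>

lemma oscillation:
  fixes P Q :: "nat \<Rightarrow> (nat \<Rightarrow> bool) \<Rightarrow> bool"
  assumes locP: "\<And>n a. P n a \<Longrightarrow> \<exists>N. \<forall>b. agree N a b \<longrightarrow> P n b"
    and locQ: "\<And>n a. Q n a \<Longrightarrow> \<exists>N. \<forall>b. agree N a b \<longrightarrow> Q n b"
    and fin: "\<And>a M. (\<forall>i\<ge>M. \<not> a i) \<Longrightarrow> \<exists>N. \<forall>n\<ge>N. P n a"
    and cof: "\<And>a M. (\<forall>i\<ge>M. a i) \<Longrightarrow> \<exists>N. \<forall>n\<ge>N. Q n a"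
  obtains a where "\<And>N. \<exists>n\<ge>N. P n a" "\<And>N. \<exists>n\<ge>N. Q n a"
proof -
  define good where "good k s t \<longleftrightarrow> snd s < snd t \<and> agree (snd s) (fst s) (fst t) \<and>
    (\<exists>n\<ge>k. \<forall>b. agree (snd t) (fst t) b \<longrightarrow> P n b) \<and> (\<exists>n\<ge>k. \<forall>b. agree (snd t) (fst t) b \<longrightarrow> Q n b)"
    for k :: nat and s t :: "(nat \<Rightarrow> bool) \<times> nat"
  have ex: "\<exists>t. good k s t" for k s
  proof -
    obtain a l where s: "s = (a, l)" by fastforce
    let ?c = "\<lambda>i. i < l \<and> a i"
    have "\<forall>i\<ge>l. \<not> ?c i" by auto
    from fin[OF this] obtain n where n: "n \<ge> k" "P n ?c" by (metis nle_le)
    obtain N where N: "\<And>b. agree N ?c b \<Longrightarrow> P n b" using locP[OF n(2)] by blast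
    let ?l = "max l N"
    let ?d = "\<lambda>i. if i < ?l then ?c i else True"
    have "\<forall>i\<ge>?l. ?d i" by (simp add: max_def)
    from cof[OF this] obtain m where m: "m \<ge> k" "Q m ?d" by (metis nle_le)
    obtain M where M: "\<And>b. agree M ?d b \<Longrightarrow> Q m b" using locQ[OF m(2)] by blast
    have "P n b" if b: "agree (Suc (max ?l M)) ?d b" for b
    proof -
      have "agree N ?c ?d" by (simp add: agree_def less_max_iff_disj)
      moreover have "agree N ?d b" by (rule agree_less[OF _ b]) simp
      ultimately show "P n b" by (rule N[OF agree_trans])
    qed
    moreover have "Q m b" if b: "agree (Suc (max ?l M)) ?d b" for b
      by (rule M) (rule agree_less[OF _ b], simp)
    moreover have "agree l a ?d" by (simp add: agree_def less_max_iff_disj)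
    ultimately have "good k s (?d, Suc (max ?l M))"
      unfolding good_def s fst_conv snd_conv using n(1) m(1) by (intro conjI) (simp, blast+)
    then show ?thesis by blast
  qed
  then obtain nxt where nxt: "\<And>k s. good k s (nxt k s)" by metis
  define f where "f = rec_nat ((\<lambda>_. False), 0) nxt"
  have f: "good k (f k) (f (Suc k))" for k by (simp add: f_def nxt)
  obtain x where x: "\<And>k. agree (snd (f k)) (fst (f k)) x"
    by (rule agree_limit[of "\<lambda>k. snd (f k)" "\<lambda>k. fst (f k)"]) (use f in \<open>auto simp: good_def\<close>)
  have "\<exists>n\<ge>N. P n x" "\<exists>n\<ge>N. Q n x" for N
    using f[of N] x[of "Suc N"] unfolding good_def by blast+
  then show ?thesis by (rule that)
qed

definition bit_column :: "(nat \<Rightarrow> bool) \<Rightarrow> nat \<Rightarrow> nat set" where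
  "bit_column a j = {i. a (prod_encode (j, i))}"

lemma prod_encode_ge_snd: "i \<le> prod_encode (j, i)"
  by (rule le_prod_encode_2)

lemma infinite_columnI:
  assumes "\<And>k. \<exists>i. k \<le> prod_encode (j, i) \<and> a (prod_encode (j, i))"
  shows "infinite (bit_column a j)"
proof
  assume "finite (bit_column a j)"
  then have "finite ((\<lambda>i. prod_encode (j, i)) ` bit_column a j)" by simp
  then obtain k where k: "\<And>i. i \<in> bit_column a j \<Longrightarrow> prod_encode (j, i) < k"
    unfolding finite_nat_set_iff_bounded by auto
  obtain i where i: "k \<le> prod_encode (j, i)" "a (prod_encode (j, i))" using assms by blast
  then show False using k[of i] by (simp add: bit_column_def)
qed

text \<open>A Baire category argument.  In a double limit of locally constant maps, the matrices all of whose
  columns are finite are the union over \<open>N\<close> of the sets of the \<open>x\<close> with \<open>G n x\<close> false for all \<open>n \<ge> N\<close>, each of which is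
  a countable intersection of open sets.  A set of this kind cannot be dense in a set of matrices in which
  column \<open>N\<close> is free, since it would then contain a matrix with column \<open>N\<close> infinite.  So for each
  \<open>N\<close> finitely many bits together with the earlier columns exclude the set number \<open>N\<close>, and a
  matrix with finite columns that satisfies all these conditions is a contradiction.\<close>

lemma infinite_column_not_double_limit:
  fixes \<Gamma> :: "nat \<Rightarrow> nat \<Rightarrow> (nat \<Rightarrow> bool) \<Rightarrow> bool"
  assumes loc: "\<And>n m a. \<exists>N. \<forall>b. agree N a b \<longrightarrow> \<Gamma> n m b = \<Gamma> n m a"
    and lim1: "\<And>n a. \<exists>M. \<forall>m\<ge>M. \<Gamma> n m a = G n a"
    and lim2: "\<And>a. \<exists>N. \<forall>n\<ge>N. G n a = (\<exists>j. infinite (bit_column a j))"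
  shows False
proof -
  define fin where "fin a \<longleftrightarrow> (\<forall>j. finite (bit_column a j))" for a
  define F where "F N a \<longleftrightarrow> (\<forall>n\<ge>N. \<not> G n a)" for N a
  define same where "same N a b \<longleftrightarrow> (\<forall>j<N. \<forall>i. a (prod_encode (j, i)) = b (prod_encode (j, i)))"
    for N and a b :: "nat \<Rightarrow> bool"
  have F_fin: "fin a" if F: "F N a" for N a
  proof -
    obtain M where "\<forall>n\<ge>M. G n a = (\<exists>j. infinite (bit_column a j))" using lim2 by blast
    then have "G (max N M) a = (\<exists>j. infinite (bit_column a j))" by simp
    then show ?thesis using F unfolding F_def fin_def by (metis max.cobounded1)
  qed
  have fin_F: "\<exists>N. F N a" if "fin a" for a
    using lim2[of a] that unfolding F_def fin_def by metis
  have same_trans: "same N a b \<Longrightarrow> same N b c \<Longrightarrow> same N a c" for N a b c by (simp add: same_def)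
  have avoid: "\<exists>b l'. fin b \<and> l < l' \<and> agree l a b \<and> same N a b \<and> (\<forall>c. agree l' b c \<and> same N b c \<longrightarrow> \<not> F N c)"
    if a: "fin a" for a l N
  proof (rule ccontr)
    assume "\<not> (\<exists>b l'. fin b \<and> l < l' \<and> agree l a b \<and> same N a b \<and> (\<forall>c. agree l' b c \<and> same N b c \<longrightarrow> \<not> F N c))"
    then have dense: "\<exists>c. agree l' b c \<and> same N b c \<and> F N c"
      if "fin b" "l < l'" "agree l a b" "same N a b" for b l' using that by blast
    \<comment> \<open>The set \<open>F N\<close> would be dense among these matrices.  Meeting its open conditions one after the
      other while adding bits to column \<open>N\<close> leads to a member of \<open>F N\<close> with column \<open>N\<close> infinite.\<close>
    define inv where "inv s \<longleftrightarrow> fin (fst s) \<and> l < snd s \<and> agree l a (fst s) \<and> same N a (fst s)"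
      for s :: "(nat \<Rightarrow> bool) \<times> nat"
    define good where "good k s t \<longleftrightarrow> snd s < snd t \<and> agree (snd s) (fst s) (fst t) \<and> same N (fst s) (fst t) \<and>
        (\<exists>i. snd s \<le> prod_encode (N, i) \<and> prod_encode (N, i) < snd t \<and> fst t (prod_encode (N, i))) \<and>
        (\<forall>n M. prod_decode k = (n, M) \<longrightarrow> N \<le> n \<longrightarrow> (\<exists>m\<ge>M. \<forall>x. agree (snd t) (fst t) x \<longrightarrow> \<not> \<Gamma> n m x))"
      for k and s t :: "(nat \<Rightarrow> bool) \<times> nat"
    have ex: "\<exists>t. inv t \<and> good k s t" if s: "inv s" for k s
    proof -
      obtain c where c: "agree (snd s) (fst s) c" "same N (fst s) c" "F N c"
        using dense[of "fst s" "snd s"] s unfolding inv_def by blast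
      obtain n M where nM: "prod_decode k = (n, M)" by fastforce
      obtain m where m: "M \<le> m" "\<Gamma> n m c = G n c" using lim1[of n c] by (metis nle_le)
      obtain R where R: "\<And>x. agree R c x \<Longrightarrow> \<Gamma> n m x = \<Gamma> n m c" using loc by blast
      \<comment> \<open>The new bit of column \<open>N\<close> lies beyond everything that has been decided so far.\<close>
      define q where "q = prod_encode (N, max (snd s) R)"
      have q: "snd s \<le> q" "R \<le> q" using prod_encode_ge_snd[of "max (snd s) R" N] by (auto simp: q_def)
      define b where "b = c(q := True)"
      have cb: "agree q c b" by (simp add: agree_def b_def)
      have scb: "same N c b" by (auto simp: same_def b_def q_def)
      have sb: "agree (snd s) (fst s) b" using c(1) agree_less[OF q(1) cb] by (rule agree_trans)
      have "bit_column b j \<subseteq> insert (max (snd s) R) (bit_column c j)" for j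
        by (auto simp: bit_column_def b_def q_def split: if_splits)
      then have "fin b" using F_fin[OF c(3)] unfolding fin_def by (meson finite.insertI finite_subset)
      then have "inv (b, Suc q)"
        using s q(1) sb same_trans[OF _ same_trans[OF c(2) scb]] agree_trans[OF _ agree_less[OF _ sb]]
        unfolding inv_def fst_conv snd_conv by (meson le_SucI less_imp_le order_less_le_trans)
      moreover have "good k s (b, Suc q)"
        unfolding good_def fst_conv snd_conv
      proof (intro conjI allI impI)
        show "snd s < Suc q" using q(1) by simp
        show "agree (snd s) (fst s) b" by (rule sb)
        show "same N (fst s) b" by (rule same_trans[OF c(2) scb])
        show "\<exists>i. snd s \<le> prod_encode (N, i) \<and> prod_encode (N, i) < Suc q \<and> b (prod_encode (N, i))"
          using q(1) by (intro exI[of _ "max (snd s) R"]) (simp add: b_def flip: q_def)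
        fix n' M' assume "prod_decode k = (n', M')" "N \<le> n'"
        then have n': "n' = n" "M' = M" "\<not> G n c" using nM c(3) by (auto simp: F_def)
        have "\<not> \<Gamma> n m x" if x: "agree (Suc q) b x" for x
        proof -
          have "agree R c x"
            by (rule agree_trans[OF agree_less[OF q(2) cb] agree_less[OF _ x]]) (use q(2) in simp)
          then show ?thesis using R m(2) n'(3) by simp
        qed
        then show "\<exists>m\<ge>M'. \<forall>x. agree (Suc q) b x \<longrightarrow> \<not> \<Gamma> n' m x" using m(1) n' by blast
      qed
      ultimately show ?thesis by blast
    qed
    define nxt where "nxt k s = (SOME t. inv t \<and> good k s t)" for k s
    have nxt: "inv (nxt k s) \<and> good k s (nxt k s)" if "inv s" for k s
      unfolding nxt_def by (rule someI_ex) (rule ex[OF that])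
    define f where "f = rec_nat (a, Suc l) nxt"
    have inv: "inv (f k)" for k
    proof (induction k)
      case 0
      then show ?case using a by (simp add: f_def inv_def agree_def same_def)
    next
      case (Suc k)
      then show ?case using nxt by (simp add: f_def)
    qed
    then have f: "good k (f k) (f (Suc k))" for k using nxt[OF inv[of k], of k] by (simp add: f_def)
    have lt: "snd (f k) < snd (f (Suc k))" for k using f[of k] by (simp add: good_def)
    have ge: "k \<le> snd (f k)" for k
    proof (induction k)
      case (Suc k)
      then show ?case using lt[of k] by simp
    qed simp
    obtain x where x: "\<And>k. agree (snd (f k)) (fst (f k)) x"
      by (rule agree_limit[of "\<lambda>k. snd (f k)" "\<lambda>k. fst (f k)"]) (use f in \<open>auto simp: good_def\<close>)
    have "F N x" unfolding F_def
    proof (intro allI impI)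
      fix n assume n: "n \<ge> N"
      obtain M where M: "\<forall>m\<ge>M. \<Gamma> n m x = G n x" using lim1 by blast
      have "prod_decode (prod_encode (n, M)) = (n, M)" by simp
      then obtain m where "m \<ge> M" "\<not> \<Gamma> n m x"
        using f[of "prod_encode (n, M)"] n x[of "Suc (prod_encode (n, M))"] unfolding good_def by blast
      then show "\<not> G n x" using M by simp
    qed
    then have "finite (bit_column x N)" using F_fin by (simp add: fin_def)
    moreover have "infinite (bit_column x N)"
    proof (rule infinite_columnI)
      fix k
      obtain i where i: "snd (f k) \<le> prod_encode (N, i)" "prod_encode (N, i) < snd (f (Suc k))"
        "fst (f (Suc k)) (prod_encode (N, i))"
        using f[of k] unfolding good_def by blast
      have "x (prod_encode (N, i))" using x[of "Suc k"] i(2,3) by (simp add: agree_def)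
      then show "\<exists>i. k \<le> prod_encode (N, i) \<and> x (prod_encode (N, i))"
        using i(1) ge[of k] order_trans by blast
    qed
    ultimately show False by simp
  qed
  define good where "good N s t \<longleftrightarrow> snd s < snd t \<and> agree (snd s) (fst s) (fst t) \<and> same N (fst s) (fst t) \<and>
      (\<forall>c. agree (snd t) (fst t) c \<and> same N (fst t) c \<longrightarrow> \<not> F N c)"
    for N and s t :: "(nat \<Rightarrow> bool) \<times> nat"
  have "\<exists>t. fin (fst t) \<and> good N s t" if "fin (fst s)" for N s
    using avoid[OF that, of "snd s" N] unfolding good_def by (metis fst_conv snd_conv)
  note ex = this
  define nxt where "nxt N s = (SOME t. fin (fst t) \<and> good N s t)" for N s
  have nxt: "fin (fst (nxt N s)) \<and> good N s (nxt N s)" if "fin (fst s)" for N s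
    unfolding nxt_def by (rule someI_ex) (rule ex[OF that])
  define f where "f = rec_nat ((\<lambda>_. False), 0) nxt"
  have fin_f: "fin (fst (f N))" for N
  proof (induction N)
    case 0
    then show ?case by (simp add: f_def fin_def bit_column_def)
  next
    case (Suc N)
    then show ?case using nxt by (simp add: f_def)
  qed
  then have f: "good N (f N) (f (Suc N))" for N using nxt[of "f N" N] by (simp add: f_def)
  have lt: "snd (f k) < snd (f (Suc k))" for k using f[of k] by (simp add: good_def)
  have ge: "k \<le> snd (f k)" for k
  proof (induction k)
    case (Suc k)
    then show ?case using lt[of k] by simp
  qed simp
  obtain x where x: "\<And>k. agree (snd (f k)) (fst (f k)) x"
    by (rule agree_limit[of "\<lambda>k. snd (f k)" "\<lambda>k. fst (f k)"]) (use f in \<open>auto simp: good_def\<close>)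
  have later: "same N (fst (f N)) (fst (f k))" if "N \<le> k" for N k
    using that
  proof (induction k rule: dec_induct)
    case (step k)
    then show ?case using f[of k] by (simp add: good_def same_def)
  qed (simp add: same_def)
  have same_x: "same N (fst (f N)) x" for N
    unfolding same_def
  proof (intro allI impI)
    fix j i assume j: "j < N"
    let ?k = "max N (Suc (prod_encode (j, i)))"
    have "fst (f N) (prod_encode (j, i)) = fst (f ?k) (prod_encode (j, i))"
      using later[of N ?k] j by (simp add: same_def)
    also have "\<dots> = x (prod_encode (j, i))"
      using x[of ?k] ge[of ?k] by (simp add: agree_def)
    finally show "fst (f N) (prod_encode (j, i)) = x (prod_encode (j, i))" .
  qed
  have "\<not> F N x" for N
  proof -
    have "same N (fst (f (Suc N))) x" using same_x[of "Suc N"] by (simp add: same_def)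
    then show ?thesis using f[of N] x[of "Suc N"] unfolding good_def by blast
  qed
  moreover have "fin x"
    unfolding fin_def
  proof
    fix j
    have "bit_column x j = bit_column (fst (f (Suc j))) j"
      using same_x[of "Suc j"] by (simp add: same_def bit_column_def)
    then show "finite (bit_column x j)" using fin_f[of "Suc j"] by (simp add: fin_def)
  qed
  ultimately show False using fin_F by blast
qed

section \<open>Lower bounds\<close>

lemma hausdorff_dist_zero_one: "hausdorff_dist {0} {1} \<ge> 1"
  using infdist_le_hausdorff[of "{0}" "{1}" 0] by (simp add: ne_compacts_def)

text \<open>On an oscillating sequence the approximations are infinitely often close to \<open>{0}\<close> and infinitely
  often close to \<open>{1}\<close>, so they cannot converge.\<close>

lemma we_not_in_Delta:
  assumes \<Omega>: "Omega_SA \<subseteq> \<Omega>" and ev: "ev \<in> {eval_1, eval_2}"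
  shows "we_problem \<Omega> ev \<notin> Delta General 2"
proof
  let ?p = "we_problem \<Omega> ev"
  have p [simp]: "inputs ?p = \<Omega>" "evals ?p = ev" "odist ?p = hausdorff_dist" "outs ?p = ne_compacts"
    "target ?p = ess_num_range"
    by (simp_all add: we_problem_def)
  assume "?p \<in> Delta General 2"
  then obtain k \<Gamma> where k: "1 \<le> k" "k < 2" and "tower ?p k \<Gamma>"
    unfolding Delta_def typed_tower_def by blast
  then have T: "tower ?p 1 \<Gamma>" by (metis One_nat_def le_antisym less_2_cases_iff less_one not_le numeral_2_eq_2)
  let ?\<kappa> = "switched (\<lambda>_. 1)"
  have \<kappa>: "?\<kappa> a \<in> \<Omega>" for a using switched_SA[of "\<lambda>_. 1"] \<Omega> by auto
  have loc: "\<exists>N. \<forall>b. agree N a b \<longrightarrow> \<Gamma> [n] (?\<kappa> b) = \<Gamma> [n] (?\<kappa> a)" for n a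
  proof (rule general_algorithm_locally_constant[where p = ?p])
    show "general_algorithm ?p (\<Gamma> [n])" using T unfolding tower_def by simp
    show "?\<kappa> a \<in> inputs ?p" for a using \<kappa> by simp
    show "\<exists>N. \<forall>a b. agree N a b \<longrightarrow> evals ?p n (?\<kappa> a) = evals ?p n (?\<kappa> b)" for n
      using switched_eval[OF _ _ ev, of "\<lambda>_. 1" n] by simp
  qed
  have ne: "\<Gamma> ns (?\<kappa> a) \<in> ne_compacts" if "length ns \<le> 1" for ns a
    using T that \<kappa> unfolding tower_def by (auto simp: Pi_iff)
  have lim: "(\<lambda>n. hausdorff_dist (\<Gamma> [n] (?\<kappa> a)) (\<Gamma> [] (?\<kappa> a))) \<longlonglongrightarrow> 0" for a
  proof -
    have "\<forall>ns. length ns < 1 \<longrightarrow>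
        (\<forall>A\<in>inputs ?p. (\<lambda>n. odist ?p (\<Gamma> (ns @ [n]) A) (\<Gamma> ns A)) \<longlonglongrightarrow> 0)"
      using T unfolding tower_def by blast
    from this[rule_format, of "[]" "?\<kappa> a"] \<kappa>[of a] show ?thesis by simp
  qed
  have tgt: "\<Gamma> [] (?\<kappa> a) = ess_num_range (?\<kappa> a)" for a
    using T \<kappa> unfolding tower_def by simp
  define near where "near z n a \<longleftrightarrow> hausdorff_dist (\<Gamma> [n] (?\<kappa> a)) {z} < 1 / 4" for z n a
  have near_loc: "\<exists>N. \<forall>b. agree N a b \<longrightarrow> near z n b" if "near z n a" for z n a
    using loc[of a n] that unfolding near_def by metis
  have near_lim: "\<exists>N. \<forall>n\<ge>N. near z n a" if z: "\<And>i. i \<ge> M \<Longrightarrow> of_bool (a i) = z" for z a M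
  proof -
    have "ess_num_range (?\<kappa> a) = {z}"
      unfolding switched_def
    proof (rule ess_num_range_diag_singleton)
      show "cmod (of_real (of_bool (a n) * 1)) \<le> 1" for n by simp
      fix e :: real assume "e > 0"
      then have "cmod (of_real (of_bool (a n) * 1) - z) \<le> e" if "n \<ge> M" for n
        using z[OF that, symmetric] by simp
      then show "\<exists>M. \<forall>n\<ge>M. cmod (of_real (of_bool (a n) * 1) - z) \<le> e" by blast
    qed
    then have "eventually (\<lambda>n. hausdorff_dist (\<Gamma> [n] (?\<kappa> a)) {z} < 1 / 4) sequentially"
      using order_tendstoD(2)[OF lim[of a], of "1 / 4"] tgt by simp
    then show ?thesis unfolding near_def eventually_sequentially .
  qed
  obtain a where a: "\<And>N. \<exists>n\<ge>N. near 0 n a" "\<And>N. \<exists>n\<ge>N. near 1 n a"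
  proof (rule oscillation[of "near 0" "near 1"])
    show "\<exists>N. \<forall>n\<ge>N. near 0 n a" if "\<forall>i\<ge>M. \<not> a i" for a M
      using that by (intro near_lim[of M]) auto
    show "\<exists>N. \<forall>n\<ge>N. near 1 n a" if "\<forall>i\<ge>M. a i" for a M
      using that by (intro near_lim[of M]) auto
  qed (use near_loc in blast)+
  let ?X = "\<Gamma> [] (?\<kappa> a)" and ?Y = "\<lambda>n. \<Gamma> [n] (?\<kappa> a)"
  have "eventually (\<lambda>n. hausdorff_dist (?Y n) ?X < 1 / 4) sequentially"
    using lim[of a] by (rule order_tendstoD) simp
  then obtain N where N: "\<And>n. n \<ge> N \<Longrightarrow> hausdorff_dist (?Y n) ?X < 1 / 4"
    unfolding eventually_sequentially by blast
  obtain n m where n: "n \<ge> N" "hausdorff_dist (?Y n) {0} < 1 / 4"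
    and m: "m \<ge> N" "hausdorff_dist (?Y m) {1} < 1 / 4"
    using a[of N] unfolding near_def by blast
  interpret Metric_space ne_compacts hausdorff_dist by (rule Metric_space_hausdorff)
  have pt: "{z} \<in> ne_compacts" for z by (simp add: ne_compacts_def)
  have X: "?X \<in> ne_compacts" and Y: "?Y n \<in> ne_compacts" for n using ne by simp_all
  have "hausdorff_dist {0} {1} \<le> hausdorff_dist {0} (?Y n) + hausdorff_dist (?Y n) {1}"
    by (rule triangle[OF pt Y pt])
  also have "hausdorff_dist (?Y n) {1} \<le> hausdorff_dist (?Y n) ?X + hausdorff_dist ?X {1}"
    by (rule triangle[OF Y X pt])
  also have "hausdorff_dist ?X {1} \<le> hausdorff_dist ?X (?Y m) + hausdorff_dist (?Y m) {1}"
    by (rule triangle[OF X Y pt])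
  finally have "hausdorff_dist {0} {1} < 1"
    using N[OF n(1)] N[OF m(1)] n(2) m(2) by (simp add: hausdorff_dist_commute[of "{0}" "?Y n"] hausdorff_dist_commute[of ?X "?Y m"])
  then show False using hausdorff_dist_zero_one by simp
qed

definition weight :: "nat \<Rightarrow> real" where
  "weight n = 1 / real (Suc (fst (prod_decode n)))"

lemma weight: "0 \<le> weight n" "weight n \<le> 1" "weight (prod_encode (j, i)) = 1 / real (Suc j)"
  by (simp_all add: weight_def)

lemma switched_weight_diag:
  "switched weight a = diag (\<lambda>n. of_real (of_bool (a n) * weight n))"
  "cmod (of_real (of_bool (a n) * weight n)) \<le> 1"
  by (simp_all add: switched_def switched_le[of weight] weight(1,2) del: of_real_mult)

text \<open>With finite columns the diagonal tends to zero, which reduces the essential numerical range to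
  \<open>{0}\<close>; and zero is an eigenvalue.\<close>

lemma no_pollution:
  assumes fin: "\<And>j. finite (bit_column a j)"
  shows "ess_num_range (switched weight a) \<subseteq> Sp (switched weight a)"
proof -
  let ?d = "\<lambda>n. complex_of_real (of_bool (a n) * weight n)"
  have "ess_num_range (diag ?d) = {0}"
  proof (rule ess_num_range_diag_singleton)
    show "cmod (?d n) \<le> 1" for n by (rule switched_weight_diag(2))
    fix e :: real assume "e > 0"
    then obtain J where J: "inverse (real (Suc J)) < e" using reals_Archimedean by blast
    let ?B = "\<Union>j\<le>J. (\<lambda>i. prod_encode (j, i)) ` bit_column a j"
    have "finite ?B" using fin by simp
    then have "\<exists>M. \<forall>n\<in>?B. n < M" by (simp only: finite_nat_set_iff_bounded)
    then obtain M where M: "\<forall>n\<in>?B. n < M" by (rule exE)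
    have "cmod (?d n - 0) \<le> e" if "n \<ge> M" for n
    proof (cases "a n")
      case True
      obtain j i where ji: "n = prod_encode (j, i)" by (metis prod_decode_inverse surj_pair)
      have "i \<in> bit_column a j" using True by (simp add: bit_column_def ji)
      have "\<not> j \<le> J"
      proof
        assume "j \<le> J"
        with \<open>i \<in> bit_column a j\<close> have "n \<in> ?B" unfolding ji by blast
        with M have "n < M" by (rule bspec)
        with that show False by simp
      qed
      then have "1 / real (Suc j) \<le> 1 / real (Suc J)" by (simp add: frac_le)
      then have "weight n \<le> e" using J by (simp add: ji weight(3) inverse_eq_divide)
      then show ?thesis using True weight(1)[of n] by simp
    next
      case False
      then show ?thesis using \<open>e > 0\<close> by simp
    qed
    then show "\<exists>M. \<forall>n\<ge>M. cmod (?d n - 0) \<le> e" by blast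
  qed
  moreover have "0 \<in> Sp (diag ?d)"
  proof -
    have "bit_column a 0 \<noteq> UNIV" using fin[of 0] infinite_UNIV_nat by metis
    then obtain i where i: "\<not> a (prod_encode (0, i))" by (auto simp: bit_column_def)
    let ?k = "prod_encode (0, i)"
    have "blinfun_apply (diag ?d) (ell2_basis ?k) = 0"
      using i by (simp add: diag_basis[of ?d, OF switched_weight_diag(2)[of a]] del: of_real_mult)
    moreover have "ell2_basis ?k \<noteq> 0" by (metis norm_basis norm_zero zero_neq_one)
    ultimately show ?thesis unfolding Sp_def mem_Collect_eq
      by (metis blinfun.zero_right diff_zero scaleC_simps(1))
  qed
  ultimately show ?thesis by (simp add: switched_weight_diag(1))
qed

text \<open>If column \<open>j\<close> is infinite, the essential numerical range contains the segment from \<open>0\<close> to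
  \<open>1 / (j + 1)\<close>, whereas the spectrum is contained in \<open>0\<close> and the points \<open>1 / (k + 1)\<close>.\<close>

lemma pollution:
  assumes inf: "infinite (bit_column a j)"
  shows "\<exists>z::real. of_real z \<in> ess_num_range (switched weight a) - Sp (switched weight a)"
proof -
  let ?d = "\<lambda>n. complex_of_real (of_bool (a n) * weight n)"
  have d: "cmod (?d n) \<le> 1" for n by (rule switched_weight_diag(2))
  have A: "diag ?d \<in> Omega_B" by (rule diag(2)) (rule d)
  define u v where "u = 1 / real (Suc j)" and "v = 1 / real (Suc (Suc j))"
  \<comment> \<open>\<open>z\<close> is the midpoint of the gap below \<open>1 / (j + 1)\<close>, and \<open>\<delta>\<close> its distance to the spectrum.\<close>
  define z \<delta> where "z = (u + v) / 2" and "\<delta> = (u - v) / 2"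
  have uv: "0 < v" "v < u" unfolding u_def v_def by (simp_all add: field_simps)
  have entry: "?d p \<in> tail_range (diag ?d) n" if "p \<ge> n" for p n
  proof -
    have "cinner (blinfun_apply (diag ?d) (ell2_basis p)) (ell2_basis p) \<in> tail_range (diag ?d) n"
      using that by (intro tail_range_I) auto
    then show ?thesis by (simp add: diag_basis[of ?d, OF d] cinner_scaleC_left cinner_self del: of_real_mult)
  qed
  have "of_real z \<in> closure (tail_range (diag ?d) n)" for n
  proof -
    obtain i where i: "i \<ge> n" "i \<in> bit_column a j"
      using inf by (metis infinite_nat_iff_unbounded_le)
    have "prod_encode (j, i) \<ge> n" using i(1) prod_encode_ge_snd[of i j] by simp
    from entry[OF this] have U: "of_real u \<in> closure (tail_range (diag ?d) n)"
      using i(2) closure_subset by (auto simp: bit_column_def weight(3) u_def)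
    have "(0::complex) \<in> closure (tail_range (diag ?d) n)"
      unfolding closure_approachable
    proof (intro allI impI)
      fix e :: real assume "e > 0"
      then obtain J where J: "inverse (real (Suc J)) < e" using reals_Archimedean by blast
      let ?p = "prod_encode (n + J, 0)"
      have "?p \<ge> n" using le_prod_encode_1[of "n + J" 0] by simp
      from entry[OF this] have "?d ?p \<in> tail_range (diag ?d) n" .
      moreover have "cmod (?d ?p) < e"
      proof -
        have "cmod (?d ?p) \<le> 1 / real (Suc (n + J))"
          unfolding norm_of_real using weight(3)[of "n + J" 0] by simp
        also have "\<dots> \<le> 1 / real (Suc J)" by (simp add: frac_le)
        finally show ?thesis using J by (simp add: inverse_eq_divide)
      qed
      ultimately show "\<exists>y\<in>tail_range (diag ?d) n. dist y 0 < e" by (auto simp: dist_norm)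
    qed
    moreover have "convex (closure (tail_range (diag ?d) n))"
      by (intro convex_closure convex_tail_range A)
    moreover have "0 \<le> z / u" "z / u \<le> 1" using uv by (auto simp: z_def)
    ultimately have "(1 - z / u) *\<^sub>R 0 + (z / u) *\<^sub>R complex_of_real u \<in> closure (tail_range (diag ?d) n)"
      using U unfolding convex_alt by blast
    then show ?thesis using uv by (simp add: scaleR_conv_of_real)
  qed
  then have "of_real z \<in> ess_num_range (diag ?d)" by (simp only: ess_num_range_eq[OF A]) blast
  moreover have "of_real z \<notin> Sp (diag ?d)"
  proof -
    have gap: "\<delta> \<le> \<bar>of_bool (a n) * weight n - z\<bar>" for n
    proof (cases "a n")
      case True
      obtain k i where n: "n = prod_encode (k, i)" by (metis prod_decode_inverse surj_pair)
      show ?thesis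
      proof (cases "k \<le> j")
        case True
        then have "u \<le> weight n" unfolding n weight(3) u_def by (simp add: frac_le)
        then have "\<delta> \<le> weight n - z" by (simp add: z_def \<delta>_def field_simps)
        then show ?thesis using \<open>a n\<close> by simp
      next
        case False
        then have "weight n \<le> v" unfolding n weight(3) v_def by (intro divide_left_mono) auto
        then have "\<delta> \<le> z - weight n" by (simp add: z_def \<delta>_def field_simps)
        then show ?thesis using \<open>a n\<close> by simp
      qed
    next
      case False
      then show ?thesis using uv by (simp add: z_def \<delta>_def)
    qed
    have low: "\<delta>\<^sup>2 * (norm x)\<^sup>2 \<le> (norm (blinfun_apply (diag ?d) x - scaleC (of_real z) x))\<^sup>2" for x
    proof -
      have nth: "ell2_nth (blinfun_apply (diag ?d) x - scaleC (of_real z) x) n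
          = of_real (of_bool (a n) * weight n - z) * ell2_nth x n" for n
        unfolding minus_ell2.rep_eq scaleC.rep_eq diag(1)[of ?d, OF d] of_real_diff left_diff_distrib
        by (rule refl)
      have "\<delta>\<^sup>2 * (norm x)\<^sup>2 = (\<Sum>n. \<delta>\<^sup>2 * (cmod (ell2_nth x n))\<^sup>2)"
        by (simp add: norm_sq_suminf suminf_mult[OF summable_cmod_sq])
      also have "\<dots> \<le> (\<Sum>n. (cmod (ell2_nth (blinfun_apply (diag ?d) x - scaleC (of_real z) x) n))\<^sup>2)"
      proof (intro suminf_le summable_cmod_sq summable_mult)
        fix n
        show "\<delta>\<^sup>2 * (cmod (ell2_nth x n))\<^sup>2 \<le> (cmod (ell2_nth (blinfun_apply (diag ?d) x - scaleC (of_real z) x) n))\<^sup>2"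
          unfolding nth norm_mult power_mult_distrib norm_of_real
          using gap[of n] uv by (intro mult_right_mono power_mono) (auto simp: \<delta>_def)
      qed
      also have "\<dots> = (norm (blinfun_apply (diag ?d) x - scaleC (of_real z) x))\<^sup>2"
        by (simp only: norm_sq_suminf)
      finally show ?thesis .
    qed
    have "adj (diag ?d) = diag ?d" by (rule adj_diag) (use d in auto)
    then show ?thesis unfolding not_in_Sp_iff[OF A]
      using low uv by (intro exI[of _ "\<delta>\<^sup>2"]) (simp add: \<delta>_def)
  qed
  ultimately show ?thesis unfolding switched_weight_diag(1) by blast
qed

lemma not_in_Delta_3:
  fixes p :: "('a, nat) problem"
  assumes p: "odist p = discrete_metric.dd" "outs p = {0, 1}" and \<kappa>: "\<And>a. \<kappa> a \<in> inputs p"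
    and ev: "\<And>n. \<exists>N. \<forall>a b. agree N a b \<longrightarrow> evals p n (\<kappa> a) = evals p n (\<kappa> b)"
    and target: "\<And>a. target p (\<kappa> a) = of_bool (\<exists>j. infinite (bit_column a j))"
  shows "p \<notin> Delta General 3"
proof
  assume "p \<in> Delta General 3"
  then obtain k \<Gamma> where k: "1 \<le> k" "k < 3" and T: "tower p k \<Gamma>"
    unfolding Delta_def typed_tower_def by blast
  have lim: "\<exists>N. \<forall>n\<ge>N. \<Gamma> (ns @ [n]) (\<kappa> a) = \<Gamma> ns (\<kappa> a)" if "length ns < k" for ns a
  proof -
    have "(\<lambda>n. odist p (\<Gamma> (ns @ [n]) (\<kappa> a)) (\<Gamma> ns (\<kappa> a))) \<longlonglongrightarrow> 0"
      using T that \<kappa>[of a] unfolding tower_def by blast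
    then show ?thesis unfolding p(1) dd_tendsto_zero_iff .
  qed
  have loc: "\<exists>N. \<forall>b. agree N a b \<longrightarrow> \<Gamma> ns (\<kappa> b) = \<Gamma> ns (\<kappa> a)" if "length ns = k" for ns a
  proof (rule general_algorithm_locally_constant[where p = p])
    show "general_algorithm p (\<Gamma> ns)" using T that unfolding tower_def by blast
  qed (use \<kappa> ev in blast)+
  have tgt: "\<Gamma> [] (\<kappa> a) = of_bool (\<exists>j. infinite (bit_column a j))" for a
    using T \<kappa>[of a] target[of a] unfolding tower_def by simp
  \<comment> \<open>A tower of height one is treated as one of height two whose inner limit is constant.\<close>
  define index where "index n m = (if k = 1 then [n] else [n, m])" for n m :: nat
  have index: "length (index n m) = k" for n m using k by (auto simp: index_def)
  show False
  proof (rule infinite_column_not_double_limit[of "\<lambda>n m a. \<Gamma> (index n m) (\<kappa> a) = 1" "\<lambda>n a. \<Gamma> [n] (\<kappa> a) = 1"])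
    show "\<exists>N. \<forall>b. agree N a b \<longrightarrow> (\<Gamma> (index n m) (\<kappa> b) = 1) = (\<Gamma> (index n m) (\<kappa> a) = 1)" for n m a
      using loc[OF index] by metis
    show "\<exists>M. \<forall>m\<ge>M. (\<Gamma> (index n m) (\<kappa> a) = 1) = (\<Gamma> [n] (\<kappa> a) = 1)" for n a
    proof (cases "k = 1")
      case True
      then show ?thesis by (simp add: index_def)
    next
      case False
      then obtain N where "\<forall>m\<ge>N. \<Gamma> ([n] @ [m]) (\<kappa> a) = \<Gamma> [n] (\<kappa> a)"
        using lim[of "[n]" a] k by auto
      then show ?thesis using False by (intro exI[of _ N]) (simp add: index_def)
    qed
    show "\<exists>N. \<forall>n\<ge>N. (\<Gamma> [n] (\<kappa> a) = 1) = (\<exists>j. infinite (bit_column a j))" for a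
    proof -
      obtain N where N: "\<forall>n\<ge>N. \<Gamma> ([] @ [n]) (\<kappa> a) = \<Gamma> [] (\<kappa> a)" using lim[of "[]" a] k by auto
      have "(\<Gamma> [n] (\<kappa> a) = 1) = (\<exists>j. infinite (bit_column a j))" if "n \<ge> N" for n
        using N[rule_format, OF that] unfolding tgt append.simps by (simp only: of_bool_eq_1_iff)
      then show ?thesis by blast
    qed
  qed
qed

lemma real_poll_not_in_Delta:
  assumes ev: "ev \<in> {eval_1, eval_2}" and U: "(\<lambda>_. (-\<infinity>, \<infinity>)) \<in> \<U>"
  shows "real_poll_problem Omega_SA \<U> ev \<notin> Delta General 3"
proof (rule not_in_Delta_3[where \<kappa> = "\<lambda>a. (switched weight a, \<lambda>_. (-\<infinity>, \<infinity>))"])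
  let ?p = "real_poll_problem Omega_SA \<U> ev" and ?U = "\<lambda>_ :: nat. (-\<infinity>, \<infinity>) :: ereal \<times> ereal"
  have p: "inputs ?p = Omega_SA \<times> \<U>" "evals ?p = real_poll_eval ev" "target ?p = real_poll"
    by (simp_all add: real_poll_problem_def decision_problem_def)
  show "odist ?p = discrete_metric.dd" "outs ?p = {0, 1}"
    by (simp_all add: real_poll_problem_def decision_problem_def)
  show "(switched weight a, ?U) \<in> inputs ?p" for a
    using switched_SA[of weight a] weight U by (simp add: p)
  show "\<exists>N. \<forall>a b. agree N a b \<longrightarrow> evals ?p n (switched weight a, ?U) = evals ?p n (switched weight b, ?U)" for n
    using switched_eval[OF weight(1,2) ev, of "n div 3"] by (simp add: p real_poll_eval_def interleave_def)
  show "target ?p (switched weight a, ?U) = of_bool (\<exists>j. infinite (bit_column a j))" for a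
  proof -
    have "(\<Union>m. real_ball (?U m)) = UNIV" by (simp add: real_ball_def)
    then have "real_poll (switched weight a, ?U) =
        (if range complex_of_real \<inter> (ess_num_range (switched weight a) - Sp (switched weight a)) \<noteq> {} then 1 else 0)"
      by (simp add: real_poll_def)
    moreover have "ess_num_range (switched weight a) - Sp (switched weight a) = {}" if "\<not> (\<exists>j. infinite (bit_column a j))"
      using no_pollution[of a] that by blast
    moreover have "\<exists>z::real. of_real z \<in> ess_num_range (switched weight a) - Sp (switched weight a)" if "\<exists>j. infinite (bit_column a j)"
      using pollution[of a] that by blast
    ultimately show ?thesis unfolding p by (cases "\<exists>j. infinite (bit_column a j)") auto
  qed
qed

lemma complex_poll_not_in_Delta:
  assumes ev: "ev \<in> {eval_1, eval_2}" and U: "(\<lambda>_. (\<infinity>, 0)) \<in> \<U>"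
  shows "complex_poll_problem Omega_B \<U> ev \<notin> Delta General 3"
proof (rule not_in_Delta_3[where \<kappa> = "\<lambda>a. (switched weight a, \<lambda>_. (\<infinity>, 0))"])
  let ?p = "complex_poll_problem Omega_B \<U> ev" and ?U = "\<lambda>_ :: nat. (\<infinity>, 0) :: ereal \<times> complex"
  have p: "inputs ?p = Omega_B \<times> \<U>" "evals ?p = complex_poll_eval ev" "target ?p = complex_poll"
    by (simp_all add: complex_poll_problem_def decision_problem_def)
  show "odist ?p = discrete_metric.dd" "outs ?p = {0, 1}"
    by (simp_all add: complex_poll_problem_def decision_problem_def)
  show "(switched weight a, ?U) \<in> inputs ?p" for a
    using switched_SA[of weight a] weight U by (simp add: p Omega_SA_def)
  show "\<exists>N. \<forall>a b. agree N a b \<longrightarrow> evals ?p n (switched weight a, ?U) = evals ?p n (switched weight b, ?U)" for n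
    using switched_eval[OF weight(1,2) ev, of "n div 3"] by (simp add: p complex_poll_eval_def interleave_def)
  show "target ?p (switched weight a, ?U) = of_bool (\<exists>j. infinite (bit_column a j))" for a
  proof -
    have "(\<Union>m. complex_ball (?U m)) = UNIV" by (simp add: complex_ball_def)
    then have "complex_poll (switched weight a, ?U) =
        (if ess_num_range (switched weight a) - Sp (switched weight a) \<noteq> {} then 1 else 0)"
      by (simp add: complex_poll_def)
    moreover have "ess_num_range (switched weight a) - Sp (switched weight a) = {}" if "\<not> (\<exists>j. infinite (bit_column a j))"
      using no_pollution[of a] that by blast
    moreover have "\<exists>z::real. of_real z \<in> ess_num_range (switched weight a) - Sp (switched weight a)" if "\<exists>j. infinite (bit_column a j)"
      using pollution[of a] that by blast
    ultimately show ?thesis unfolding p by (cases "\<exists>j. infinite (bit_column a j)") auto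
  qed
qed

lemma Omega_inclusions: "Omega_SA \<subseteq> Omega_N" "Omega_N \<subseteq> Omega_B" "Omega_SA \<subseteq> Omega_B"
  by (auto simp: Omega_SA_def Omega_N_def)

theorem theorem3p10:
  shows "(\<forall>\<Omega> \<in> {Omega_N, Omega_SA, Omega_B}. \<forall>ev \<in> {eval_1, eval_2}.
            we_problem \<Omega> ev \<notin> Delta General 2 \<and>
            we_problem \<Omega> ev \<in> Pi_Haus Arithmetic 2) \<and>
         (\<forall>\<U> \<in> {real_ball_seqs, single real_ball_seqs,
                 {U \<in> single real_ball_seqs. real_ball (U 0) = UNIV}}. \<forall>ev \<in> {eval_1, eval_2}.
            real_poll_problem Omega_SA \<U> ev \<notin> Delta General 3 \<and>
            real_poll_problem Omega_SA \<U> ev \<in> Sigma_dec Arithmetic 3) \<and>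
         (\<forall>\<U> \<in> {complex_ball_seqs, single complex_ball_seqs,
                 {U \<in> single complex_ball_seqs. complex_ball (U 0) = UNIV}}. \<forall>ev \<in> {eval_1, eval_2}.
            complex_poll_problem Omega_B \<U> ev \<notin> Delta General 3 \<and>
            complex_poll_problem Omega_B \<U> ev \<in> Sigma_dec Arithmetic 3)"
proof (intro conjI ballI)
  fix \<Omega> and ev :: "nat \<Rightarrow> op2 \<Rightarrow> complex"
  assume \<Omega>: "\<Omega> \<in> {Omega_N, Omega_SA, Omega_B}" and ev: "ev \<in> {eval_1, eval_2}"
  then have incl: "Omega_SA \<subseteq> \<Omega>" "\<Omega> \<subseteq> Omega_B" using Omega_inclusions by auto
  show "we_problem \<Omega> ev \<notin> Delta General 2" by (rule we_not_in_Delta[OF incl(1) ev])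
  show "we_problem \<Omega> ev \<in> Pi_Haus Arithmetic 2"
    using ev we_in_Pi[OF incl(2), of 1 eval_1] we_in_Pi[OF incl(2), of 3 eval_2] matrix_oracle_eval by blast
next
  fix \<U> and ev :: "nat \<Rightarrow> op2 \<Rightarrow> complex"
  assume \<U>: "\<U> \<in> {real_ball_seqs, single real_ball_seqs,
    {U \<in> single real_ball_seqs. real_ball (U 0) = UNIV}}" and ev: "ev \<in> {eval_1, eval_2}"
  have "(\<lambda>_. (-\<infinity>, \<infinity>)) \<in> \<U>"
    using \<U> by (auto simp: single_def real_ball_seqs_def ext_rat_def real_ball_def)
  then show "real_poll_problem Omega_SA \<U> ev \<notin> Delta General 3" by (rule real_poll_not_in_Delta[OF ev])
  have "\<U> \<subseteq> real_ball_seqs" using \<U> by (auto simp: single_def)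
  then show "real_poll_problem Omega_SA \<U> ev \<in> Sigma_dec Arithmetic 3"
    using ev real_poll_in_Sigma[of 1 eval_1 \<U>] real_poll_in_Sigma[of 3 eval_2 \<U>] matrix_oracle_eval by blast
next
  fix \<U> and ev :: "nat \<Rightarrow> op2 \<Rightarrow> complex"
  assume \<U>: "\<U> \<in> {complex_ball_seqs, single complex_ball_seqs,
    {U \<in> single complex_ball_seqs. complex_ball (U 0) = UNIV}}" and ev: "ev \<in> {eval_1, eval_2}"
  have "(\<lambda>_. (\<infinity>, 0)) \<in> \<U>"
    using \<U> by (auto simp: single_def complex_ball_seqs_def ext_rat_def complex_ball_def gauss_rat_def)
  then show "complex_poll_problem Omega_B \<U> ev \<notin> Delta General 3" by (rule complex_poll_not_in_Delta[OF ev])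
  have "\<U> \<subseteq> complex_ball_seqs" using \<U> by (auto simp: single_def)
  then show "complex_poll_problem Omega_B \<U> ev \<in> Sigma_dec Arithmetic 3"
    using ev complex_poll_in_Sigma[of 1 eval_1 \<U>] complex_poll_in_Sigma[of 3 eval_2 \<U>] matrix_oracle_eval by blast
qed

end
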